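(* Let $q\in[1,\infty]$ and let $V\in L^q[0,1]$ be non-negative. Define $\det\mathscr{T}_V=e^{-\zeta'_{\mathscr{T}_V}(0)}$, where $\zeta_{\mathscr{T}_V}$ denotes the meromorphic continuation of the spectral zeta function. Then \[ \det\mathscr{T}_V=2y(1), \] where $y$ is the solution of $-y''+Vy=0$ on $[0,1]$ with $y(0)=0$, $y'(0)=1$.
   Context: $\mathscr{T}_V$ denotes the operator $\phi\mapsto-\phi''+V\phi$ on $L^2[0,1]$ with Dirichlet boundary conditions $\phi(0)=\phi(1)=0$. Its eigenvalues $\lambda_n$ are positive. The series $\zeta_{\mathscr{T}_V}(s)=\sum_n\lambda_n^{-s}$ converges for $\mathrm{Re}(s)>1/2$ and continues meromorphically to $\mathrm{Re}(s)>-1/2$, where it is analytic at $s=0$. *)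

theory Defs
  imports "HOL-Analysis.Analysis" "HOL-Complex_Analysis.Complex_Analysis"
begin

definition memLq :: "ennreal \<Rightarrow> (real \<Rightarrow> real) \<Rightarrow> bool" where
  "memLq q V \<longleftrightarrow> V \<in> borel_measurable (restrict_space lborel {0..1}) \<and>
     (if q = \<infinity> then (\<exists>C. AE x in lborel. x \<in> {0..1} \<longrightarrow> \<bar>V x\<bar> \<le> C)
      else set_integrable lborel {0..1::real} (\<lambda>x. \<bar>V x\<bar> powr enn2real q))"

text \<open>phi is a (Caratheodory) solution of  -phi'' + V phi = lam phi  on [0,1]
  with derivative dphi: phi and dphi are absolutely continuous,
  phi' = dphi and dphi' = (V - lam) phi almost everywhere.\<close>
definition ode_sol :: "(real \<Rightarrow> real) \<Rightarrow> real \<Rightarrow> (real \<Rightarrow> real) \<Rightarrow> (real \<Rightarrow> real) \<Rightarrow> bool" where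
  "ode_sol V lam phi dphi \<longleftrightarrow>
     set_integrable lborel {0..1::real} dphi \<and>
     set_integrable lborel {0..1::real} (\<lambda>t. (V t - lam) * phi t) \<and>
     (\<forall>x\<in>{0..1}. phi x = phi 0 + (LINT t:{0..x}|lborel. dphi t) \<and>
                  dphi x = dphi 0 + (LINT t:{0..x}|lborel. (V t - lam) * phi t))"

definition dirichlet_eigenvalues :: "(real \<Rightarrow> real) \<Rightarrow> real set" where
  "dirichlet_eigenvalues V = {lam. \<exists>phi dphi. ode_sol V lam phi dphi \<and> phi 0 = 0 \<and> phi 1 = 0 \<and>
                                   (\<exists>x\<in>{0..1}. phi x \<noteq> 0)}"

text \<open>Spectral zeta function (as a series over the eigenvalues; they are simple).\<close>
definition spectral_zeta :: "(real \<Rightarrow> real) \<Rightarrow> complex \<Rightarrow> complex" where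
  "spectral_zeta V s = (\<Sum>\<^sub>\<infinity>lam\<in>dirichlet_eigenvalues V. complex_of_real lam powr (- s))"

definition zeta_continuation :: "(real \<Rightarrow> real) \<Rightarrow> (complex \<Rightarrow> complex) \<Rightarrow> bool" where
  "zeta_continuation V Z \<longleftrightarrow>
     Z meromorphic_on {s. Re s > -1/2} \<and> Z analytic_on {0} \<and>
     (\<forall>s. Re s > 1/2 \<longrightarrow>
        (\<lambda>lam. complex_of_real lam powr (- s)) summable_on dirichlet_eigenvalues V \<and>
        Z s = spectral_zeta V s)"

end

theory Submission
  imports Defs "HOL-Real_Asymp.Real_Asymp"
begin

text \<open>
  Let \<open>D l = sol l 1\<close>, where \<open>sol l\<close> solves the initial value problem
  \<open>-y'' + V y = l y\<close>, \<open>y(0) = 0\<close>, \<open>y'(0) = 1\<close>. It is an entire function of \<open>l\<close>; since \<open>V\<close> is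
  non-negative, its zeros are positive and simple, and they are the Dirichlet eigenvalues. The
  Volterra equation gives \<open>D (z\<^sup>2) = sin z / z + O(exp \<bar>Im z\<bar> / \<bar>z\<bar>\<^sup>2)\<close>. Rouche's theorem on the circles
  of radius \<open>((N + 1/2) \<pi>)\<^sup>2\<close> then yields an enumeration \<open>e n\<close> (from \<open>n = 1\<close>) of the eigenvalues with
  \<open>e n = (n \<pi>)\<^sup>2 + O(1)\<close>, and comparing \<open>D\<close> with the free function \<open>sin z / z\<close> on the same circles
  after dividing out Blaschke factors yields \<open>D 0 = \<Prod>n. e n / (n \<pi>)\<^sup>2\<close>.

  Because of the \<open>O(1)\<close> error, the difference between the zeta series of \<open>V\<close> and that of the free
  operator, a rescaled Riemann zeta function, converges for \<open>Re s > -1/2\<close> and may be differentiated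
  termwise at \<open>0\<close>. This contributes \<open>- ln (D 0)\<close> to the derivative, while the free operator
  contributes \<open>- ln 2\<close>, which is Stirling's formula, that is, Wallis' product.
\<close>

section \<open>Absolutely continuous functions on the unit interval\<close>

text \<open>Since \<open>V\<close> is merely integrable, solutions need not be twice differentiable
  in the classical sense. The ODE part therefore rests on a product rule for \<open>ac\<close>,
  which comes from Fubini, and on Gronwall's inequality with an integrable weight. Self-adjointness
  enters only through two integral identities: pairing the equation with \<open>cnj y\<close> makes
  the zeros of \<open>D\<close> positive, and the Lagrange identity makes them simple. Simplicity
  lets Rouche's theorem count points, which is what a sum over the set
  \<open>dirichlet_eigenvalues V\<close> needs. On the chosen circles \<open>norm (sin z)\<close>
  stays above a fixed multiple of \<open>exp \<bar>Im z\<bar>\<close>, so \<open>D / D0\<close>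
  tends to 1 uniformly there. With equally many zeros inside, the powers of the radius in Jensen's
  formula cancel; values at 0 and products of zeros can then be compared without Hadamard
  factorization. The free function \<open>D0\<close> is the instance \<open>V = 0\<close> of the
  same construction, hence entire without treating the singularity of \<open>sin z / z\<close>. The
  zeta series is compared term by term with integrals of powers, and convergence in Stirling's
  formula is a by-product of termwise differentiability; only the limit has to be
  identified.\<close>

text \<open>\<open>ac F f\<close>: on the unit interval \<open>F\<close> is absolutely continuous with almost everywhere
  derivative \<open>f\<close>, expressed as an indefinite Lebesgue integral as in \<open>ode_sol\<close>.\<close>
definition ac :: "(real \<Rightarrow> 'a::euclidean_space) \<Rightarrow> (real \<Rightarrow> 'a) \<Rightarrow> bool" where
  "ac F f \<longleftrightarrow> set_integrable lborel {0..1} f \<and>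
     (\<forall>x\<in>{0..1}. F x = F 0 + (LINT t:{0..x}|lborel. f t))"

lemma ac_integrable: "ac F f \<Longrightarrow> set_integrable lborel {0..1} f"
  by (simp add: ac_def)

lemma ac_eq: "ac F f \<Longrightarrow> x \<in> {0..1} \<Longrightarrow> F x = F 0 + (LINT t:{0..x}|lborel. f t)"
  unfolding ac_def by blast

lemma set_integrable_Icc_sub:
  fixes f :: "real \<Rightarrow> 'a::euclidean_space"
  assumes "set_integrable lborel {0..1} f" "x \<le> 1"
  shows "set_integrable lborel {0..x} f"
  by (rule set_integrable_subset[OF assms(1)]) (use assms(2) in auto)

lemma set_integral_singleton [simp]: 
  "(LINT t:{a::real}|lborel. f t) = (0 :: 'a::euclidean_space)"
proof -
  have "(LINT t:{a}|lborel. f t) = (LINT t:{a}|lborel. f a)"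
    unfolding set_lebesgue_integral_def by (intro Bochner_Integration.integral_cong) (auto simp: indicator_def)
  then show ?thesis by (simp add: set_lebesgue_integral_def)
qed

lemma ac_continuous:
  assumes "ac F f" shows "continuous_on {0..1} F"
proof -
  have "f integrable_on {0..1}"
    using set_borel_integral_eq_integral(1)[OF ac_integrable[OF assms]] .
  then have "continuous_on {0..1} (\<lambda>x. F 0 + integral {0..x} f)"
    by (intro continuous_intros indefinite_integral_continuous_1)
  moreover have "F 0 + integral {0..x} f = F x" if "x \<in> {0..1}" for x
  proof -
    have "set_integrable lborel {0..x} f"
      using set_integrable_Icc_sub[OF ac_integrable[OF assms]] that by simp
    then show ?thesis
      unfolding ac_eq[OF assms that] by (simp only: set_borel_integral_eq_integral(2))
  qed
  ultimately show ?thesis by (rule continuous_on_eq)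
qed

lemma ac_integral:
  assumes "set_integrable lborel {0..1} f"
  shows "ac (\<lambda>x. c + (LINT t:{0..x}|lborel. f t)) f"
  using assms by (simp add: ac_def)

lemma ac_cong:
  assumes "\<And>x. x \<in> {0..1} \<Longrightarrow> F x = G x" "\<And>x. x \<in> {0..1} \<Longrightarrow> f x = g x" 
  shows "ac F f \<longleftrightarrow> ac G g"
proof -
  have 1: "set_integrable lborel {0..1} f \<longleftrightarrow> set_integrable lborel {0..1} g"
    by (rule set_integrable_cong) (use assms in auto)
  have 2: "(LINT t:{0..x}|lborel. f t) = (LINT t:{0..x}|lborel. g t)" if "x \<in> {0..1}" for x
    by (rule set_lebesgue_integral_cong) (use assms that in auto)
  show ?thesis unfolding ac_def using 1 2 assms(1) by (metis atLeastAtMost_iff order_refl zero_le_one)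
qed

lemma ac_add: 
  assumes "ac F f" "ac G g" shows "ac (\<lambda>x. F x + G x) (\<lambda>x. f x + g x)"
  unfolding ac_def
proof safe
  show "set_integrable lborel {0..1} (\<lambda>x. f x + g x)"
    using assms by (intro set_integral_add(1) ac_integrable)
  fix x :: real assume x: "x \<in> {0..1}"
  have "(LINT t:{0..x}|lborel. f t + g t) = (LINT t:{0..x}|lborel. f t) + (LINT t:{0..x}|lborel. g t)"
    by (rule set_integral_add(2); rule set_integrable_Icc_sub) (use assms x in \<open>auto intro: ac_integrable\<close>)
  then show "F x + G x = F 0 + G 0 + (LINT t:{0..x}|lborel. f t + g t)"
    unfolding ac_eq[OF assms(1) x] ac_eq[OF assms(2) x] by (simp add: algebra_simps)
qed

lemma ac_diff: 
  assumes "ac F f" "ac G g" shows "ac (\<lambda>x. F x - G x) (\<lambda>x. f x - g x)"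
  unfolding ac_def
proof safe
  show "set_integrable lborel {0..1} (\<lambda>x. f x - g x)"
    using assms by (intro set_integral_diff(1) ac_integrable)
  fix x :: real assume x: "x \<in> {0..1}"
  have "(LINT t:{0..x}|lborel. f t - g t) = (LINT t:{0..x}|lborel. f t) - (LINT t:{0..x}|lborel. g t)"
    by (rule set_integral_diff(2); rule set_integrable_Icc_sub) (use assms x in \<open>auto intro: ac_integrable\<close>)
  then show "F x - G x = F 0 - G 0 + (LINT t:{0..x}|lborel. f t - g t)"
    unfolding ac_eq[OF assms(1) x] ac_eq[OF assms(2) x] by (simp add: algebra_simps)
qed

lemma ac_linear:
  assumes "bounded_linear T" "ac F f" shows "ac (\<lambda>x. T (F x)) (\<lambda>x. T (f x))"
proof -
  interpret bounded_linear T by fact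
  have i: "set_integrable lborel {0..x} (\<lambda>x. T (f x)) \<and> (LINT t:{0..x}|lborel. T (f t)) = T (LINT t:{0..x}|lborel. f t)" if "x \<le> 1" for x
    using integrable_bounded_linear[OF assms(1), of lborel "\<lambda>t. indicator {0..x} t *\<^sub>R f t"]
      integral_bounded_linear[OF assms(1), of lborel "\<lambda>t. indicator {0..x} t *\<^sub>R f t"]
      set_integrable_Icc_sub[OF ac_integrable[OF assms(2)] that]
    by (simp add: set_integrable_def set_lebesgue_integral_def scaleR)
  show ?thesis unfolding ac_def
  proof safe
    show "set_integrable lborel {0..1} (\<lambda>x. T (f x))" using i[of 1] by simp
    fix x :: real assume "x \<in> {0..1}"
    then show "T (F x) = T (F 0) + (LINT t:{0..x}|lborel. T (f t))"
      using i[of x] ac_eq[OF assms(2), of x] by (simp add: add)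
  qed
qed

lemma ac_cmult:
  fixes c :: "'a::{euclidean_space,real_normed_field}"
  shows "ac F f \<Longrightarrow> ac (\<lambda>x. c * F x) (\<lambda>x. c * f x)"
  by (rule ac_linear[OF bounded_linear_mult_right])

lemma ac_C1:
  assumes "\<And>x. x \<in> {0..1} \<Longrightarrow> (F has_vector_derivative f x) (at x within {0..1})"
    and "continuous_on {0..1} f"
  shows "ac F f"
  unfolding ac_def
proof safe
  show i: "set_integrable lborel {0..1} f" by (rule borel_integrable_atLeastAtMost'[OF assms(2)])
  fix x :: real assume x: "x \<in> {0..1}"
  have "(f has_integral (F x - F 0)) {0..x}"
    by (rule fundamental_theorem_of_calculus) 
      (use x in \<open>auto intro!: has_vector_derivative_within_subset[OF assms(1)]\<close>)
  then have "integral {0..x} f = F x - F 0" by blast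
  moreover have "(LINT t:{0..x}|lborel. f t) = integral {0..x} f"
    using set_borel_integral_eq_integral(2)[OF set_integrable_Icc_sub[OF i]] x by simp
  ultimately show "F x = F 0 + (LINT t:{0..x}|lborel. f t)" by simp
qed

text \<open>Integration by parts: the product is a double integral over the plane, cut along the
  diagonal into \<open>t \<le> s\<close> and \<open>s \<le> t\<close>. Both halves contain the
  diagonal, which is harmless because it meets each line in a null set. Fubini is applied in
  opposite orders to the two halves.\<close>

lemma integral_mult_split:
  fixes f g :: "real \<Rightarrow> 'a::{euclidean_space,real_normed_field}"
  assumes f: "integrable lborel f" and g: "integrable lborel g"
  shows "(LINT s|lborel. f s) * (LINT t|lborel. g t) =
     (LINT s|lborel. f s * (LINT t:{..s}|lborel. g t)) + (LINT t|lborel. (LINT s:{..t}|lborel. f s) * g t)"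
    and "integrable lborel (\<lambda>s. f s * (LINT t:{..s}|lborel. g t))"
    and "integrable lborel (\<lambda>t. (LINT s:{..t}|lborel. f s) * g t)"
proof -
  have [measurable]: "f \<in> borel_measurable borel" "g \<in> borel_measurable borel" using f g by auto
  have H: "integrable (lborel \<Otimes>\<^sub>M lborel) (\<lambda>(s,t). f s * g t)"
  proof (rule lborel_pair.Fubini_integrable)
    show "(\<lambda>(s,t). f s * g t) \<in> borel_measurable (lborel \<Otimes>\<^sub>M lborel)" by measurable
    show "integrable lborel (\<lambda>x. LINT y|lborel. norm (case (x, y) of (s, t) \<Rightarrow> f s * g t))"
      using f by (simp add: norm_mult)
    show "AE x in lborel. integrable lborel (\<lambda>y. case (x, y) of (s, t) \<Rightarrow> f s * g t)"
      using g by simp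
  qed
  define A where "A = (\<lambda>s t. if t \<le> s then f s * g t else 0)"
  define B where "B = (\<lambda>s t. if s \<le> t then f s * g t else 0)"
  have A: "integrable (lborel \<Otimes>\<^sub>M lborel) (case_prod A)"
  proof (rule Bochner_Integration.integrable_bound[OF H])
    show "case_prod A \<in> borel_measurable (lborel \<Otimes>\<^sub>M lborel)" unfolding A_def by measurable
  qed (auto simp: A_def norm_mult indicator_def)
  have B: "integrable (lborel \<Otimes>\<^sub>M lborel) (case_prod B)"
  proof (rule Bochner_Integration.integrable_bound[OF H])
    show "case_prod B \<in> borel_measurable (lborel \<Otimes>\<^sub>M lborel)" unfolding B_def by measurable
  qed (auto simp: B_def norm_mult indicator_def)
  have A1: "(LINT t|lborel. A s t) = f s * (LINT t:{..s}|lborel. g t)" for s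
  proof -
    have "A s = (\<lambda>t. f s * (indicator {..s} t *\<^sub>R g t))" by (auto simp: A_def fun_eq_iff)
    then show ?thesis by (simp only: set_lebesgue_integral_def integral_mult_right_zero integral_mult_left_zero)
  qed
  have B1: "(LINT s|lborel. B s t) = (LINT s:{..t}|lborel. f s) * g t" for t
  proof -
    have "(\<lambda>s. B s t) = (\<lambda>s. (indicator {..t} s *\<^sub>R f s) * g t)" by (auto simp: B_def fun_eq_iff)
    then show ?thesis by (simp only: set_lebesgue_integral_def integral_mult_right_zero integral_mult_left_zero)
  qed
  have "(LINT s|lborel. f s) * (LINT t|lborel. g t) = (LINT s|lborel. LINT t|lborel. f s * g t)"
    by simp
  also have "\<dots> = (LINT s|lborel. LINT t|lborel. A s t + B s t)"
  proof (rule Bochner_Integration.integral_cong[OF refl])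
    fix s :: real
    have "AE t in lborel. t \<noteq> s" by (rule AE_lborel_singleton)
    then have "AE t in lborel. f s * g t = A s t + B s t"
      by (rule AE_mp) (auto simp: A_def B_def indicator_def)
    then show "(LINT t|lborel. f s * g t) = (LINT t|lborel. A s t + B s t)"
      by (intro integral_cong_AE) (simp_all add: A_def B_def)
  qed
  also have "\<dots> = integral\<^sup>L (lborel \<Otimes>\<^sub>M lborel) (\<lambda>x. case_prod A x + case_prod B x)"
    using lborel_pair.integral_fst'[OF Bochner_Integration.integrable_add[OF A B]] by simp
  also have "\<dots> = integral\<^sup>L (lborel \<Otimes>\<^sub>M lborel) (case_prod A) + integral\<^sup>L (lborel \<Otimes>\<^sub>M lborel) (case_prod B)"
    using A B by simp
  also have "\<dots> = (LINT s|lborel. LINT t|lborel. A s t) + (LINT t|lborel. LINT s|lborel. B s t)"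
    using lborel_pair.integral_fst'[OF A] lborel_pair.integral_snd[OF B] by simp
  finally show "(LINT s|lborel. f s) * (LINT t|lborel. g t) =
     (LINT s|lborel. f s * (LINT t:{..s}|lborel. g t)) + (LINT t|lborel. (LINT s:{..t}|lborel. f s) * g t)"
    by (simp add: A1 B1)
  show "integrable lborel (\<lambda>s. f s * (LINT t:{..s}|lborel. g t))"
    using lborel_pair.integrable_fst'[OF A] by (simp add: A1)
  show "integrable lborel (\<lambda>t. (LINT s:{..t}|lborel. f s) * g t)"
    using lborel_pair.integrable_snd[OF B] by (simp add: B1)
qed

lemma ac_mult:
  fixes F G :: "real \<Rightarrow> 'a::{euclidean_space,real_normed_field}"
  assumes F: "ac F f" and G: "ac G g"
  shows "ac (\<lambda>x. F x * G x) (\<lambda>x. f x * G x + F x * g x)"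
proof -
  \<comment> \<open>Cutting off outside \<open>{0..x}\<close> turns the increments of
    \<open>F\<close> and \<open>G\<close> over \<open>{0..x}\<close> into integrals over the whole
    line, where \<open>integral_mult_split\<close> applies; the constants \<open>F 0\<close> and
    \<open>G 0\<close> are carried separately.\<close>
  define f1 where "f1 = (\<lambda>x t. indicator {0..x::real} t *\<^sub>R f t)"
  define g1 where "g1 = (\<lambda>x t. indicator {0..x::real} t *\<^sub>R g t)"
  have fi: "integrable lborel (f1 x)" and gi: "integrable lborel (g1 x)" if "x \<le> 1" for x
    using set_integrable_Icc_sub[OF ac_integrable[OF F] that] set_integrable_Icc_sub[OF ac_integrable[OF G] that]
    by (simp_all add: f1_def g1_def set_integrable_def)
  have fs: "f1 x s * (G 0 + (LINT t:{..s}|lborel. g1 x t)) = indicator {0..x} s *\<^sub>R (f s * G s)" if "x \<le> 1" for x s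
  proof (cases "s \<in> {0..x}")
    case True
    then have "(LINT t:{..s}|lborel. g1 x t) = (LINT t:{0..s}|lborel. g t)"
      unfolding set_lebesgue_integral_def g1_def by (intro Bochner_Integration.integral_cong) (auto simp: indicator_def)
    then show ?thesis using True ac_eq[OF G, of s] that by (simp add: f1_def)
  qed (simp add: f1_def)
  have gs: "(F 0 + (LINT t:{..s}|lborel. f1 x t)) * g1 x s = indicator {0..x} s *\<^sub>R (F s * g s)" if "x \<le> 1" for x s
  proof (cases "s \<in> {0..x}")
    case True
    then have "(LINT t:{..s}|lborel. f1 x t) = (LINT t:{0..s}|lborel. f t)"
      unfolding set_lebesgue_integral_def f1_def by (intro Bochner_Integration.integral_cong) (auto simp: indicator_def)
    then show ?thesis using True ac_eq[OF F, of s] that by (simp add: g1_def)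
  qed (simp add: g1_def)
  have i1: "integrable lborel (\<lambda>s. indicator {0..x} s *\<^sub>R (f s * G s))" 
    and i2: "integrable lborel (\<lambda>s. indicator {0..x} s *\<^sub>R (F s * g s))" if "x \<le> 1" for x
  proof -
    have "integrable lborel (\<lambda>s. f1 x s * (G 0 + (LINT t:{..s}|lborel. g1 x t)))"
      using integral_mult_split(2)[OF fi[OF that] gi[OF that]] fi[OF that] by (simp add: distrib_left)
    then show "integrable lborel (\<lambda>s. indicator {0..x} s *\<^sub>R (f s * G s))" by (simp only: fs[OF that])
    have "integrable lborel (\<lambda>s. (F 0 + (LINT t:{..s}|lborel. f1 x t)) * g1 x s)"
      using integral_mult_split(3)[OF fi[OF that] gi[OF that]] gi[OF that] by (simp add: distrib_right)
    then show "integrable lborel (\<lambda>s. indicator {0..x} s *\<^sub>R (F s * g s))" by (simp only: gs[OF that])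
  qed
  show ?thesis unfolding ac_def
  proof safe
    show "set_integrable lborel {0..1} (\<lambda>x. f x * G x + F x * g x)"
      using i1[of 1] i2[of 1] by (simp add: set_integrable_def scaleR_add_right)
    fix x :: real assume x: "x \<in> {0..1}"
    then have x1: "x \<le> 1" by simp
    have Fx: "F x = F 0 + (LINT s|lborel. f1 x s)" and Gx: "G x = G 0 + (LINT s|lborel. g1 x s)"
      using ac_eq[OF F x] ac_eq[OF G x] by (simp_all add: f1_def g1_def set_lebesgue_integral_def)
    have "(LINT t:{0..x}|lborel. f t * G t + F t * g t) = (LINT s|lborel. indicator {0..x} s *\<^sub>R (f s * G s)) + (LINT s|lborel. indicator {0..x} s *\<^sub>R (F s * g s))"
      using i1[OF x1] i2[OF x1] by (simp add: set_lebesgue_integral_def scaleR_add_right)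
    also have "(LINT s|lborel. indicator {0..x} s *\<^sub>R (f s * G s)) = (LINT s|lborel. f1 x s) * G 0 + (LINT s|lborel. f1 x s * (LINT t:{..s}|lborel. g1 x t))"
      unfolding fs[OF x1, symmetric] distrib_left
      using integral_mult_split(2)[OF fi[OF x1] gi[OF x1]] fi[OF x1] by simp
    also have "(LINT s|lborel. indicator {0..x} s *\<^sub>R (F s * g s)) = F 0 * (LINT s|lborel. g1 x s) + (LINT s|lborel. (LINT t:{..s}|lborel. f1 x t) * g1 x s)"
      unfolding gs[OF x1, symmetric] distrib_right
      using integral_mult_split(3)[OF fi[OF x1] gi[OF x1]] gi[OF x1] by simp
    finally have I: "(LINT t:{0..x}|lborel. f t * G t + F t * g t) = (LINT s|lborel. f1 x s) * G 0 + F 0 * (LINT s|lborel. g1 x s)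
        + (LINT s|lborel. f1 x s) * (LINT s|lborel. g1 x s)"
      unfolding integral_mult_split(1)[OF fi[OF x1] gi[OF x1]] by (simp only: ac_simps)
    show "F x * G x = F 0 * G 0 + (LINT t:{0..x}|lborel. f t * G t + F t * g t)"
      unfolding I Fx Gx by (simp only: distrib_left distrib_right ac_simps)
  qed
qed

lemma set_integrable_mult_continuous:
  fixes f g :: "real \<Rightarrow> 'a::{euclidean_space,real_normed_field}"
  assumes g: "set_integrable lborel {0..1} g" and f: "continuous_on {0..1} f"
  shows "set_integrable lborel {0..1} (\<lambda>t. g t * f t)"
proof -
  have "bounded (f ` {0..1})" by (intro compact_imp_bounded compact_continuous_image f) simp
  then obtain M where M: "\<And>x. x \<in> {0..1} \<Longrightarrow> norm (f x) \<le> M" unfolding bounded_iff by blast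
  define F where "F = (\<lambda>t. indicator {0..1} t *\<^sub>R f t)"
  define G where "G = (\<lambda>t. indicator {0..1} t *\<^sub>R g t)"
  have Gi: "integrable lborel G" and Fi: "integrable lborel F"
    using g borel_integrable_atLeastAtMost'[OF f] by (simp_all add: F_def G_def set_integrable_def)
  have "integrable lborel (\<lambda>t. G t * F t)"
  proof (rule Bochner_Integration.integrable_bound)
    show "integrable lborel (\<lambda>t. norm (G t) * M)" using Gi by simp
    show "(\<lambda>t. G t * F t) \<in> borel_measurable lborel" using Gi Fi by measurable
    show "AE x in lborel. norm (G x * F x) \<le> norm (norm (G x) * M)"
    proof (rule AE_I2)
      fix x show "norm (G x * F x) \<le> norm (norm (G x) * M)"
      proof (cases "x \<in> {0..1}")
        case True
        then show ?thesis using M[OF True] order_trans[OF norm_ge_zero M[OF True]]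
          by (simp add: F_def norm_mult abs_mult mult_left_mono)
      qed (simp add: F_def G_def)
    qed
  qed
  moreover have "G t * F t = indicator {0..1} t *\<^sub>R (g t * f t)" for t
    by (simp add: F_def G_def indicator_def)
  ultimately show ?thesis by (simp add: set_integrable_def)
qed

section \<open>Iterated integrals and Gronwall's inequality\<close>

lemma set_integral_nonneg_mono:
  fixes g :: "real \<Rightarrow> real"
  assumes "set_integrable lborel {0..1} g" "\<And>t. t \<in> {0..1} \<Longrightarrow> g t \<ge> 0" "x \<le> y" "y \<le> 1"
  shows "(LINT t:{0..x}|lborel. g t) \<le> (LINT t:{0..y}|lborel. g t)"
  unfolding set_lebesgue_integral_def
proof (rule integral_mono)
  show "integrable lborel (\<lambda>t. indicator {0..x} t *\<^sub>R g t)" "integrable lborel (\<lambda>t. indicator {0..y} t *\<^sub>R g t)"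
    using set_integrable_Icc_sub[OF assms(1), of x] set_integrable_Icc_sub[OF assms(1), of y] assms(3,4) by (simp_all add: set_integrable_def)
qed (use assms in \<open>auto simp: indicator_def\<close>)

lemma set_integral_Icc_nonneg:
  fixes g :: "real \<Rightarrow> real"
  assumes "\<And>t. t \<in> {0..1} \<Longrightarrow> g t \<ge> 0" "x \<le> 1"
  shows "0 \<le> (LINT t:{0..x}|lborel. g t)"
  unfolding set_lebesgue_integral_def
  by (rule integral_nonneg_AE) (use assms in \<open>auto simp: indicator_def\<close>)

lemma ac_const: "ac (\<lambda>x. c) (\<lambda>x. 0)"
  by (rule ac_C1) auto

text \<open>The terms of the exponential series of the primitive \<open>h\<close> are the iterated
  integrals with weight \<open>g\<close>. Both Gronwall's inequality and the Picard estimates are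
  summed by means of this fact.\<close>

lemma ac_power_divide_fact:
  fixes g :: "real \<Rightarrow> real"
  assumes "set_integrable lborel {0..1} g"
  defines "h \<equiv> (\<lambda>x. LINT t:{0..x}|lborel. g t)"
  shows "ac (\<lambda>x. h x ^ Suc m / fact (Suc m)) (\<lambda>t. g t * (h t ^ m / fact m))"
proof -
  have h: "ac h g" using ac_integral[OF assms(1), of 0] by (simp add: h_def)
  have "ac (\<lambda>x. h x ^ Suc m) (\<lambda>t. real (Suc m) * (g t * h t ^ m))"
  proof (induction m)
    case 0
    then show ?case using h by simp
  next
    case (Suc m)
    have "g t * h t ^ Suc m + h t * (real (Suc m) * (g t * h t ^ m)) = real (Suc (Suc m)) * (g t * h t ^ Suc m)" for t
      by (simp add: algebra_simps)
    then show ?case using ac_mult[OF h Suc] by simp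
  qed
  from ac_cmult[OF this, of "1 / fact (Suc m)"]
  have "ac (\<lambda>x. 1 / fact (Suc m) * h x ^ Suc m) (\<lambda>t. 1 / fact (Suc m) * (real (Suc m) * (g t * h t ^ m)))" .
  moreover have "1 / fact (Suc m) * (real (Suc m) * (g t * h t ^ m)) = g t * (h t ^ m / fact m)" for t
    unfolding fact_Suc using fact_nonzero[of m, where 'a=real] by (simp add: divide_simps del: of_nat_Suc)
  moreover have "1 / fact (Suc m) * h x ^ Suc m = h x ^ Suc m / fact (Suc m)" for x by simp
  ultimately show ?thesis by simp
qed

lemma gronwall:
  fixes f g :: "real \<Rightarrow> real"
  assumes g: "set_integrable lborel {0..1} g" and g0: "\<And>t. t \<in> {0..1} \<Longrightarrow> g t \<ge> 0"
    and f: "continuous_on {0..1} f"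
    and le: "\<And>x. x \<in> {0..1} \<Longrightarrow> f x \<le> a + (LINT t:{0..x}|lborel. g t * f t)"
    and x: "x \<in> {0..1}"
  shows "f x \<le> a * exp (LINT t:{0..x}|lborel. g t)"
proof -
  define h where "h = (\<lambda>x. LINT t:{0..x}|lborel. g t)"
  have "bounded (f ` {0..1})" by (intro compact_imp_bounded compact_continuous_image f) simp
  then obtain M where "\<And>x. x \<in> {0..1} \<Longrightarrow> \<bar>f x\<bar> \<le> M" unfolding bounded_iff real_norm_def by blast
  then have M: "\<And>x. x \<in> {0..1} \<Longrightarrow> f x \<le> M" by fastforce
  define E where "E = (\<lambda>m x. \<Sum>k<m. h x ^ k / fact k)"
  \<comment> \<open>The bound obtained by inserting the crude estimate \<open>f \<le> M\<close> into
    the hypothesis \<open>m\<close> times; it satisfies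
    \<open>B (Suc m) x = a + (LINT t:{0..x}|lborel. g t * B m t)\<close> and tends to
    \<open>a * exp (h x)\<close>.\<close>
  define B where "B = (\<lambda>m x. a * E m x + M * (h x ^ m / fact m))"
  have h0: "h 0 = 0" by (simp add: h_def)
  have hp: "ac (\<lambda>x. h x ^ Suc m / fact (Suc m)) (\<lambda>t. g t * (h t ^ m / fact m))" for m
    unfolding h_def by (rule ac_power_divide_fact[OF g])
  have E: "ac (E (Suc m)) (\<lambda>t. g t * E m t)" for m
  proof (induction m)
    case 0
    then show ?case using ac_const[of 1] by (simp add: E_def)
  next
    case (Suc m)
    have "ac (\<lambda>x. E (Suc m) x + h x ^ Suc m / fact (Suc m)) (\<lambda>t. g t * E m t + g t * (h t ^ m / fact m))"
      by (rule ac_add[OF Suc hp])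
    then show ?case by (simp add: E_def distrib_left)
  qed
  have B: "ac (B (Suc m)) (\<lambda>t. g t * B m t)" for m
  proof -
    have "ac (B (Suc m)) (\<lambda>t. a * (g t * E m t) + M * (g t * (h t ^ m / fact m)))"
      unfolding B_def by (intro ac_add ac_cmult hp E)
    then show ?thesis by (simp add: B_def algebra_simps)
  qed
  have B0: "B (Suc m) 0 = a" for m
  proof -
    have "E (Suc m) 0 = 1" unfolding E_def h0 by (simp add: lessThan_Suc_atMost sum.atMost_shift)
    then show ?thesis by (simp add: B_def h0)
  qed
  have bd: "f x \<le> B m x" if "x \<in> {0..1}" for m x using that
  proof (induction m arbitrary: x)
    case 0
    then show ?case using M by (simp add: B_def E_def)
  next
    case (Suc m)
    have Bc: "continuous_on {0..1} (B m)"
    proof (cases m)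
      case 0 then show ?thesis by (simp add: B_def E_def)
    next
      case (Suc k) then show ?thesis using ac_continuous[OF B] by simp
    qed
    have "f x \<le> a + (LINT t:{0..x}|lborel. g t * f t)" by (rule le[OF Suc.prems])
    also have "(LINT t:{0..x}|lborel. g t * f t) \<le> (LINT t:{0..x}|lborel. g t * B m t)"
    proof (rule set_integral_mono)
      show "set_integrable lborel {0..x} (\<lambda>t. g t * f t)" "set_integrable lborel {0..x} (\<lambda>t. g t * B m t)"
        by (rule set_integrable_Icc_sub[OF set_integrable_mult_continuous[OF g]], rule f Bc, use Suc.prems in simp)+
      fix t assume "t \<in> {0..x}"
      then have t: "t \<in> {0..1}" using Suc.prems by simp
      show "g t * f t \<le> g t * B m t" by (rule mult_left_mono[OF Suc.IH[OF t] g0[OF t]])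
    qed
    also have "a + (LINT t:{0..x}|lborel. g t * B m t) = B (Suc m) x"
      using ac_eq[OF B Suc.prems, of m] B0[of m] by simp
    finally show ?case by simp
  qed
  have "(\<lambda>m. E m x) \<longlonglongrightarrow> exp (h x)"
    using exp_converges[of "h x"] unfolding sums_def E_def by (simp add: divide_inverse mult.commute)
  moreover have "(\<lambda>m. h x ^ m / fact m) \<longlonglongrightarrow> 0"
    using summable_LIMSEQ_zero[OF summable_exp[of "h x"]] by (simp add: divide_inverse mult.commute)
  ultimately have "(\<lambda>m. B m x) \<longlonglongrightarrow> a * exp (h x) + M * 0"
    unfolding B_def by (intro tendsto_intros)
  then show ?thesis using bd[OF x] LIMSEQ_le_const[of "\<lambda>m. B m x" "a * exp (h x) + M * 0" "f x"] 
    by (auto simp: h_def)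
qed

text \<open>Dominated convergence for a series of derivatives. The bound is a summable coefficient
  times an integrable weight rather than a constant, because the second derivatives of the Picard
  terms contain the possibly unbounded \<open>V\<close>.\<close>

lemma ac_suminf:
  fixes F f :: "nat \<Rightarrow> real \<Rightarrow> 'a::euclidean_space"
  assumes ac: "\<And>m. ac (F m) (f m)" and F0: "summable (\<lambda>m. F m 0)"
    and g: "set_integrable lborel {0..1} g" and b: "summable b"
    and le: "\<And>m x. x \<in> {0..1} \<Longrightarrow> norm (f m x) \<le> b m * g x"
  shows "ac (\<lambda>x. \<Sum>m. F m x) (\<lambda>x. \<Sum>m. f m x)"
proof -
  have main: "set_integrable lborel {0..x} (\<lambda>x. \<Sum>m. f m x) \<and> (\<lambda>m. LINT t:{0..x}|lborel. f m t) sums (LINT t:{0..x}|lborel. \<Sum>m. f m t)"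
    if x: "x \<le> 1" for x
  proof -
    let ?i = "\<lambda>t. indicator {0..x} t :: real"
    have fi: "integrable lborel (\<lambda>t. ?i t *\<^sub>R f m t)" for m
      using set_integrable_Icc_sub[OF ac_integrable[OF ac] x] by (simp add: set_integrable_def)
    have gi: "integrable lborel (\<lambda>t. ?i t *\<^sub>R g t)"
      using set_integrable_Icc_sub[OF g x] by (simp add: set_integrable_def)
    have le': "norm (?i t *\<^sub>R f m t) \<le> b m * (?i t *\<^sub>R g t)" for m t
      using le[of t m] x by (auto simp: indicator_def)
    have s1: "AE t in lborel. summable (\<lambda>m. norm (?i t *\<^sub>R f m t))"
    proof (rule AE_I2)
      fix t show "summable (\<lambda>m. norm (?i t *\<^sub>R f m t))"
        by (rule summable_comparison_test'[where N=0 and g="\<lambda>m. b m * (?i t *\<^sub>R g t)"])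
          (use le' in \<open>auto intro: summable_mult2 b\<close>)
    qed
    have s2: "summable (\<lambda>m. LINT t|lborel. norm (?i t *\<^sub>R f m t))"
    proof (rule summable_comparison_test'[where N=0 and g="\<lambda>m. b m * (LINT t|lborel. ?i t *\<^sub>R g t)"])
      show "summable (\<lambda>m. b m * (LINT t|lborel. ?i t *\<^sub>R g t))" by (intro summable_mult2 b)
      fix m
      have "(LINT t|lborel. norm (?i t *\<^sub>R f m t)) \<le> (LINT t|lborel. b m * (?i t *\<^sub>R g t))"
        by (rule integral_mono) (use fi gi le' in \<open>auto intro!: integrable_norm integrable_mult_right simp del: norm_scaleR\<close>)
      then show "norm (LINT t|lborel. norm (?i t *\<^sub>R f m t)) \<le> b m * (LINT t|lborel. ?i t *\<^sub>R g t)" by simp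
    qed
    have eq: "(\<Sum>m. ?i t *\<^sub>R f m t) = ?i t *\<^sub>R (\<Sum>m. f m t)" for t
      by (simp add: indicator_def)
    show ?thesis
      using integrable_suminf[OF fi s1 s2] sums_integral[OF fi s1 s2]
      by (simp add: eq set_integrable_def set_lebesgue_integral_def)
  qed
  show ?thesis unfolding ac_def
  proof safe
    show "set_integrable lborel {0..1} (\<lambda>x. \<Sum>m. f m x)" using main[of 1] by simp
    fix x :: real assume x: "x \<in> {0..1}"
    have "(\<lambda>m. F m 0 + (LINT t:{0..x}|lborel. f m t)) sums ((\<Sum>m. F m 0) + (LINT t:{0..x}|lborel. \<Sum>m. f m t))"
      by (rule sums_add[OF summable_sums[OF F0]]) (use main[of x] x in simp)
    then show "(\<Sum>m. F m x) = (\<Sum>m. F m 0) + (LINT t:{0..x}|lborel. \<Sum>m. f m t)"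
      unfolding ac_eq[OF ac x, symmetric] by (simp add: sums_iff)
  qed
qed

section \<open>Uniqueness for the initial value problem with complex spectral parameter\<close>

definition csol :: "(real \<Rightarrow> real) \<Rightarrow> complex \<Rightarrow> (real \<Rightarrow> complex) \<Rightarrow> (real \<Rightarrow> complex) \<Rightarrow> bool" where
  "csol V l y dy \<longleftrightarrow> ac y dy \<and> ac dy (\<lambda>t. (complex_of_real (V t) - l) * y t)"

text \<open>Written as a first order system for \<open>(y, dy)\<close>, the equation bounds
  \<open>norm (y x) + norm (dy x)\<close> by its own integral against the weight
  \<open>1 + \<bar>V t\<bar> + norm l\<close>; Gronwall with initial value 0 finishes.\<close>

lemma csol_zero:
  assumes V: "set_integrable lborel {0..1} V" and s: "csol V l y dy" and "y 0 = 0" "dy 0 = 0" and x: "x \<in> {0..1}"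
  shows "y x = 0"
proof -
  have acy: "ac y dy" and acd: "ac dy (\<lambda>t. (complex_of_real (V t) - l) * y t)" using s by (auto simp: csol_def)
  note yc = ac_continuous[OF acy] note dc = ac_continuous[OF acd]
  define f where "f = (\<lambda>x. norm (y x) + norm (dy x))"
  define g where "g = (\<lambda>t. 1 + (\<bar>V t\<bar> + norm l))"
  have g: "set_integrable lborel {0..1} g" unfolding g_def
    by (intro set_integral_add(1) set_integrable_abs V borel_integrable_atLeastAtMost' continuous_intros)
  have fc: "continuous_on {0..1} f" unfolding f_def by (intro continuous_intros yc dc)
  have "f x \<le> 0 * exp (LINT t:{0..x}|lborel. g t)"
  proof (rule gronwall[OF g _ fc _ x])
    show "g t \<ge> 0" for t by (simp add: g_def)
    fix x :: real assume x: "x \<in> {0..1}"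
    have i: "set_integrable lborel {0..x} dy" "set_integrable lborel {0..x} (\<lambda>t. (complex_of_real (V t) - l) * y t)"
      by (rule set_integrable_Icc_sub[OF ac_integrable]; use acy acd x in simp)+
    have "f x \<le> (LINT t:{0..x}|lborel. norm (dy t)) + (LINT t:{0..x}|lborel. norm ((complex_of_real (V t) - l) * y t))"
      unfolding f_def ac_eq[OF acy x] ac_eq[OF acd x] assms
      using set_integral_norm_bound[OF i(1)] set_integral_norm_bound[OF i(2)] by simp
    also have "\<dots> = (LINT t:{0..x}|lborel. norm (dy t) + norm ((complex_of_real (V t) - l) * y t))"
      by (rule set_integral_add(2)[symmetric]; rule set_integrable_norm; rule i)
    also have "\<dots> \<le> (LINT t:{0..x}|lborel. g t * f t)"
    proof (rule set_integral_mono)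
      show "set_integrable lborel {0..x} (\<lambda>t. norm (dy t) + norm ((complex_of_real (V t) - l) * y t))"
        by (rule set_integral_add(1); rule set_integrable_norm; rule i)
      show "set_integrable lborel {0..x} (\<lambda>t. g t * f t)"
        by (rule set_integrable_Icc_sub[OF set_integrable_mult_continuous[OF g fc]]) (use x in simp)
      fix t assume "t \<in> {0..x}"
      have "norm (complex_of_real (V t) - l) \<le> \<bar>V t\<bar> + norm l"
        by (metis norm_of_real norm_triangle_ineq4)
      then have "norm (complex_of_real (V t) - l) * norm (y t) \<le> (\<bar>V t\<bar> + norm l) * norm (y t)" 
        by (rule mult_right_mono) simp
      moreover have "0 \<le> \<bar>V t\<bar> * norm (dy t)" "0 \<le> norm l * norm (dy t)" "0 \<le> norm (y t)" by simp_all
      ultimately show "norm (dy t) + norm ((complex_of_real (V t) - l) * y t) \<le> g t * f t"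
        unfolding g_def f_def norm_mult distrib_left distrib_right mult_1 by linarith
    qed
    finally show "f x \<le> 0 + (LINT t:{0..x}|lborel. g t * f t)" by simp
  qed
  then have "norm (y x) \<le> 0" using norm_ge_zero[of "dy x"] unfolding f_def mult_zero_left by linarith
  then show ?thesis by simp
qed

section \<open>Series solution of the initial value problem\<close>

locale potential =
  fixes V :: "real \<Rightarrow> real"
  assumes V_int: "set_integrable lborel {0..1} V"
begin

lemma V_complex_int: "set_integrable lborel {0..1} (\<lambda>t. complex_of_real (V t) - l)"
proof (rule set_integral_diff(1))
  have "integrable lborel (\<lambda>t. complex_of_real (indicator {0..1} t *\<^sub>R V t))"
    using V_int unfolding set_integrable_def by (rule integrable_of_real)
  then show "set_integrable lborel {0..1} (\<lambda>t. complex_of_real (V t))"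
    unfolding set_integrable_def by (simp add: scaleR_conv_of_real)
qed (intro borel_integrable_atLeastAtMost' continuous_intros)

text \<open>The \<open>m\<close>-th term of the Neumann series for the twice integrated equation.
  The usual Picard approximations are the partial sums of these terms.\<close>

primrec picard :: "nat \<Rightarrow> complex \<Rightarrow> real \<Rightarrow> complex" where
  "picard 0 l = complex_of_real"
| "picard (Suc m) l = (\<lambda>x. LINT t:{0..x}|lborel. LINT s:{0..t}|lborel. (complex_of_real (V s) - l) * picard m l s)"

definition dpicard :: "nat \<Rightarrow> complex \<Rightarrow> real \<Rightarrow> complex" where
  "dpicard m l = (case m of 0 \<Rightarrow> (\<lambda>_. 1) | Suc k \<Rightarrow> (\<lambda>t. LINT s:{0..t}|lborel. (complex_of_real (V s) - l) * picard k l s))"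

definition d2picard :: "nat \<Rightarrow> complex \<Rightarrow> real \<Rightarrow> complex" where
  "d2picard m l = (case m of 0 \<Rightarrow> (\<lambda>_. 0) | Suc k \<Rightarrow> (\<lambda>t. (complex_of_real (V t) - l) * picard k l t))"

lemma ac_picard: "ac (picard m l) (dpicard m l)" and ac_dpicard: "ac (dpicard m l) (d2picard m l)"
proof -
  have "ac (picard m l) (dpicard m l) \<and> ac (dpicard m l) (d2picard m l)"
  proof (induction m)
    case 0
    have "ac (\<lambda>x. complex_of_real x) (\<lambda>_. 1)"
      by (rule ac_C1) (auto intro!: derivative_eq_intros has_vector_derivative_of_real[of "\<lambda>x. x" 1, simplified])
    then show ?case using ac_const by (simp add: dpicard_def d2picard_def)
  next
    case (Suc m)
    then have "continuous_on {0..1} (picard m l)" by (auto intro: ac_continuous)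
    then have "set_integrable lborel {0..1} (\<lambda>t. (complex_of_real (V t) - l) * picard m l t)"
      by (intro set_integrable_mult_continuous V_complex_int)
    from ac_integral[OF this, of 0] have 1: "ac (dpicard (Suc m) l) (d2picard (Suc m) l)"
      by (simp add: dpicard_def d2picard_def)
    then have "continuous_on {0..1} (dpicard (Suc m) l)" by (rule ac_continuous)
    from ac_integral[OF borel_integrable_atLeastAtMost'[OF this], of 0]
    have "ac (picard (Suc m) l) (dpicard (Suc m) l)" by (simp add: dpicard_def)
    with 1 show ?case by blast
  qed
  then show "ac (picard m l) (dpicard m l)" "ac (dpicard m l) (d2picard m l)" by auto
qed

text \<open>An integrable majorant of \<open>V - l\<close>. Its primitive \<open>V_mass\<close>
  takes the place of the length \<open>x\<close> in the classical Picard estimate.\<close>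

definition V_weight :: "complex \<Rightarrow> real \<Rightarrow> real" where "V_weight l t = \<bar>V t\<bar> + norm l"
definition V_mass :: "complex \<Rightarrow> real \<Rightarrow> real" where "V_mass l x = (LINT t:{0..x}|lborel. V_weight l t)"

lemma V_weight_int: "set_integrable lborel {0..1} (V_weight l)"
  unfolding V_weight_def
  by (intro set_integral_add(1) set_integrable_abs V_int borel_integrable_atLeastAtMost' continuous_intros)

lemma V_weight_nonneg: "V_weight l t \<ge> 0" by (simp add: V_weight_def)

lemma norm_V_le: "norm (complex_of_real (V t) - l) \<le> V_weight l t"
  unfolding V_weight_def by (metis norm_of_real norm_triangle_ineq4)

lemma V_mass_mono: "x \<le> y \<Longrightarrow> y \<le> 1 \<Longrightarrow> V_mass l x \<le> V_mass l y"
  unfolding V_mass_def by (rule set_integral_nonneg_mono[OF V_weight_int V_weight_nonneg])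

lemma V_mass_nonneg: "x \<le> 1 \<Longrightarrow> 0 \<le> V_mass l x"
  unfolding V_mass_def by (rule set_integral_Icc_nonneg[OF V_weight_nonneg])

lemma V_mass_1: "V_mass l 1 = (LINT t:{0..1}|lborel. \<bar>V t\<bar>) + norm l"
proof -
  have "V_mass l 1 = (LINT t:{0..1}|lborel. \<bar>V t\<bar>) + (LINT t:{0..1::real}|lborel. norm l)"
    unfolding V_mass_def V_weight_def
    by (intro set_integral_add(2) set_integrable_abs V_int borel_integrable_atLeastAtMost' continuous_intros)
  also have "(LINT t:{0..1::real}|lborel. norm l) = norm l" by (simp add: set_lebesgue_integral_def)
  finally show ?thesis .
qed

lemma V_mass_power_ac: "ac (\<lambda>x. V_mass l x ^ Suc m / fact (Suc m)) (\<lambda>t. V_weight l t * (V_mass l t ^ m / fact m))"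
  unfolding V_mass_def by (rule ac_power_divide_fact[OF V_weight_int])

lemma V_mass_0 [simp]: "V_mass l 0 = 0" by (simp add: V_mass_def)

text \<open>Integrating \<open>d2picard\<close> gains a factor \<open>V_mass / (m + 1)\<close>. The
  second integration, from \<open>dpicard\<close> to \<open>picard\<close>, runs over an interval of
  length at most 1 and costs nothing, so one bound serves both.\<close>

lemma picard_dpicard_bound:
  "x \<in> {0..1} \<Longrightarrow> norm (picard m l x) \<le> V_mass l x ^ m / fact m \<and> norm (dpicard m l x) \<le> V_mass l x ^ m / fact m"
proof (induction m arbitrary: x)
  case 0
  then show ?case by (simp add: dpicard_def)
next
  case (Suc m)
  have d: "norm (dpicard (Suc m) l x) \<le> V_mass l x ^ Suc m / fact (Suc m)" if x: "x \<in> {0..1}" for x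
  proof -
    have i: "set_integrable lborel {0..x} (d2picard (Suc m) l)"
      by (rule set_integrable_Icc_sub[OF ac_integrable[OF ac_dpicard]]) (use x in simp)
    have "norm (dpicard (Suc m) l x) \<le> (LINT t:{0..x}|lborel. norm (d2picard (Suc m) l t))"
      using set_integral_norm_bound[OF i] by (simp add: dpicard_def d2picard_def)
    also have "\<dots> \<le> (LINT t:{0..x}|lborel. V_weight l t * (V_mass l t ^ m / fact m))"
    proof (rule set_integral_mono)
      show "set_integrable lborel {0..x} (\<lambda>t. norm (d2picard (Suc m) l t))" by (rule set_integrable_norm[OF i])
      show "set_integrable lborel {0..x} (\<lambda>t. V_weight l t * (V_mass l t ^ m / fact m))"
        by (rule set_integrable_Icc_sub[OF ac_integrable[OF V_mass_power_ac]]) (use x in simp)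
      fix t assume "t \<in> {0..x}"
      then have "norm (picard m l t) \<le> V_mass l t ^ m / fact m" using Suc.IH[of t] x by simp
      then show "norm (d2picard (Suc m) l t) \<le> V_weight l t * (V_mass l t ^ m / fact m)"
        by (simp add: d2picard_def norm_mult del: times_divide_eq_right) (intro mult_mono norm_V_le, auto simp: V_weight_nonneg)
    qed
    also have "\<dots> = V_mass l x ^ Suc m / fact (Suc m)" using ac_eq[OF V_mass_power_ac x, of l m] by simp
    finally show ?thesis .
  qed
  have i: "set_integrable lborel {0..x} (dpicard (Suc m) l)"
    by (rule set_integrable_Icc_sub[OF ac_integrable[OF ac_picard]]) (use Suc.prems in simp)
  have "norm (picard (Suc m) l x) \<le> (LINT t:{0..x}|lborel. norm (dpicard (Suc m) l t))"
    using set_integral_norm_bound[OF i] by (simp add: dpicard_def)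
  also have "\<dots> \<le> (LINT t:{0..x}|lborel. V_mass l x ^ Suc m / fact (Suc m))"
  proof (rule set_integral_mono)
    show "set_integrable lborel {0..x} (\<lambda>t. norm (dpicard (Suc m) l t))" by (rule set_integrable_norm[OF i])
    show "set_integrable lborel {0..x} (\<lambda>t. V_mass l x ^ Suc m / fact (Suc m))"
      by (intro borel_integrable_atLeastAtMost' continuous_intros)
    fix t assume t: "t \<in> {0..x}"
    have "norm (dpicard (Suc m) l t) \<le> V_mass l t ^ Suc m / fact (Suc m)" by (rule d) (use t Suc.prems in simp)
    also have "\<dots> \<le> V_mass l x ^ Suc m / fact (Suc m)"
      using t Suc.prems by (intro divide_right_mono power_mono V_mass_mono V_mass_nonneg) auto
    finally show "norm (dpicard (Suc m) l t) \<le> V_mass l x ^ Suc m / fact (Suc m)" .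
  qed
  also have "\<dots> = x * (V_mass l x ^ Suc m / fact (Suc m))"
    using Suc.prems by (simp add: set_lebesgue_integral_def del: power_Suc fact_Suc)
  also have "\<dots> \<le> 1 * (V_mass l x ^ Suc m / fact (Suc m))"
    using Suc.prems by (intro mult_right_mono divide_nonneg_nonneg zero_le_power V_mass_nonneg) auto
  finally show ?case using d[OF Suc.prems] by simp
qed

definition mass_coeff :: "complex \<Rightarrow> nat \<Rightarrow> real" where "mass_coeff l m = V_mass l 1 ^ m / fact m"

lemma mass_coeff_sums: "mass_coeff l sums exp (V_mass l 1)"
  using exp_converges[of "V_mass l 1"] unfolding mass_coeff_def by (simp add: divide_inverse mult.commute)

lemma picard_bound: "x \<in> {0..1} \<Longrightarrow> norm (picard m l x) \<le> mass_coeff l m"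
  and dpicard_bound: "x \<in> {0..1} \<Longrightarrow> norm (dpicard m l x) \<le> mass_coeff l m"
proof -
  assume x: "x \<in> {0..1}"
  have "V_mass l x ^ m / fact m \<le> mass_coeff l m" unfolding mass_coeff_def
    using x by (intro divide_right_mono power_mono V_mass_mono V_mass_nonneg) auto
  then show "norm (picard m l x) \<le> mass_coeff l m" "norm (dpicard m l x) \<le> mass_coeff l m"
    using picard_dpicard_bound[OF x, of m l] by simp_all
qed

definition sol :: "complex \<Rightarrow> real \<Rightarrow> complex" where "sol l x = (\<Sum>m. picard m l x)"
definition dsol :: "complex \<Rightarrow> real \<Rightarrow> complex" where "dsol l x = (\<Sum>m. dpicard m l x)"

lemma picard_summable: "x \<in> {0..1} \<Longrightarrow> summable (\<lambda>m. picard m l x)"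
  by (rule summable_comparison_test'[OF sums_summable[OF mass_coeff_sums], of 0]) (auto intro: picard_bound)

lemma dpicard_summable: "x \<in> {0..1} \<Longrightarrow> summable (\<lambda>m. dpicard m l x)"
  by (rule summable_comparison_test'[OF sums_summable[OF mass_coeff_sums], of 0]) (auto intro: dpicard_bound)

lemma picard_at_0 [simp]: "picard m l 0 = 0" by (cases m) auto
lemma dpicard_at_0 [simp]: "dpicard m l 0 = (if m = 0 then 1 else 0)" by (cases m) (auto simp: dpicard_def)

lemma sol_0 [simp]: "sol l 0 = 0" by (simp add: sol_def)
lemma dsol_0 [simp]: "dsol l 0 = 1"
  using suminf_finite[of "{0}" "\<lambda>m. dpicard m l 0"] by (simp add: dsol_def)

lemma csol_sol: "csol V l (sol l) (dsol l)"
  unfolding csol_def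
proof
  show "ac (sol l) (dsol l)" unfolding sol_def dsol_def
  proof (rule ac_suminf[OF ac_picard _ _ sums_summable[OF mass_coeff_sums[of l]]])
    show "set_integrable lborel {0..1} (\<lambda>_::real. 1::real)" by (intro borel_integrable_atLeastAtMost' continuous_intros)
  qed (auto intro: dpicard_bound)
  have "ac (dsol l) (\<lambda>x. \<Sum>m. d2picard m l x)" unfolding dsol_def
  proof (rule ac_suminf[OF ac_dpicard _ V_weight_int])
    show "summable (\<lambda>m. dpicard m l 0)" by (rule dpicard_summable) simp
    \<comment> \<open>The second derivative of term \<open>m\<close> involves
      \<open>picard (m - 1)\<close>, hence the shifted coefficient. At \<open>m = 0\<close>
      truncated subtraction gives index 0, which is fine since \<open>d2picard 0\<close>
      vanishes.\<close>
    show "summable (\<lambda>m. mass_coeff l (m - 1))"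
      using sums_summable[OF mass_coeff_sums[of l]] by (subst summable_Suc_iff[symmetric]) simp
    fix m x assume x: "(x::real) \<in> {0..1}"
    have "norm ((complex_of_real (V x) - l) * picard k l x) \<le> mass_coeff l k * V_weight l x" for k
      unfolding norm_mult mult.commute[of "norm (complex_of_real (V x) - l)"]
      by (intro mult_mono picard_bound[OF x] norm_V_le) (auto simp: mass_coeff_def V_mass_nonneg)
    then show "norm (d2picard m l x) \<le> mass_coeff l (m - 1) * V_weight l x"
      by (cases m) (auto simp: d2picard_def mass_coeff_def V_weight_nonneg)
  qed
  moreover have "(\<Sum>m. d2picard m l x) = (complex_of_real (V x) - l) * sol l x" if "x \<in> {0..1}" for x
  proof -
    have "(\<Sum>m. d2picard m l x) = (\<Sum>m. d2picard (Suc m) l x)"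
    proof -
      have "summable (\<lambda>m. d2picard (Suc m) l x)"
        unfolding d2picard_def using picard_summable[OF that, of l] by simp
      then have "summable (\<lambda>m. d2picard m l x)" by (subst (asm) summable_Suc_iff)
      from suminf_split_head[OF this] show ?thesis by (simp add: d2picard_def)
    qed
    also have "\<dots> = (complex_of_real (V x) - l) * sol l x"
      unfolding d2picard_def sol_def using suminf_mult[OF picard_summable[OF that]] by simp
    finally show ?thesis .
  qed
  ultimately show "ac (dsol l) (\<lambda>t. (complex_of_real (V t) - l) * sol l t)"
    using ac_cong[of "dsol l" "dsol l" "\<lambda>x. \<Sum>m. d2picard m l x" "\<lambda>t. (complex_of_real (V t) - l) * sol l t"] by blast
qed

text \<open>The difference of the two sides has zero initial data. Solutions vanishing at 0 thus
  form a line spanned by \<open>sol l\<close>, so the Dirichlet condition at 1 becomes the scalar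
  equation \<open>sol l 1 = 0\<close>.\<close>

lemma csol_unique:
  assumes "csol V l y dy" "y 0 = 0" "x \<in> {0..1}"
  shows "y x = dy 0 * sol l x"
proof -
  have 1: "ac (\<lambda>x. y x - dy 0 * sol l x) (\<lambda>x. dy x - dy 0 * dsol l x)"
    using assms(1) csol_sol by (intro ac_diff ac_cmult) (auto simp: csol_def)
  have "ac (\<lambda>x. dy x - dy 0 * dsol l x) (\<lambda>t. (complex_of_real (V t) - l) * y t - dy 0 * ((complex_of_real (V t) - l) * sol l t))"
    using assms(1) csol_sol by (intro ac_diff ac_cmult) (auto simp: csol_def)
  also have "(\<lambda>t. (complex_of_real (V t) - l) * y t - dy 0 * ((complex_of_real (V t) - l) * sol l t)) = (\<lambda>t. (complex_of_real (V t) - l) * (y t - dy 0 * sol l t))"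
    by (simp add: fun_eq_iff algebra_simps)
  finally have "csol V l (\<lambda>x. y x - dy 0 * sol l x) (\<lambda>x. dy x - dy 0 * dsol l x)"
    using 1 by (simp add: csol_def)
  from csol_zero[OF V_int this _ _ assms(3)] show ?thesis using assms(2) by simp
qed

lemma sol_bound: "x \<in> {0..1} \<Longrightarrow> norm (sol l x) \<le> exp (V_mass l 1)"
  unfolding sol_def sums_unique[OF mass_coeff_sums[of l]]
  by (rule norm_suminf_le) (auto intro: picard_bound sums_summable[OF mass_coeff_sums])

section \<open>Holomorphy in the spectral parameter\<close>

text \<open>Each term of the series is a polynomial in \<open>l\<close>. This makes holomorphy
  immediate and avoids differentiating the iterated integrals with respect to the parameter.\<close>

lemma picard_polynomial:
  "\<exists>c. (\<forall>i. continuous_on {0..1} (c i)) \<and> (\<forall>x\<in>{0..1}. \<forall>l. picard m l x = (\<Sum>i\<le>m. c i x * l ^ i))"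
proof (induction m)
  case 0
  show ?case by (rule exI[of _ "\<lambda>_. complex_of_real"]) (auto intro!: continuous_intros)
next
  case (Suc m)
  then obtain c where c: "\<And>i. continuous_on {0..1} (c i)" 
    and ce: "\<And>x l. x \<in> {0..1} \<Longrightarrow> picard m l x = (\<Sum>i\<le>m. c i x * l ^ i)" by blast
  define J where "J = (\<lambda>f (x::real). LINT t:{0..x}|lborel. (LINT s:{0..t}|lborel. f (s::real) :: complex))"
  have J: "set_integrable lborel {0..1} f \<Longrightarrow> continuous_on {0..1} (J f)" 
    and Jadd: "set_integrable lborel {0..1} f \<Longrightarrow> set_integrable lborel {0..1} g \<Longrightarrow> x \<in> {0..1} \<Longrightarrow> J (\<lambda>t. f t + g t) x = J f x + J g x" 
    and Jmult: "J (\<lambda>t. f t * k) x = J f x * k" for f g k x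
  proof -
    have JJ: "ac (\<lambda>t. LINT s:{0..t}|lborel. f s) f" if "set_integrable lborel {0..1} f" for f :: "real \<Rightarrow> complex"
      using ac_integral[OF that, of 0] by simp
    have JJJ: "ac (J f) (\<lambda>t. LINT s:{0..t}|lborel. f s)" if "set_integrable lborel {0..1} f" for f :: "real \<Rightarrow> complex"
      using ac_integral[OF borel_integrable_atLeastAtMost'[OF ac_continuous[OF JJ[OF that]]], of 0] by (simp add: J_def)
    show "set_integrable lborel {0..1} f \<Longrightarrow> continuous_on {0..1} (J f)" by (rule ac_continuous[OF JJJ])
    show "J (\<lambda>t. f t * k) x = J f x * k" by (simp add: J_def)
    assume f: "set_integrable lborel {0..1} f" and g: "set_integrable lborel {0..1} g" and x: "x \<in> {0..1}"
    have "J (\<lambda>t. f t + g t) x = (LINT t:{0..x}|lborel. (LINT s:{0..t}|lborel. f s) + (LINT s:{0..t}|lborel. g s))"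
      unfolding J_def
      by (rule set_lebesgue_integral_cong, simp, intro allI impI, rule set_integral_add(2); rule set_integrable_Icc_sub)
        (use f g x in auto)
    also have "\<dots> = J f x + J g x" unfolding J_def
      by (rule set_integral_add(2); rule set_integrable_Icc_sub[OF ac_integrable[OF JJJ]]) (use f g x in auto)
    finally show "J (\<lambda>t. f t + g t) x = J f x + J g x" .
  qed
  have int: "set_integrable lborel {0..1} (\<lambda>t. complex_of_real (V t) * c i t)" "set_integrable lborel {0..1} (\<lambda>t. c i t)" for i
    using set_integrable_mult_continuous[OF V_complex_int[of 0] c[of i]] borel_integrable_atLeastAtMost'[OF c[of i]] by simp_all
  define a where "a = (\<lambda>i. J (\<lambda>t. complex_of_real (V t) * c i t))"
  define b where "b = (\<lambda>i. J (c i))"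
  have sumint: "set_integrable lborel {0..1} (\<lambda>t. \<Sum>i<n. f i t)" and Jsum: "x \<in> {0..1} \<Longrightarrow> J (\<lambda>t. \<Sum>i<n. f i t) x = (\<Sum>i<n. J (f i) x)"
    if "\<And>i. set_integrable lborel {0..1} (f i)" for f and n :: nat and x
  proof -
    have "set_integrable lborel {0..1} (\<lambda>t. \<Sum>i<n. f i t) \<and> (x \<in> {0..1} \<longrightarrow> J (\<lambda>t. \<Sum>i<n. f i t) x = (\<Sum>i<n. J (f i) x))"
    proof (induction n)
      case 0
      have "J (\<lambda>t. 0) x = 0" by (simp add: J_def)
      then show ?case by (simp add: set_integrable_def)
    next
      case (Suc n)
      then show ?case using that[of n] Jadd[of "\<lambda>t. \<Sum>i<n. f i t" "f n" x] by (simp add: set_integral_add(1))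
    qed
    then show "set_integrable lborel {0..1} (\<lambda>t. \<Sum>i<n. f i t)" "x \<in> {0..1} \<Longrightarrow> J (\<lambda>t. \<Sum>i<n. f i t) x = (\<Sum>i<n. J (f i) x)" by auto
  qed
  \<comment> \<open>Multiplication by \<open>V\<close> keeps the degree and multiplication by
    \<open>- l\<close> raises it by one, so the new coefficient is
    \<open>J (V * c i) - J (c (i - 1))\<close>; the conditionals treat the two ends
    \<open>i = Suc m\<close> and \<open>i = 0\<close>.\<close>
  define d where "d = (\<lambda>i x. (if i \<le> m then a i x else 0) - (if i = 0 then 0 else b (i - 1) x))"
  have "picard (Suc m) l x = (\<Sum>i\<le>Suc m. d i x * l ^ i)" if x: "x \<in> {0..1}" for l x
  proof -
    have "picard (Suc m) l x = J (\<lambda>s. (complex_of_real (V s) - l) * picard m l s) x" by (simp add: J_def)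
    also have "\<dots> = J (\<lambda>s. (\<Sum>i<Suc m. complex_of_real (V s) * c i s * l ^ i + c i s * - (l ^ Suc i))) x"
      unfolding J_def
    proof (rule set_lebesgue_integral_cong, simp, intro allI impI, rule set_lebesgue_integral_cong, simp, intro allI impI)
      fix t s assume "t \<in> {0..x}" "s \<in> {0..t}"
      then have "s \<in> {0..1}" using x by simp
      then show "(complex_of_real (V s) - l) * picard m l s = (\<Sum>i<Suc m. complex_of_real (V s) * c i s * l ^ i + c i s * - (l ^ Suc i))"
        by (simp only: ce sum_distrib_left lessThan_Suc_atMost) (intro sum.cong refl, simp add: algebra_simps)
    qed
    also have "\<dots> = (\<Sum>i<Suc m. a i x * l ^ i + b i x * - (l ^ Suc i))"
    proof -
      have i12: "set_integrable lborel {0..1} (\<lambda>s. complex_of_real (V s) * c i s * l ^ i)" "set_integrable lborel {0..1} (\<lambda>s. c i s * - (l ^ Suc i))" for i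
        by (rule set_integrable_mult_left, rule int)+
      show ?thesis
        by (simp only: Jsum[OF set_integral_add(1)[OF i12] x] Jadd[OF i12 x] Jmult a_def b_def)
    qed
    also have "\<dots> = (\<Sum>i<Suc m. a i x * l ^ i) - (\<Sum>i<Suc m. b i x * l ^ Suc i)"
      by (simp add: sum.distrib sum_negf sum_subtractf)
    also have "(\<Sum>i<Suc m. b i x * l ^ Suc i) = (\<Sum>i\<le>Suc m. (if i = 0 then 0 else b (i - 1) x) * l ^ i)"
      by (subst sum.atMost_Suc_shift) (simp add: lessThan_Suc_atMost)
    also have "(\<Sum>i<Suc m. a i x * l ^ i) = (\<Sum>i\<le>Suc m. (if i \<le> m then a i x else 0) * l ^ i)"
      by (simp add: lessThan_Suc_atMost)
    finally show ?thesis by (simp only: d_def left_diff_distrib sum_subtractf)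
  qed
  moreover have "continuous_on {0..1} (d i)" for i
    unfolding d_def a_def b_def using J[OF int(1)] J[OF int(2)] by (cases "i = 0"; cases "i \<le> m"; simp; intro continuous_intros; simp)
  ultimately show ?case by blast
qed

lemma picard_holomorphic: "x \<in> {0..1} \<Longrightarrow> (\<lambda>l. picard m l x) holomorphic_on A"
proof -
  assume x: "x \<in> {0..1}"
  obtain c where "\<And>l. picard m l x = (\<Sum>i\<le>m. c i x * l ^ i)" using picard_polynomial[of m] x by blast
  then show ?thesis by (simp) (intro holomorphic_intros)
qed

lemma sol_holomorphic: 
  assumes x: "x \<in> {0..1}"
  shows "(\<lambda>l. sol l x) holomorphic_on UNIV"
proof (rule holomorphic_uniform_sequence[where f="\<lambda>n l. \<Sum>m<n. picard m l x"])
  show "(\<lambda>l. \<Sum>m<n. picard m l x) holomorphic_on UNIV" for n by (intro holomorphic_intros picard_holomorphic x)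
  fix l0 :: complex
  \<comment> \<open>Since \<open>V_mass l 1\<close> is the L1 norm of \<open>V\<close> plus
    \<open>norm l\<close>, this bounds it on the whole closed unit disc about
    \<open>l0\<close>.\<close>
  define M where "M = V_mass 0 1 + norm l0 + 1"
  have "uniform_limit (cball l0 1) (\<lambda>n l. \<Sum>m<n. picard m l x) (\<lambda>l. sol l x) sequentially"
    unfolding sol_def
  proof (rule Weierstrass_m_test)
    show "summable (\<lambda>m. M ^ m / fact m)"
      using summable_exp[of M] by (simp add: divide_inverse mult.commute)
    fix m l assume l: "l \<in> cball l0 1"
    have "norm l \<le> norm l0 + 1" using l norm_triangle_sub[of l l0] by (simp add: dist_norm norm_minus_commute)
    then have "V_mass l 1 \<le> M" by (simp add: M_def V_mass_1)
    then show "norm (picard m l x) \<le> M ^ m / fact m" 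
      by (intro order_trans[OF picard_bound[OF x]]) (auto simp: mass_coeff_def intro!: divide_right_mono power_mono V_mass_nonneg)
  qed
  then show "\<exists>d>0. cball l0 d \<subseteq> UNIV \<and> uniform_limit (cball l0 d) (\<lambda>n l. \<Sum>m<n. picard m l x) (\<lambda>l. sol l x) sequentially"
    by (intro exI[of _ 1]) auto
qed simp

end

section \<open>Comparison with the free solution\<close>

lemma norm_sin_le_exp_Im: "norm (sin z) \<le> exp \<bar>Im z\<bar>" for z :: complex
proof -
  have "norm (sin z) = norm (exp (\<i> * z) - exp (- (\<i> * z))) / 2"
    by (simp add: sin_exp_eq norm_divide norm_mult)
  also have "\<dots> \<le> (norm (exp (\<i> * z)) + norm (exp (- (\<i> * z)))) / 2"
    by (intro divide_right_mono norm_triangle_ineq4) simp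
  also have "\<dots> = (exp (- Im z) + exp (Im z)) / 2" by (simp add: norm_exp_eq_Re)
  also have "\<dots> \<le> exp \<bar>Im z\<bar>"
  proof -
    have "exp (Im z) \<le> exp \<bar>Im z\<bar>" "exp (- Im z) \<le> exp \<bar>Im z\<bar>" by simp_all
    from add_mono[OF this] show ?thesis by simp
  qed
  finally show ?thesis .
qed

context potential begin

text \<open>Variation of constants. The function \<open>A t * y t + S t * y' t\<close>, with
  \<open>S\<close> the free kernel and \<open>A\<close> its companion cosine, has derivative
  \<open>S t * V t * y t\<close>, because the terms with \<open>z\<^sup>2\<close> cancel. It equals
  \<open>y x\<close> at \<open>t = x\<close> and \<open>sin (z * x) / z\<close> at
  \<open>t = 0\<close>.\<close>

lemma sol_volterra:
  assumes z: "z \<noteq> 0" and x: "x \<in> {0..1}"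
  shows "sol (z\<^sup>2) x = sin (z * of_real x) / z +
     (LINT t:{0..x}|lborel. sin (z * (of_real x - of_real t)) / z * (complex_of_real (V t) * sol (z\<^sup>2) t))"
    and "set_integrable lborel {0..1} (\<lambda>t. sin (z * (of_real x - of_real t)) / z * (complex_of_real (V t) * sol (z\<^sup>2) t))"
proof -
  let ?y = "sol (z\<^sup>2)" and ?dy = "dsol (z\<^sup>2)"
  define A where "A = (\<lambda>t. cos (z * (of_real x - complex_of_real t)))"
  define S where "S = (\<lambda>t. sin (z * (of_real x - complex_of_real t)) / z)"
  have A: "ac A (\<lambda>t. z * (z * S t))"
  proof (rule ac_C1)
    fix t :: real
    have "((\<lambda>w. cos (z * (of_real x - w))) has_field_derivative z * (z * S t)) (at (complex_of_real t))"
      using z by (auto intro!: derivative_eq_intros simp: S_def)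
    then show "(A has_vector_derivative z * (z * S t)) (at t within {0..1})"
      unfolding A_def by (rule has_vector_derivative_real_field)
  qed (auto simp: S_def z intro!: continuous_intros)
  have S: "ac S (\<lambda>t. - A t)"
  proof (rule ac_C1)
    fix t :: real
    have "((\<lambda>w. sin (z * (of_real x - w)) / z) has_field_derivative - A t) (at (complex_of_real t))"
      using z by (auto intro!: derivative_eq_intros simp: A_def)
    then show "(S has_vector_derivative - A t) (at t within {0..1})"
      unfolding S_def by (rule has_vector_derivative_real_field)
  qed (auto simp: A_def intro!: continuous_intros)
  have y: "ac ?y ?dy" "ac ?dy (\<lambda>t. (complex_of_real (V t) - z\<^sup>2) * ?y t)" using csol_sol[of "z\<^sup>2"] by (auto simp: csol_def)
  have "ac (\<lambda>t. A t * ?y t + S t * ?dy t) (\<lambda>t. (z * (z * S t)) * ?y t + A t * ?dy t + (- A t * ?dy t + S t * ((complex_of_real (V t) - z\<^sup>2) * ?y t)))"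
    by (intro ac_add ac_mult A S y)
  also have "(\<lambda>t. (z * (z * S t)) * ?y t + A t * ?dy t + (- A t * ?dy t + S t * ((complex_of_real (V t) - z\<^sup>2) * ?y t)))
     = (\<lambda>t. S t * (complex_of_real (V t) * ?y t))"
    by (simp add: fun_eq_iff algebra_simps power2_eq_square)
  finally have *: "ac (\<lambda>t. A t * ?y t + S t * ?dy t) (\<lambda>t. S t * (complex_of_real (V t) * ?y t))" .
  show "sol (z\<^sup>2) x = sin (z * of_real x) / z +
     (LINT t:{0..x}|lborel. sin (z * (of_real x - of_real t)) / z * (complex_of_real (V t) * sol (z\<^sup>2) t))"
    using ac_eq[OF * x] by (simp add: A_def S_def)
  show "set_integrable lborel {0..1} (\<lambda>t. sin (z * (of_real x - of_real t)) / z * (complex_of_real (V t) * sol (z\<^sup>2) t))"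
    using ac_integrable[OF *] by (simp add: S_def)
qed

definition V_L1 :: real where "V_L1 = (LINT t:{0..1}|lborel. \<bar>V t\<bar>)"

lemma V_L1_nonneg: "V_L1 \<ge> 0" unfolding V_L1_def by (rule set_integral_Icc_nonneg) auto

text \<open>For \<open>t \<le> x\<close> the kernel grows at most like
  \<open>exp (\<bar>Im z\<bar> * (x - t))\<close>, which splits into a factor in \<open>x\<close>
  and one in \<open>t\<close>. The solution rescaled by \<open>exp (- \<bar>Im z\<bar> * t)\<close>
  is thereby subject to Gronwall's inequality with a weight free of exponentials.\<close>

lemma volterra_norm_le:
  assumes z: "z \<noteq> 0" and x: "x \<in> {0..1}"
  shows "norm (LINT t:{0..x}|lborel. sin (z * (of_real x - of_real t)) / z * (complex_of_real (V t) * sol (z\<^sup>2) t))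
     \<le> exp (\<bar>Im z\<bar> * x) * (LINT t:{0..x}|lborel. \<bar>V t\<bar> / norm z * (norm (sol (z\<^sup>2) t) * exp (- \<bar>Im z\<bar> * t)))"
proof -
  have i: "set_integrable lborel {0..x} (\<lambda>t. sin (z * (of_real x - of_real t)) / z * (complex_of_real (V t) * sol (z\<^sup>2) t))"
    by (rule set_integrable_Icc_sub[OF sol_volterra(2)[OF assms]]) (use x in simp)
  have sc: "continuous_on {0..1} (sol (z\<^sup>2))" using csol_sol ac_continuous by (auto simp: csol_def)
  have Vz: "set_integrable lborel {0..1} (\<lambda>t. \<bar>V t\<bar> / norm z)"
    by (rule set_integrable_divide) (rule set_integrable_abs[OF V_int])
  have "norm (LINT t:{0..x}|lborel. sin (z * (of_real x - of_real t)) / z * (complex_of_real (V t) * sol (z\<^sup>2) t))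
     \<le> (LINT t:{0..x}|lborel. norm (sin (z * (of_real x - of_real t)) / z * (complex_of_real (V t) * sol (z\<^sup>2) t)))"
    by (rule set_integral_norm_bound[OF i])
  also have "\<dots> \<le> (LINT t:{0..x}|lborel. exp (\<bar>Im z\<bar> * x) * (\<bar>V t\<bar> / norm z * (norm (sol (z\<^sup>2) t) * exp (- \<bar>Im z\<bar> * t))))"
  proof (rule set_integral_mono)
    show "set_integrable lborel {0..x} (\<lambda>t. norm (sin (z * (of_real x - of_real t)) / z * (complex_of_real (V t) * sol (z\<^sup>2) t)))"
      by (rule set_integrable_norm[OF i])
    have "set_integrable lborel {0..1} (\<lambda>t. \<bar>V t\<bar> / norm z * (norm (sol (z\<^sup>2) t) * exp (- \<bar>Im z\<bar> * t)))"
      by (intro set_integrable_mult_continuous Vz continuous_intros sc)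
    then show "set_integrable lborel {0..x} (\<lambda>t. exp (\<bar>Im z\<bar> * x) * (\<bar>V t\<bar> / norm z * (norm (sol (z\<^sup>2) t) * exp (- \<bar>Im z\<bar> * t))))"
      by (intro set_integrable_mult_right set_integrable_Icc_sub[of _ x]) (use x in auto)
    fix t assume t: "t \<in> {0..x}"
    have "norm (sin (z * (of_real x - of_real t))) \<le> exp \<bar>Im (z * (of_real x - of_real t))\<bar>"
      by (rule norm_sin_le_exp_Im)
    also have "\<bar>Im (z * (of_real x - of_real t))\<bar> = \<bar>Im z\<bar> * x + - \<bar>Im z\<bar> * t"
    proof -
      have "\<bar>Im (z * (of_real x - of_real t))\<bar> = \<bar>Im z\<bar> * \<bar>x - t\<bar>"
        by (simp add: abs_mult[symmetric] right_diff_distrib)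
      also have "\<bar>x - t\<bar> = x - t" using t by simp
      finally show ?thesis by (simp only: right_diff_distrib)
    qed
    finally have "norm (sin (z * (of_real x - of_real t))) \<le> exp (\<bar>Im z\<bar> * x) * exp (- \<bar>Im z\<bar> * t)"
      by (simp add: exp_add[symmetric])
    then have "norm (sin (z * (of_real x - of_real t))) * (\<bar>V t\<bar> / norm z * norm (sol (z\<^sup>2) t)) \<le> 
       exp (\<bar>Im z\<bar> * x) * exp (- \<bar>Im z\<bar> * t) * (\<bar>V t\<bar> / norm z * norm (sol (z\<^sup>2) t))"
      by (rule mult_right_mono) auto
    then show "norm (sin (z * (of_real x - of_real t)) / z * (complex_of_real (V t) * sol (z\<^sup>2) t)) 
      \<le> exp (\<bar>Im z\<bar> * x) * (\<bar>V t\<bar> / norm z * (norm (sol (z\<^sup>2) t) * exp (- \<bar>Im z\<bar> * t)))"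
      by (simp add: norm_mult norm_divide mult_ac)
  qed
  finally show ?thesis by simp
qed

text \<open>Gronwall first bounds the rescaled solution by \<open>exp V_L1 / norm z\<close>.
  Inserting this into the Volterra integral, whose kernel carries another \<open>1 / norm z\<close>,
  yields the second power.\<close>

lemma sol_asymp:
  assumes z: "norm z \<ge> 1"
  shows "norm (sol (z\<^sup>2) 1 - sin z / z) \<le> V_L1 * exp V_L1 * exp \<bar>Im z\<bar> / (norm z)\<^sup>2"
proof -
  have z0: "z \<noteq> 0" using z by auto
  define f where "f = (\<lambda>t. norm (sol (z\<^sup>2) t) * exp (- \<bar>Im z\<bar> * t))"
  define g where "g = (\<lambda>t. \<bar>V t\<bar> / norm z)"
  have sc: "continuous_on {0..1} (sol (z\<^sup>2))" using csol_sol ac_continuous by (auto simp: csol_def)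
  have g: "set_integrable lborel {0..1} g" unfolding g_def
    by (rule set_integrable_divide) (rule set_integrable_abs[OF V_int])
  have fc: "continuous_on {0..1} f" unfolding f_def by (intro continuous_intros sc)
  have g1: "(LINT t:{0..1}|lborel. g t) = V_L1 / norm z" by (simp add: g_def V_L1_def)
  have f_le: "f x \<le> exp V_L1 / norm z" if x: "x \<in> {0..1}" for x
  proof -
    have "f x \<le> 1 / norm z * exp (LINT t:{0..x}|lborel. g t)"
    proof (rule gronwall[OF g _ fc _ x])
      show "g t \<ge> 0" for t by (simp add: g_def)
      fix x :: real assume x: "x \<in> {0..1}"
      have "norm (sol (z\<^sup>2) x) \<le> norm (sin (z * of_real x) / z) + exp (\<bar>Im z\<bar> * x) * (LINT t:{0..x}|lborel. g t * f t)"
        using volterra_norm_le[OF z0 x] by (subst sol_volterra(1)[OF z0 x]) (intro order_trans[OF norm_triangle_ineq] add_left_mono, simp add: f_def g_def)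
      also have "norm (sin (z * of_real x) / z) \<le> exp (\<bar>Im z\<bar> * x) / norm z"
        using norm_sin_le_exp_Im[of "z * of_real x"] x by (simp add: norm_divide abs_mult divide_right_mono)
      finally have "norm (sol (z\<^sup>2) x) \<le> exp (\<bar>Im z\<bar> * x) * (1 / norm z + (LINT t:{0..x}|lborel. g t * f t))"
        by (simp add: algebra_simps)
      then have "f x \<le> exp (\<bar>Im z\<bar> * x) * (1 / norm z + (LINT t:{0..x}|lborel. g t * f t)) * exp (- \<bar>Im z\<bar> * x)"
        unfolding f_def by (intro mult_right_mono) auto
      also have "\<dots> = 1 / norm z + (LINT t:{0..x}|lborel. g t * f t)"
        by (simp add: exp_minus)
      finally show "f x \<le> 1 / norm z + (LINT t:{0..x}|lborel. g t * f t)" .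
    qed
    also have "(LINT t:{0..x}|lborel. g t) \<le> (LINT t:{0..1}|lborel. g t)"
      by (rule set_integral_nonneg_mono[OF g]) (use x in \<open>auto simp: g_def\<close>)
    also have "\<dots> \<le> V_L1" using z V_L1_nonneg by (simp add: g1 divide_le_eq mult_le_cancel_left1)
    finally show ?thesis by (simp add: divide_right_mono)
  qed
  have "norm (sol (z\<^sup>2) 1 - sin z / z) = norm (LINT t:{0..1}|lborel. sin (z * (of_real 1 - of_real t)) / z * (complex_of_real (V t) * sol (z\<^sup>2) t))"
    using sol_volterra(1)[OF z0, of 1] by simp
  also have "\<dots> \<le> exp (\<bar>Im z\<bar> * 1) * (LINT t:{0..1}|lborel. g t * f t)"
    unfolding f_def g_def by (rule volterra_norm_le[OF z0]) simp
  also have "(LINT t:{0..1}|lborel. g t * f t) \<le> (LINT t:{0..1}|lborel. g t * (exp V_L1 / norm z))"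
    using f_le by (intro set_integral_mono set_integrable_mult_continuous g fc continuous_intros mult_left_mono)
      (auto simp: g_def)
  also have "\<dots> = V_L1 / norm z * (exp V_L1 / norm z)" by (simp only: set_integral_mult_left g1)
  finally show ?thesis by (simp add: power2_eq_square mult_ac)
qed

end

section \<open>Zeros of the characteristic function\<close>

lemma ode_sol_iff: "ode_sol V lam phi dphi \<longleftrightarrow> ac phi dphi \<and> ac dphi (\<lambda>t. (V t - lam) * phi t)"
  unfolding ode_sol_def ac_def by blast

lemma ode_sol_imp_csol:
  assumes "ode_sol V lam phi dphi"
  shows "csol V (of_real lam) (\<lambda>x. complex_of_real (phi x)) (\<lambda>x. complex_of_real (dphi x))"
  unfolding csol_def
proof
  show "ac (\<lambda>x. complex_of_real (phi x)) (\<lambda>x. complex_of_real (dphi x))"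
    using assms by (intro ac_linear[OF bounded_linear_of_real]) (simp add: ode_sol_iff)
  have "ac (\<lambda>x. complex_of_real (dphi x)) (\<lambda>t. complex_of_real ((V t - lam) * phi t))"
    using assms by (intro ac_linear[OF bounded_linear_of_real]) (simp add: ode_sol_iff)
  then show "ac (\<lambda>x. complex_of_real (dphi x)) (\<lambda>t. (complex_of_real (V t) - of_real lam) * complex_of_real (phi t))"
    by simp
qed

lemma csol_imp_ode_sol:
  assumes "csol V (of_real lam) y dy"
  shows "ode_sol V lam (\<lambda>x. Re (y x)) (\<lambda>x. Re (dy x))"
  unfolding ode_sol_iff
proof
  show "ac (\<lambda>x. Re (y x)) (\<lambda>x. Re (dy x))"
    using assms by (intro ac_linear[OF bounded_linear_Re]) (simp add: csol_def)
  have "ac (\<lambda>x. Re (dy x)) (\<lambda>t. Re ((complex_of_real (V t) - of_real lam) * y t))"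
    using assms by (intro ac_linear[OF bounded_linear_Re]) (simp add: csol_def)
  then show "ac (\<lambda>x. Re (dy x)) (\<lambda>t. (V t - lam) * Re (y t))" by simp
qed

lemma csol_cnj: "csol V l y dy \<Longrightarrow> csol V (cnj l) (\<lambda>x. cnj (y x)) (\<lambda>x. cnj (dy x))"
  unfolding csol_def using ac_linear[OF bounded_linear_cnj, of y dy] ac_linear[OF bounded_linear_cnj, of dy] by fastforce

context potential begin

lemma dirichlet_eigenvalues_eq: "dirichlet_eigenvalues V = {r. sol (of_real r) 1 = 0}"
proof (intro set_eqI iffI)
  fix r assume "r \<in> dirichlet_eigenvalues V"
  then obtain phi dphi x where s: "ode_sol V r phi dphi" "phi 0 = 0" "phi 1 = 0" "x \<in> {0..1}" "phi x \<noteq> 0"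
    unfolding dirichlet_eigenvalues_def by blast
  note u = csol_unique[OF ode_sol_imp_csol[OF s(1)]]
  have "dphi 0 \<noteq> 0" using u[of x] s by auto
  moreover have "complex_of_real (dphi 0) * sol (of_real r) 1 = 0" using u[of 1] s by simp
  ultimately show "r \<in> {r. sol (of_real r) 1 = 0}" by simp
next
  fix r assume "r \<in> {r. sol (of_real r) 1 = 0}"
  then have r: "sol (of_real r) 1 = 0" by simp
  note s = csol_imp_ode_sol[OF csol_sol[of "of_real r"]]
  \<comment> \<open>The real part of \<open>sol\<close> serves as real eigenfunction. If it vanished
    identically, the real part of \<open>dsol\<close> would keep its initial value 1, and
    integrating it would make the real part of \<open>sol\<close> equal to 1 at
    \<open>x = 1\<close>.\<close>
  have "\<exists>x\<in>{0..1}. Re (sol (of_real r) x) \<noteq> 0"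
  proof (rule ccontr)
    assume "\<not> ?thesis"
    then have z: "\<And>x. x \<in> {0..1} \<Longrightarrow> Re (sol (of_real r) x) = 0" by blast
    have ac1: "ac (\<lambda>x. Re (sol (of_real r) x)) (\<lambda>x. Re (dsol (of_real r) x))" 
      and ac2: "ac (\<lambda>x. Re (dsol (of_real r) x)) (\<lambda>t. (V t - r) * Re (sol (of_real r) t))" using s by (auto simp: ode_sol_iff)
    have "Re (dsol (of_real r) x) = 1" if x: "x \<in> {0..1}" for x
    proof -
      have "(LINT t:{0..x}|lborel. (V t - r) * Re (sol (of_real r) t)) = (LINT t:{0..x}|lborel. 0)"
        by (rule set_lebesgue_integral_cong) (use x z in auto)
      then show ?thesis using ac_eq[OF ac2 x] by (simp add: set_lebesgue_integral_def)
    qed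
    then have "(LINT t:{0..1}|lborel. Re (dsol (of_real r) t)) = (LINT t:{0..1::real}|lborel. 1)"
      by (intro set_lebesgue_integral_cong) auto
    then have "(LINT t:{0..1}|lborel. Re (dsol (of_real r) t)) = 1" by (simp add: set_lebesgue_integral_def)
    then show False using ac_eq[OF ac1, of 1] z[of 1] by simp
  qed
  then show "r \<in> dirichlet_eigenvalues V"
    unfolding dirichlet_eigenvalues_def using s r by (intro CollectI exI[of _ "\<lambda>x. Re (sol (of_real r) x)"] exI) auto
qed

lemma ode_sol_eq_sol: 
  assumes "ode_sol V 0 y dy" "y 0 = 0" "dy 0 = 1"
  shows "sol 0 1 = of_real (y 1)"
  using csol_unique[OF ode_sol_imp_csol[OF assms(1)], of 1] assms by simp

lemma sol_cnj: "x \<in> {0..1} \<Longrightarrow> sol (cnj l) x = cnj (sol l x)"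
  using csol_unique[OF csol_cnj[OF csol_sol[of l]], of x] by simp

lemma sol_real: "x \<in> {0..1} \<Longrightarrow> sol (of_real r) x = of_real (Re (sol (of_real r) x))"
  using sol_cnj[of x "of_real r"] by (simp add: complex_eq_iff)

lemma sol_continuous: "continuous_on {0..1} (sol l)" and dsol_continuous: "continuous_on {0..1} (dsol l)"
  using csol_sol[of l] ac_continuous by (auto simp: csol_def)

section \<open>Simplicity of the zeros\<close>

text \<open>The integrated derivative of the Wronskian: the potential cancels and both solutions
  vanish at 0. When \<open>sol l 1 = 0\<close>, division by \<open>m - l\<close> turns the left side
  into a difference quotient of \<open>D\<close>.\<close>

lemma lagrange_identity:
  "dsol l 1 * sol m 1 - sol l 1 * dsol m 1 = (m - l) * (LINT t:{0..1}|lborel. sol l t * sol m t)"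
proof -
  have a: "ac (sol l) (dsol l)" "ac (dsol l) (\<lambda>t. (complex_of_real (V t) - l) * sol l t)" for l
    using csol_sol by (auto simp: csol_def)
  have "ac (\<lambda>x. dsol l x * sol m x - sol l x * dsol m x) 
    (\<lambda>t. ((complex_of_real (V t) - l) * sol l t) * sol m t + dsol l t * dsol m t - (dsol l t * dsol m t + sol l t * ((complex_of_real (V t) - m) * sol m t)))"
    by (intro ac_diff ac_mult a)
  also have "(\<lambda>t. ((complex_of_real (V t) - l) * sol l t) * sol m t + dsol l t * dsol m t - (dsol l t * dsol m t + sol l t * ((complex_of_real (V t) - m) * sol m t)))
    = (\<lambda>t. (m - l) * (sol l t * sol m t))" by (simp add: fun_eq_iff algebra_simps)
  finally show ?thesis using ac_eq[of _ _ 1] by fastforce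
qed

text \<open>By the Lagrange identity, \<open>dsol l 1\<close> times the difference quotient of
  \<open>D\<close> at \<open>l\<close> is the integral of \<open>sol l * sol m\<close>, which tends
  to the integral of \<open>(sol l)\<^sup>2\<close>. For real \<open>l\<close> the solution is real,
  so this limit is the positive integral of \<open>(norm (sol l t))\<^sup>2\<close>, while a double
  zero would make it 0.\<close>

lemma simple_zero:
  assumes z: "sol (of_real r) 1 = 0" and pos: "(LINT t:{0..1}|lborel. (norm (sol (of_real r) t))\<^sup>2) > 0"
  shows "deriv (\<lambda>l. sol l 1) (of_real r) \<noteq> 0"
proof
  let ?l = "complex_of_real r"
  assume d0: "deriv (\<lambda>l. sol l 1) ?l = 0"
  have "((\<lambda>l. sol l 1) has_field_derivative 0) (at ?l)"
    using holomorphic_derivI[OF sol_holomorphic[of 1], of ?l] d0 by simp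
  then have lim: "(\<lambda>m. sol m 1 / (m - ?l)) \<midarrow>?l\<rightarrow> 0" using z by (simp add: has_field_derivative_iff)
  define ms where "ms = (\<lambda>n. ?l + of_real (inverse (real (Suc n))))"
  have ms: "ms \<longlonglongrightarrow> ?l" unfolding ms_def 
    using tendsto_add[OF tendsto_const tendsto_of_real[OF LIMSEQ_inverse_real_of_nat], of ?l] by simp
  have ne: "ms n \<noteq> ?l" for n by (simp add: ms_def del: of_nat_Suc)
  have "filterlim ms (at ?l) sequentially" using ms ne by (simp add: filterlim_at)
  then have "(\<lambda>n. sol (ms n) 1 / (ms n - ?l)) \<longlonglongrightarrow> 0" by (rule filterlim_compose[OF lim])
  then have "(\<lambda>n. dsol ?l 1 * (sol (ms n) 1 / (ms n - ?l))) \<longlonglongrightarrow> dsol ?l 1 * 0" by (intro tendsto_intros)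
  moreover have "dsol ?l 1 * (sol (ms n) 1 / (ms n - ?l)) = (LINT t:{0..1}|lborel. sol ?l t * sol (ms n) t)" for n
    using lagrange_identity[of ?l "ms n"] ne[of n] z by (simp add: field_simps)
  ultimately have "(\<lambda>n. LINT t:{0..1}|lborel. sol ?l t * sol (ms n) t) \<longlonglongrightarrow> 0" by simp
  moreover have "(\<lambda>n. LINT t:{0..1}|lborel. sol ?l t * sol (ms n) t) \<longlonglongrightarrow> (LINT t:{0..1}|lborel. sol ?l t * sol ?l t)"
    unfolding set_lebesgue_integral_def
  proof (rule integral_dominated_convergence)
    \<comment> \<open>Along the sequence \<open>norm (ms n)\<close> exceeds \<open>norm ?l\<close>
      by at most 1, so \<open>V_mass\<close> also grows by at most 1.\<close>
    define C where "C = exp (V_mass ?l 1) * exp (V_mass ?l 1 + 1)"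
    have int: "set_integrable lborel {0..1} (\<lambda>t. sol ?l t * sol m t)" for m
      by (intro borel_integrable_atLeastAtMost' continuous_intros sol_continuous)
    show "(\<lambda>t. indicator {0..1} t *\<^sub>R (sol ?l t * sol ?l t)) \<in> borel_measurable lborel"
         "(\<lambda>t. indicator {0..1} t *\<^sub>R (sol ?l t * sol (ms n) t)) \<in> borel_measurable lborel" for n
      using int by (auto simp: set_integrable_def)
    show "integrable lborel (\<lambda>t::real. indicator {0..1} t * C)"
    proof -
      have "set_integrable lborel {0..1::real} (\<lambda>_. C)" by (intro borel_integrable_atLeastAtMost' continuous_intros)
      then show ?thesis unfolding set_integrable_def real_scaleR_def .
    qed
    show "AE t in lborel. (\<lambda>n. indicator {0..1} t *\<^sub>R (sol ?l t * sol (ms n) t)) \<longlonglongrightarrow> indicator {0..1} t *\<^sub>R (sol ?l t * sol ?l t)"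
    proof (rule AE_I2)
      fix t :: real
      show "(\<lambda>n. indicator {0..1} t *\<^sub>R (sol ?l t * sol (ms n) t)) \<longlonglongrightarrow> indicator {0..1} t *\<^sub>R (sol ?l t * sol ?l t)"
      proof (cases "t \<in> {0..1}")
        case True
        have "isCont (\<lambda>l. sol l t) ?l"
          using holomorphic_on_imp_continuous_on[OF sol_holomorphic[OF True]] by (simp add: continuous_on_eq_continuous_at)
        then have "(\<lambda>n. sol (ms n) t) \<longlonglongrightarrow> sol ?l t" using ms by (rule isCont_tendsto_compose)
        then show ?thesis by (intro tendsto_intros)
      qed simp
    qed
    fix n show "AE t in lborel. norm (indicator {0..1} t *\<^sub>R (sol ?l t * sol (ms n) t)) \<le> indicator {0..1} t * C"
    proof (rule AE_I2)
      fix t :: real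
      show "norm (indicator {0..1} t *\<^sub>R (sol ?l t * sol (ms n) t)) \<le> indicator {0..1} t * C"
      proof (cases "t \<in> {0..1}")
        case True
        have "norm (ms n) \<le> norm ?l + 1"
          unfolding ms_def by (intro order_trans[OF norm_triangle_ineq] add_left_mono) (simp add: norm_inverse inverse_le_1_iff del: of_nat_Suc of_real_inverse)
        then have "V_mass (ms n) 1 \<le> V_mass ?l 1 + 1" by (simp add: V_mass_1)
        then have "norm (sol (ms n) t) \<le> exp (V_mass ?l 1 + 1)" using sol_bound[OF True, of "ms n"] by (meson exp_le_cancel_iff order_trans)
        then show ?thesis using True sol_bound[OF True, of ?l] by (auto simp: norm_mult C_def intro!: mult_mono)
      qed simp
    qed
  qed
  ultimately have "(LINT t:{0..1}|lborel. sol ?l t * sol ?l t) = 0" by (rule LIMSEQ_unique[rotated])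
  moreover have "(LINT t:{0..1}|lborel. sol ?l t * sol ?l t) = (LINT t:{0..1}|lborel. complex_of_real ((norm (sol ?l t))\<^sup>2))"
  proof (rule set_lebesgue_integral_cong, simp, intro allI impI)
    fix t :: real assume t: "t \<in> {0..1}"
    show "sol ?l t * sol ?l t = complex_of_real ((norm (sol ?l t))\<^sup>2)"
      using sol_cnj[OF t, of ?l] unfolding complex_norm_square by simp
  qed
  ultimately show False using pos by (simp only: set_integral_complex_of_real) simp
qed

end

locale nonneg_potential = potential +
  assumes V_nonneg: "AE x in lborel. x \<in> {0..1} \<longrightarrow> V x \<ge> 0"
begin

text \<open>The energy identity: multiplying the equation by \<open>cnj (sol l t)\<close> and
  integrating by parts gives \<open>l * a = b + c\<close>. Here \<open>c > 0\<close> because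
  \<open>dsol l\<close> is continuous with value 1 at 0, and this forces \<open>a > 0\<close>.
  Reality and positivity of \<open>l\<close> come out together.\<close>

lemma zero_imp_positive:
  assumes z: "sol l 1 = 0"
  shows "(LINT t:{0..1}|lborel. (norm (sol l t))\<^sup>2) > 0" "\<exists>r>0. l = of_real r"
proof -
  define a where "a = (LINT t:{0..1}|lborel. (norm (sol l t))\<^sup>2)"
  define b where "b = (LINT t:{0..1}|lborel. V t * (norm (sol l t))\<^sup>2)"
  define c where "c = (LINT t:{0..1}|lborel. (norm (dsol l t))\<^sup>2)"
  have ai: "set_integrable lborel {0..1} (\<lambda>t. (norm (sol l t))\<^sup>2)" and ci: "set_integrable lborel {0..1} (\<lambda>t. (norm (dsol l t))\<^sup>2)"
    by (intro borel_integrable_atLeastAtMost' continuous_intros sol_continuous dsol_continuous)+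
  have bi: "set_integrable lborel {0..1} (\<lambda>t. V t * (norm (sol l t))\<^sup>2)"
    by (intro set_integrable_mult_continuous V_int continuous_intros sol_continuous)
  have of_real_i: "set_integrable lborel {0..1} (\<lambda>t. complex_of_real (f t))" if "set_integrable lborel {0..1} f" for f
    using integrable_of_real[where 'a=complex, OF that[unfolded set_integrable_def]]
    by (simp add: set_integrable_def scaleR_conv_of_real)
  have a: "ac (sol l) (dsol l)" "ac (dsol l) (\<lambda>t. (complex_of_real (V t) - l) * sol l t)"
    using csol_sol by (auto simp: csol_def)
  have "ac (\<lambda>x. dsol l x * cnj (sol l x)) (\<lambda>t. ((complex_of_real (V t) - l) * sol l t) * cnj (sol l t) + dsol l t * cnj (dsol l t))"
    by (intro ac_mult a ac_linear[OF bounded_linear_cnj])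
  also have "(\<lambda>t. ((complex_of_real (V t) - l) * sol l t) * cnj (sol l t) + dsol l t * cnj (dsol l t)) = 
     (\<lambda>t. (complex_of_real (V t * (norm (sol l t))\<^sup>2) - l * complex_of_real ((norm (sol l t))\<^sup>2)) + complex_of_real ((norm (dsol l t))\<^sup>2))"
    by (simp only: fun_eq_iff of_real_mult complex_norm_square) (simp add: algebra_simps)
  finally have *: "ac (\<lambda>x. dsol l x * cnj (sol l x)) (\<lambda>t. (complex_of_real (V t * (norm (sol l t))\<^sup>2) - l * complex_of_real ((norm (sol l t))\<^sup>2)) + complex_of_real ((norm (dsol l t))\<^sup>2))" .
  have "0 = (LINT t:{0..1}|lborel. (complex_of_real (V t * (norm (sol l t))\<^sup>2) - l * complex_of_real ((norm (sol l t))\<^sup>2)) + complex_of_real ((norm (dsol l t))\<^sup>2))"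
    using ac_eq[OF *, of 1] z by simp
  also have "\<dots> = (LINT t:{0..1}|lborel. (complex_of_real (V t * (norm (sol l t))\<^sup>2) - l * complex_of_real ((norm (sol l t))\<^sup>2))) + of_real c"
    unfolding c_def set_integral_complex_of_real[symmetric]
    by (rule set_integral_add(2)[OF set_integral_diff(1)[OF of_real_i[OF bi] set_integrable_mult_right[OF of_real_i[OF ai]]] of_real_i[OF ci]])
  also have "(LINT t:{0..1}|lborel. (complex_of_real (V t * (norm (sol l t))\<^sup>2) - l * complex_of_real ((norm (sol l t))\<^sup>2))) = of_real b - l * of_real a"
    unfolding b_def a_def set_integral_complex_of_real[symmetric] set_integral_mult_right[symmetric]
    by (rule set_integral_diff(2)[OF of_real_i[OF bi] set_integrable_mult_right[OF of_real_i[OF ai]]])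
  finally have e0: "of_real b - l * of_real a + of_real c = 0" by simp
  have "l * of_real a = of_real (b + c) - (of_real b - l * of_real a + of_real c)" by (simp add: algebra_simps)
  then have eq: "l * of_real a = of_real (b + c)" unfolding e0 by simp
  have b0: "b \<ge> 0" unfolding b_def set_lebesgue_integral_def
    by (rule integral_nonneg_AE, rule AE_mp[OF V_nonneg], rule AE_I2) (auto simp: indicator_def)
  have a0: "a \<ge> 0" unfolding a_def by (rule set_integral_Icc_nonneg) auto
  have "c \<ge> 0" unfolding c_def by (rule set_integral_Icc_nonneg) auto
  moreover have "c \<noteq> 0"
  proof
    assume "c = 0"
    then have "integral {0..1} (\<lambda>t. (norm (dsol l t))\<^sup>2) = 0" 
      using set_borel_integral_eq_integral(2)[OF ci] by (simp add: c_def)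
    then have "\<forall>t\<in>{0..1}. (norm (dsol l t))\<^sup>2 = 0"
      by (subst (asm) integral_eq_0_iff) (auto intro!: continuous_intros dsol_continuous)
    then show False by (auto dest!: bspec[of _ _ 0])
  qed
  ultimately have c0: "c > 0" by simp
  have "a \<noteq> 0" using eq b0 c0 by (metis add_nonneg_pos less_irrefl mult_zero_right of_real_0 of_real_eq_0_iff)
  then have a1: "a > 0" using a0 by simp
  then show "(LINT t:{0..1}|lborel. (norm (sol l t))\<^sup>2) > 0" by (simp add: a_def)
  have "l = of_real ((b + c) / a)" using eq a1 by (simp add: field_simps)
  moreover have "(b + c) / a > 0" using a1 b0 c0 by simp
  ultimately show "\<exists>r>0. l = of_real r" by blast
qed

lemma zero_simple: "sol l 1 = 0 \<Longrightarrow> deriv (\<lambda>l. sol l 1) l \<noteq> 0"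
  using zero_imp_positive[of l] simple_zero by auto

lemma picard_nonneg: "x \<in> {0..1} \<Longrightarrow> \<exists>r\<ge>0. picard m 0 x = of_real r"
proof (induction m arbitrary: x)
  case 0
  then show ?case by (intro exI[of _ x]) simp
next
  case (Suc m)
  then have e: "\<And>s. s \<in> {0..1} \<Longrightarrow> picard m 0 s = of_real (Re (picard m 0 s)) \<and> Re (picard m 0 s) \<ge> 0" by fastforce
  define f where "f = (\<lambda>t. LINT s:{0..t}|lborel. V s * Re (picard m 0 s))"
  have "picard (Suc m) 0 x = (LINT t:{0..x}|lborel. complex_of_real (f t))"
    unfolding picard.simps f_def set_integral_complex_of_real[symmetric]
  proof (rule set_lebesgue_integral_cong, simp, intro allI impI, rule set_lebesgue_integral_cong, simp, intro allI impI)
    fix t s assume "t \<in> {0..x}" "s \<in> {0..t}"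
    then have "s \<in> {0..1}" using Suc.prems by simp
    then show "(complex_of_real (V s) - 0) * picard m 0 s = complex_of_real (V s * Re (picard m 0 s))"
      using e[of s] by simp
  qed
  also have "\<dots> = of_real (LINT t:{0..x}|lborel. f t)" by (rule set_integral_complex_of_real)
  finally have "picard (Suc m) 0 x = of_real (LINT t:{0..x}|lborel. f t)" .
  moreover have "f t \<ge> 0" if "t \<in> {0..1}" for t
    unfolding f_def set_lebesgue_integral_def
    by (rule integral_nonneg_AE, rule AE_mp[OF V_nonneg], rule AE_I2) (use e that in \<open>auto simp: indicator_def\<close>)
  ultimately show ?case using set_integral_Icc_nonneg[of f x] Suc.prems by auto
qed

text \<open>At \<open>l = 0\<close> all terms of the series are nonnegative and the first one is 1
  at \<open>x = 1\<close>, so in fact \<open>D 0 \<ge> 1\<close>.\<close>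

lemma sol_0_pos: "\<exists>d>0. sol 0 1 = of_real d"
proof -
  have s: "summable (\<lambda>m. Re (picard m 0 1))" using picard_summable[of 1 0] by (intro summable_Re) simp
  have "(\<Sum>m<1. Re (picard m 0 1)) \<le> (\<Sum>m. Re (picard m 0 1))"
    using picard_nonneg[of 1] by (intro sum_le_suminf[OF s]) (auto, metis Re_complex_of_real)
  then have "Re (sol 0 1) \<ge> 1" using Re_suminf[OF picard_summable[of 1 0]] by (simp add: sol_def)
  then show ?thesis using sol_real[of 1 0] by (intro exI[of _ "Re (sol 0 1)"]) simp
qed

end

section \<open>Comparing zeros of entire functions\<close>

text \<open>Everything follows from \<open>4 * (norm (sin z))\<^sup>2 = exp (2 * y) + exp (- (2 *
  y)) - 2 * cos (2 * x)\<close>. For \<open>y \<ge> 1\<close> the exponential dominates the cosine.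
  For \<open>y < 1\<close> the circle forces \<open>(R - x) * (R + x) \<le> 1\<close> with
  \<open>R \<ge> 3\<close>, so \<open>x\<close> is within 1/3 of the half-integer multiple
  \<open>R\<close> of \<open>pi\<close>, and there the cosine is at most 0.\<close>

lemma norm_sin_ge_on_circle:
  fixes z :: complex
  assumes N: "N \<ge> 1" and z: "norm z = (real N + 1/2) * pi"
  shows "norm (sin z) \<ge> exp \<bar>Im z\<bar> / 8"
proof -
  define R where "R = (real N + 1/2) * pi"
  define x where "x = \<bar>Re z\<bar>"
  define y where "y = \<bar>Im z\<bar>"
  have xy: "x\<^sup>2 + y\<^sup>2 = R\<^sup>2" using z cmod_power2[of z] by (simp add: x_def y_def R_def)
  have x0: "x \<ge> 0" and y0: "y \<ge> 0" by (auto simp: x_def y_def)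
  have "(3/2) * 2 \<le> R" unfolding R_def using N pi_ge_two by (intro mult_mono) auto
  then have R3: "R \<ge> 3" by simp
  have eq: "4 * (norm (sin z))\<^sup>2 = exp (2 * y) + exp (- (2 * y)) - 2 * cos (2 * x)"
  proof -
    have "cos (2 * Re z) = cos (2 * x)" unfolding x_def by (cases "Re z \<ge> 0") (auto simp: abs_if)
    moreover have "exp (2 * Im z) + exp (- (2 * Im z)) = exp (2 * y) + exp (- (2 * y))"
      unfolding y_def by (cases "Im z \<ge> 0") (auto simp: abs_if)
    ultimately show ?thesis unfolding norm_sin_squared exp_minus[symmetric] by simp
  qed
  have "4 * (norm (sin z))\<^sup>2 \<ge> exp (2 * y) / 16"
  proof (cases "y \<ge> 1")
    case True
    have "1 + 2 * y \<le> exp (2 * y)" by (rule exp_ge_add_one_self)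
    then have e: "exp (2 * y) \<ge> 3" using True by linarith
    have "cos (2 * x) \<le> 1" by simp
    moreover have "exp (- (2 * y)) > 0" by simp
    ultimately show ?thesis using e unfolding eq by linarith
  next
    case False
    then have "y\<^sup>2 \<le> 1" using y0 power_le_one[of y 2] by simp
    moreover have "x \<le> R" using xy x0 R3 by (smt (verit) power_mono_iff zero_le_power2 pos2)
    moreover have "(R - x) * 3 \<le> (R - x) * (R + x)" using \<open>x \<le> R\<close> R3 x0 by (intro mult_left_mono) auto
    moreover have "(R - x) * (R + x) = y\<^sup>2" using xy by (simp add: power2_eq_square algebra_simps)
    ultimately have d: "0 \<le> R - x" "R - x \<le> 1/3" by auto
    have "cos (2 * x) = cos (2 * R - 2 * (R - x))" by simp
    also have "2 * R = 2 * real N * pi + pi" by (simp add: R_def algebra_simps)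
    also have "cos (2 * real N * pi + pi - 2 * (R - x)) = cos (pi - 2 * (R - x) + real N * (2 * pi))"
      by (rule arg_cong[of _ _ cos]) simp
    also have "\<dots> = cos (pi - 2 * (R - x))" using cos.plus_of_nat[of "pi - 2 * (R - x)" N] by simp
    also have "\<dots> = - cos (2 * (R - x))" by simp
    also have "\<dots> \<le> 0" using d pi_ge_two cos_ge_zero[of "2 * (R - x)"] by simp
    finally have "cos (2 * x) \<le> 0" .
    moreover have "exp (- (2 * y)) > 0" "exp (2 * y) > 0" by simp_all
    ultimately show ?thesis unfolding eq by linarith
  qed
  then have "(exp y / 8)\<^sup>2 \<le> (norm (sin z))\<^sup>2" by (simp add: power_divide exp_double)
  then show ?thesis unfolding y_def by (rule power2_le_imp_le) simp
qed

text \<open>Converts smallness of the sine at an eigenvalue into closeness to a multiple of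
  \<open>pi\<close>. Up to \<open>pi / 3\<close> the slope of the sine is at least 1/2; beyond, the
  sine is at least 1/2, while \<open>v / 4\<close> is below 1/2.\<close>

lemma abs_sin_ge:
  fixes u :: real
  assumes "\<bar>u\<bar> \<le> pi / 2"
  shows "\<bar>u\<bar> / 4 \<le> \<bar>sin u\<bar>"
proof -
  define v where "v = \<bar>u\<bar>"
  have v: "0 \<le> v" "v \<le> pi / 2" using assms by (auto simp: v_def)
  have s: "\<bar>sin u\<bar> = sin v"
  proof -
    have "sin v \<ge> 0" using v by (intro sin_ge_zero) auto
    then show ?thesis unfolding v_def by (cases "u \<ge> 0") (auto simp: abs_if)
  qed
  have "v / 4 \<le> sin v"
  proof (cases "v \<le> pi / 3")
    case True
    have "sin 0 - 0 / 2 \<le> sin v - v / 2"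
    proof (rule DERIV_nonneg_imp_nondecreasing[of 0 v "\<lambda>t. sin t - t / 2"])
      fix t assume t: "0 \<le> t" "t \<le> v"
      have "cos (pi / 3) \<le> cos t" using t True by (intro cos_monotone_0_pi_le) auto
      then show "\<exists>y. ((\<lambda>t. sin t - t / 2) has_real_derivative y) (at t) \<and> 0 \<le> y"
        by (intro exI[of _ "cos t - 1/2"]) (auto intro!: derivative_eq_intros simp: cos_60)
    qed (use v in auto)
    then show ?thesis using v by simp
  next
    case False
    have "sin (pi / 6) \<le> sin v" using False v by (intro sin_monotone_2pi_le) auto
    then have "1 / 2 \<le> sin v" by (simp add: sin_30)
    moreover have "v / 4 \<le> 1 / 2" using v pi_less_4 by simp
    ultimately show ?thesis by simp
  qed
  then show ?thesis by (simp add: s v_def)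
qed

text \<open>The zeros are divided off one at a time. The last conjunct is where simplicity is
  recorded: differentiating \<open>f = F * p\<close> at \<open>a\<close> shows that the new cofactor
  takes the value \<open>deriv F a\<close>, which is nonzero.\<close>

lemma factor_simple_zeros:
  assumes "finite A" "f holomorphic_on UNIV" "\<And>a. a \<in> A \<Longrightarrow> f a = 0 \<and> deriv f a \<noteq> 0"
  shows "\<exists>F. F holomorphic_on UNIV \<and> (\<forall>z. f z = F z * (\<Prod>a\<in>A. z - a)) \<and> (\<forall>a\<in>A. F a \<noteq> 0)"
  using assms(1,3)
proof (induction A)
  case empty
  then show ?case using assms(2) by auto
next
  case (insert a A)
  then obtain F where F: "F holomorphic_on UNIV" "\<And>z. f z = F z * (\<Prod>a\<in>A. z - a)" "\<And>a. a \<in> A \<Longrightarrow> F a \<noteq> 0" by auto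
  define p where "p = (\<lambda>z. \<Prod>a\<in>A. z - a)"
  have pa: "p a \<noteq> 0" unfolding p_def using insert.hyps by auto
  have "f a = 0" "deriv f a \<noteq> 0" using insert.prems by auto
  then have Fa: "F a = 0" using F(2)[of a] pa by (simp add: p_def)
  define G where "G = (\<lambda>z. if z = a then deriv F a else (F z - F a) / (z - a))"
  have G: "G holomorphic_on UNIV" unfolding G_def by (rule pole_lemma_open[OF F(1)]) simp
  have FG: "F z = G z * (z - a)" for z by (simp add: G_def Fa)
  have p: "p holomorphic_on UNIV" unfolding p_def by (intro holomorphic_intros)
  have "f = (\<lambda>z. F z * p z)" using F(2) by (simp add: p_def fun_eq_iff)
  then have "deriv f a = F a * deriv p a + deriv F a * p a"
    using F(1) p by (simp only:) (intro deriv_mult holomorphic_on_imp_differentiable_at[where s=UNIV]; simp)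
  then have Ga: "G a \<noteq> 0" using \<open>deriv f a \<noteq> 0\<close> Fa by (auto simp: G_def)
  have "f z = G z * (\<Prod>a\<in>insert a A. z - a)" for z
    using insert.hyps F(2)[of z] FG[of z] by (simp add: mult.assoc)
  moreover have "G b \<noteq> 0" if "b \<in> insert a A" for b
    using that Ga FG[of b] F(3)[of b] by auto
  ultimately show ?case using G by blast
qed

text \<open>Dividing out Blaschke factors of the disc gives Jensen's formula in the form of an inequality.\<close>
lemma jensen_comparison:
  fixes f g :: "complex \<Rightarrow> complex"
  assumes hol: "f holomorphic_on UNIV" "g holomorphic_on UNIV" and r: "r > 0"
    and A: "finite {z \<in> ball 0 r. f z = 0}" and B: "finite {z \<in> ball 0 r. g z = 0}"
    and card: "card {z \<in> ball 0 r. f z = 0} = card {z \<in> ball 0 r. g z = 0}"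
    and sf: "\<And>a. f a = 0 \<Longrightarrow> deriv f a \<noteq> 0" and sg: "\<And>a. g a = 0 \<Longrightarrow> deriv g a \<noteq> 0"
    and le: "\<And>z. norm z = r \<Longrightarrow> norm (f z) \<le> K * norm (g z)" and gs: "\<And>z. norm z = r \<Longrightarrow> g z \<noteq> 0"
  shows "norm (f 0) * (\<Prod>b\<in>{z \<in> ball 0 r. g z = 0}. norm b) \<le> K * norm (g 0) * (\<Prod>a\<in>{z \<in> ball 0 r. f z = 0}. norm a)"
proof -
  define A where "A = {z \<in> ball 0 r. f z = 0}"
  define B where "B = {z \<in> ball 0 r. g z = 0}"
  obtain F where F: "F holomorphic_on UNIV" "\<And>z. f z = F z * (\<Prod>a\<in>A. z - a)" "\<And>a. a \<in> A \<Longrightarrow> F a \<noteq> 0"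
    using factor_simple_zeros[OF A hol(1)] sf unfolding A_def by blast
  obtain G where G: "G holomorphic_on UNIV" "\<And>z. g z = G z * (\<Prod>a\<in>B. z - a)" "\<And>a. a \<in> B \<Longrightarrow> G a \<noteq> 0"
    using factor_simple_zeros[OF B hol(2)] sg unfolding B_def by blast
  have AB: "card A = card B" using card by (simp only: A_def B_def)
  have Gnz: "G z \<noteq> 0" if "z \<in> cball 0 r" for z
  proof (cases "z \<in> B")
    case False
    then have "g z \<noteq> 0" using that gs[of z] unfolding B_def by fastforce
    then show ?thesis using G(2)[of z] by auto
  qed (use G(3) in auto)
  \<comment> \<open>The Blaschke denominators. On the circle they have, up to the factor
    \<open>r\<close> for each zero, the modulus of the linear factors \<open>z - a\<close>, but they
    have no zero in the closed disc.\<close>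
  define q where "q = (\<lambda>S z. \<Prod>a\<in>S. (of_real r)\<^sup>2 - cnj a * z :: complex)"
  have qnz: "q B z \<noteq> 0" if "z \<in> cball 0 r" for z
  proof -
    have "(of_real r)\<^sup>2 \<noteq> cnj b * z" if b: "b \<in> B" for b
    proof
      assume "(of_real r)\<^sup>2 = cnj b * z"
      then have "norm ((of_real r :: complex)\<^sup>2) = norm (cnj b * z)" by simp
      then have "r\<^sup>2 = norm b * norm z" using r by (simp add: norm_mult norm_power)
      moreover have "norm b * norm z \<le> norm b * r" using \<open>z \<in> cball 0 r\<close> by (intro mult_left_mono) auto
      moreover have "norm b * r < r * r" using b r by (intro mult_strict_right_mono) (auto simp: B_def)
      ultimately show False by (simp add: power2_eq_square)
    qed
    then show ?thesis unfolding q_def using B by (auto simp: B_def)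
  qed
  have q_norm: "norm (q S z) = r ^ card S * norm (\<Prod>a\<in>S. z - a)" if "norm z = r" for S z
  proof -
    have "norm ((of_real r)\<^sup>2 - cnj a * z) = r * norm (z - a)" for a
    proof -
      have "(of_real r)\<^sup>2 - cnj a * z = z * cnj (z - a)"
        using complex_norm_square[of z] that by (simp add: algebra_simps)
      then have "norm ((of_real r)\<^sup>2 - cnj a * z) = norm z * norm (cnj (z - a))" by (simp only: norm_mult)
      then show ?thesis using that by (simp only: complex_mod_cnj)
    qed
    then show ?thesis by (simp add: q_def prod_norm[symmetric] prod.distrib)
  qed
  \<comment> \<open>On the circle this has the modulus of \<open>f / g\<close>, yet it is
    holomorphic inside, so the maximum principle gives \<open>norm (h 0) \<le> K\<close>. Equal
    numbers of zeros make all powers of \<open>r\<close> cancel, on the circle and at 0.\<close>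
  define h where "h = (\<lambda>z. F z * q A z / (G z * q B z))"
  have qh: "q S holomorphic_on UNIV" for S unfolding q_def by (intro holomorphic_intros)
  have hh: "h holomorphic_on cball 0 r" unfolding h_def
    by (intro holomorphic_intros holomorphic_on_subset[OF F(1)] holomorphic_on_subset[OF G(1)] holomorphic_on_subset[OF qh])
      (use Gnz qnz in auto)
  have "norm (h 0) \<le> K"
  proof (rule maximum_modulus_frontier[where f=h and S="cball 0 r" and \<xi>=0])
    show "h holomorphic_on interior (cball 0 r)" using hh by (rule holomorphic_on_subset) auto
    show "continuous_on (closure (cball 0 r)) h" using holomorphic_on_imp_continuous_on[OF hh] by simp
    fix z :: complex assume "z \<in> frontier (cball 0 r)"
    then have z: "norm z = r" using r by simp
    have "norm (h z) = norm (f z) / norm (g z)"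
      unfolding h_def F(2)[of z] G(2)[of z] norm_mult norm_divide q_norm[OF z] AB using r by simp
    then show "norm (h z) \<le> K" using le[OF z] gs[OF z] by (simp add: divide_le_eq)
  qed (use r in auto)
  moreover have "norm (h 0) = norm (F 0) / norm (G 0)"
    unfolding h_def q_def norm_mult norm_divide using r by (simp add: AB)
  ultimately have FG: "norm (F 0) \<le> K * norm (G 0)" using Gnz[of 0] r by (simp add: divide_le_eq)
  have f0: "norm (f 0) = norm (F 0) * (\<Prod>a\<in>A. norm a)" and g0: "norm (g 0) = norm (G 0) * (\<Prod>a\<in>B. norm a)"
    by (simp_all add: F(2) G(2) norm_mult prod_norm[symmetric])
  have "norm (F 0) * ((\<Prod>a\<in>A. norm a) * (\<Prod>a\<in>B. norm a)) \<le> K * norm (G 0) * ((\<Prod>a\<in>A. norm a) * (\<Prod>a\<in>B. norm a))"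
    by (intro mult_right_mono FG mult_nonneg_nonneg prod_nonneg) auto
  then show ?thesis unfolding A_def[symmetric] B_def[symmetric] f0 g0 by (simp only: mult_ac)
qed

lemma entire_finite_zeros_ball:
  assumes "f holomorphic_on UNIV" "f w \<noteq> 0"
  shows "finite {z \<in> ball 0 r. f z = (0::complex)}"
proof (cases "f constant_on UNIV")
  case True
  then have "{z \<in> ball 0 r. f z = 0} = {}" using assms(2) by (auto simp: constant_on_def)
  then show ?thesis by (simp only: finite.emptyI)
next
  case False
  have "finite {z \<in> cball 0 r. f z = 0}"
    by (rule holomorphic_compact_finite_zeros[OF assms(1)]) (use False in auto)
  then show ?thesis by (rule rev_finite_subset) auto
qed

lemma rouche_card:
  fixes f g :: "complex \<Rightarrow> complex"
  assumes hol: "f holomorphic_on UNIV" "g holomorphic_on UNIV" and r: "r > 0"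
    and sf: "\<And>a. f a = 0 \<Longrightarrow> deriv f a \<noteq> 0" and sg: "\<And>a. g a = 0 \<Longrightarrow> deriv g a \<noteq> 0"
    and lt: "\<And>z. norm z = r \<Longrightarrow> norm (f z - g z) < norm (g z)"
  shows "card {z \<in> ball 0 r. f z = 0} = card {z \<in> ball 0 r. g z = 0}"
proof -
  \<comment> \<open>Rouche's theorem needs an open set around the circle. Zeros between the radii
    \<open>r\<close> and \<open>r + 1\<close> have winding number 0, and those inside contribute
    exactly 1 each because they are simple.\<close>
  let ?s = "ball 0 (r + 1) :: complex set"
  have g1: "g (of_real r) \<noteq> 0" and f1: "f (of_real r) \<noteq> 0" using lt[of "of_real r"] r by auto
  have order1: "zorder f p = 1" if "f p = 0" "f holomorphic_on UNIV" "deriv f p \<noteq> 0" for f p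
    by (rule zorder_zero_eqI[of _ UNIV]) (use that in auto)
  have sum: "(\<Sum>p\<in>{p\<in>?s. f p = 0}. winding_number (circlepath 0 r) p * zorder f p) = card {z \<in> ball 0 r. f z = 0}"
    if f: "f holomorphic_on UNIV" "\<And>p. f p = 0 \<Longrightarrow> deriv f p \<noteq> 0" "f (of_real r) \<noteq> 0" "\<And>z. norm z = r \<Longrightarrow> f z \<noteq> 0" for f
  proof -
    have "(\<Sum>p\<in>{p\<in>?s. f p = 0}. winding_number (circlepath 0 r) p * zorder f p) = (\<Sum>p\<in>{p\<in>?s. f p = 0}. if norm p < r then 1 else 0)"
    proof (intro sum.cong refl)
      fix p assume p: "p \<in> {p\<in>?s. f p = 0}"
      then have o: "zorder f p = 1" using order1 f by auto
      show "winding_number (circlepath 0 r) p * zorder f p = (if norm p < r then 1 else 0)"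
      proof (cases "norm p < r")
        case True
        then show ?thesis using winding_number_circlepath[of p 0 r] o by simp
      next
        case False
        then have "norm p > r" using f(4)[of p] p by fastforce
        then have "winding_number (circlepath 0 r) p = 0"
          by (intro winding_number_zero_outside[of _ "cball 0 r"]) (use r in auto)
        then show ?thesis using False by simp
      qed
    qed
    also have "\<dots> = of_nat (card {p\<in>{p\<in>?s. f p = 0}. norm p < r})"
      using entire_finite_zeros_ball[OF f(1,3), of "r+1"] by (simp add: sum.If_cases Int_def)
    also have "{p\<in>{p\<in>?s. f p = 0}. norm p < r} = {z \<in> ball 0 r. f z = 0}" by auto
    finally show ?thesis .
  qed
  have fz: "f z \<noteq> 0" and gz: "g z \<noteq> 0" if "norm z = r" for z using lt[OF that] by auto
  have "(\<Sum>p\<in>{p\<in>?s. g p + (f p - g p) = 0}. winding_number (circlepath 0 r) p * zorder (\<lambda>p. g p + (f p - g p)) p) 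
      = (\<Sum>p\<in>{p\<in>?s. g p = 0}. winding_number (circlepath 0 r) p * zorder g p)"
  proof (rule Rouche_theorem)
    show "finite {p \<in> ?s. g p + (f p - g p) = 0}" "finite {p\<in>?s. g p = 0}"
      using entire_finite_zeros_ball[OF hol(1) f1] entire_finite_zeros_ball[OF hol(2) g1] by simp_all
    show "\<forall>z\<in>path_image (circlepath 0 r). norm (f z - g z) < norm (g z)" using lt r by auto
    show "\<forall>z. z \<notin> ?s \<longrightarrow> winding_number (circlepath 0 r) z = 0"
      by (intro allI impI winding_number_zero_outside[of _ "cball 0 r"]) (use r in auto)
    show "g holomorphic_on ?s" "(\<lambda>z. f z - g z) holomorphic_on ?s"
      by (intro holomorphic_intros holomorphic_on_subset[OF hol(1)] holomorphic_on_subset[OF hol(2)]; simp)+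
  qed (use r in auto)
  then have "(\<Sum>p\<in>{p\<in>?s. f p = 0}. winding_number (circlepath 0 r) p * zorder f p) = (\<Sum>p\<in>{p\<in>?s. g p = 0}. winding_number (circlepath 0 r) p * zorder g p)"
    by simp
  then show ?thesis
    using sum[OF hol(1) sf f1 fz] sum[OF hol(2) sg g1 gz] by (simp only: of_nat_eq_iff)
qed

section \<open>Enumeration of the eigenvalues\<close>

text \<open>The comparison function is taken from the same locale, so its holomorphy and the
  simplicity of its zeros need no separate argument.\<close>

interpretation free: nonneg_potential "\<lambda>_. 0"
proof
  show "set_integrable lborel {0..1::real} (\<lambda>_. 0 :: real)" by (simp add: set_integrable_def)
qed simp

lemma free_sol: "z \<noteq> 0 \<Longrightarrow> free.sol (z\<^sup>2) 1 = sin z / z"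
  using free.sol_volterra(1)[of z 1] by (simp add: set_lebesgue_integral_def)

lemma free_sol_0: "free.sol 0 1 = 1"
proof -
  have "ac (\<lambda>x::real. x) (\<lambda>_. 1)" by (rule ac_C1) (auto intro!: derivative_eq_intros)
  moreover have "ac (\<lambda>_::real. 1::real) (\<lambda>_. 0)" by (rule ac_const)
  ultimately have "ode_sol (\<lambda>_. 0) 0 (\<lambda>x. x) (\<lambda>_. 1)" by (simp add: ode_sol_iff)
  from free.ode_sol_eq_sol[OF this] show ?thesis by simp
qed

definition contour_radius :: "nat \<Rightarrow> real" where "contour_radius N = ((real N + 1/2) * pi)\<^sup>2"

lemma contour_radius_pos: "contour_radius N > 0" by (simp add: contour_radius_def)

lemma contour_radius_less_iff: "contour_radius M < contour_radius N \<longleftrightarrow> M < N"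
  unfolding contour_radius_def not_le[symmetric] by (subst power_mono_iff) auto

lemma free_zero_iff: "free.sol l 1 = 0 \<longleftrightarrow> (\<exists>n\<ge>(1::nat). l = of_real ((real n * pi)\<^sup>2))"
proof
  assume z: "free.sol l 1 = 0"
  define w where "w = csqrt l"
  have w2: "w\<^sup>2 = l" by (simp add: w_def)
  have w0: "w \<noteq> 0" using z w2 free_sol_0 by auto
  have "sin w = 0" using z free_sol[OF w0] w0 w2 by simp
  then obtain n :: int where n: "w = of_real (of_int n * pi)" by (auto simp: sin_eq_0)
  have "n \<noteq> 0" using w0 n by auto
  moreover have "l = of_real ((real (nat \<bar>n\<bar>) * pi)\<^sup>2)"
    unfolding w2[symmetric] n by (simp add: power_mult_distrib flip: of_int_power)
  ultimately show "\<exists>n\<ge>(1::nat). l = of_real ((real n * pi)\<^sup>2)" by (intro exI[of _ "nat \<bar>n\<bar>"]) auto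
next
  assume "\<exists>n\<ge>(1::nat). l = of_real ((real n * pi)\<^sup>2)"
  then obtain n where n: "n \<ge> (1::nat)" "l = (of_real (real n * pi))\<^sup>2" by auto
  then have "of_real (real n * pi) \<noteq> (0::complex)" by simp
  moreover have "sin (complex_of_real (real n * pi)) = 0" unfolding sin_of_real by simp
  ultimately show "free.sol l 1 = 0" unfolding n(2) using free_sol by simp
qed

lemma free_zeros_ball: 
  "{z \<in> ball 0 (contour_radius N). free.sol z 1 = 0} = (\<lambda>n. of_real ((real (Suc n) * pi)\<^sup>2)) ` {..<N}"
proof (intro set_eqI iffI)
  fix z assume "z \<in> {z \<in> ball 0 (contour_radius N). free.sol z 1 = 0}"
  then obtain n where n: "n \<ge> (1::nat)" "z = of_real ((real n * pi)\<^sup>2)" and b: "norm z < contour_radius N" by (auto simp: free_zero_iff)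
  have "(real n * pi)\<^sup>2 < ((real N + 1/2) * pi)\<^sup>2" using b unfolding n contour_radius_def by (simp add: norm_power norm_mult)
  then have "real n * pi < (real N + 1/2) * pi" by (rule power2_less_imp_less) simp
  then have "n \<le> N" by simp
  then show "z \<in> (\<lambda>n. of_real ((real (Suc n) * pi)\<^sup>2)) ` {..<N}" using n by (intro image_eqI[of _ _ "n - 1"]) auto
next
  fix z :: complex assume "z \<in> (\<lambda>n. of_real ((real (Suc n) * pi)\<^sup>2)) ` {..<N}"
  then obtain n where n: "n < N" "z = of_real ((real (Suc n) * pi)\<^sup>2)" by auto
  have "(real (Suc n) * pi)\<^sup>2 < ((real N + 1/2) * pi)\<^sup>2"
    using n by (intro power_strict_mono mult_strict_right_mono) auto
  then have "norm z < contour_radius N" unfolding n(2) contour_radius_def norm_of_real by simp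
  moreover have "free.sol z 1 = 0" unfolding free_zero_iff using n by (intro exI[of _ "Suc n"]) auto
  ultimately show "z \<in> {z \<in> ball 0 (contour_radius N). free.sol z 1 = 0}" by simp
qed

lemma inj_free_zeros: "inj (\<lambda>n. complex_of_real ((real (Suc n) * pi)\<^sup>2))"
  by (rule injI) (simp only: of_real_eq_iff power2_eq_iff_nonneg, simp)

context nonneg_potential begin

abbreviation D :: "complex \<Rightarrow> complex" where "D l \<equiv> sol l 1"
abbreviation D0 :: "complex \<Rightarrow> complex" where "D0 l \<equiv> free.sol l 1"

lemma D_hol: "D holomorphic_on UNIV" and D0_hol: "D0 holomorphic_on UNIV"
  by (rule sol_holomorphic free.sol_holomorphic, simp)+

text \<open>The error is \<open>exp \<bar>Im z\<bar> / (norm z)\<^sup>2\<close> up to a constant,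
  whereas \<open>sin z / z\<close> is at least \<open>exp \<bar>Im z\<bar> / (8 * norm z)\<close> in
  norm. The relative error is therefore of order \<open>1 / norm z\<close>, and 8 is the constant of
  \<open>norm_sin_ge_on_circle\<close>.\<close>

lemma circle_bound:
  assumes N: "N \<ge> 1" and l: "norm l = contour_radius N"
  shows "norm (D l - D0 l) \<le> 8 * V_L1 * exp V_L1 / ((real N + 1/2) * pi) * norm (D0 l)" "D0 l \<noteq> 0"
proof -
  define z where "z = csqrt l"
  define R where "R = (real N + 1/2) * pi"
  have z2: "z\<^sup>2 = l" by (simp add: z_def)
  have R0: "R > 0" by (simp add: R_def)
  have nz: "norm z = R"
  proof -
    have "(norm z)\<^sup>2 = R\<^sup>2" using l unfolding z2[symmetric] by (simp add: norm_power contour_radius_def R_def)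
    then show ?thesis using R0 by (simp add: power2_eq_iff_nonneg)
  qed
  have "(1 + 1/2) * 2 \<le> R" unfolding R_def using N pi_ge_two by (intro mult_mono) auto
  then have z1: "norm z \<ge> 1" using nz by simp
  then have z0: "z \<noteq> 0" by auto
  have D0: "D0 l = sin z / z" unfolding z2[symmetric] by (rule free_sol[OF z0])
  have s: "norm (sin z) \<ge> exp \<bar>Im z\<bar> / 8" using norm_sin_ge_on_circle[OF N] nz by (simp add: R_def)
  have "exp \<bar>Im z\<bar> > 0" by simp
  then have "sin z \<noteq> 0" using s by auto
  then show "D0 l \<noteq> 0" using D0 z0 by simp
  have "norm (D l - D0 l) \<le> V_L1 * exp V_L1 * exp \<bar>Im z\<bar> / R\<^sup>2"
    using sol_asymp[OF z1] by (simp add: D0 z2 nz)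
  also have "\<dots> \<le> V_L1 * exp V_L1 * (8 * norm (sin z)) / R\<^sup>2"
    using s V_L1_nonneg by (intro divide_right_mono mult_left_mono) auto
  also have "\<dots> = 8 * V_L1 * exp V_L1 / R * norm (D0 l)"
    using R0 by (simp add: D0 norm_divide nz power2_eq_square)
  finally show "norm (D l - D0 l) \<le> 8 * V_L1 * exp V_L1 / ((real N + 1/2) * pi) * norm (D0 l)" by (simp add: R_def)
qed

definition contour_error :: "nat \<Rightarrow> real" where "contour_error N = 8 * V_L1 * exp V_L1 / ((real N + 1/2) * pi)"

lemma contour_error_tendsto: "contour_error \<longlonglongrightarrow> 0"
  unfolding contour_error_def
proof (rule tendsto_divide_0[OF tendsto_const])
  have "filterlim (\<lambda>N. (real N + 1/2) * pi) at_top sequentially"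
    using filterlim_tendsto_pos_mult_at_top[OF tendsto_const pi_gt_zero
        filterlim_tendsto_add_at_top[OF tendsto_const filterlim_real_sequentially], of "1/2"]
    by (simp add: mult.commute add.commute)
  then show "filterlim (\<lambda>N. (real N + 1/2) * pi) at_infinity sequentially" by (rule filterlim_at_top_imp_at_infinity)
qed

definition eigs_below :: "nat \<Rightarrow> real set" where "eigs_below N = {x \<in> dirichlet_eigenvalues V. x < contour_radius N}"

lemma D_zeros_ball: "{z \<in> ball 0 (contour_radius N). D z = 0} = of_real ` eigs_below N"
proof (intro set_eqI iffI)
  fix z assume z: "z \<in> {z \<in> ball 0 (contour_radius N). D z = 0}"
  then obtain r where "r > 0" "z = of_real r" using zero_imp_positive(2)[of z] by auto
  then show "z \<in> of_real ` eigs_below N" using z by (auto simp: eigs_below_def dirichlet_eigenvalues_eq)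
next
  fix z :: complex assume "z \<in> of_real ` eigs_below N"
  then obtain r where r: "z = of_real r" "r < contour_radius N" "D (of_real r) = 0" by (auto simp: eigs_below_def dirichlet_eigenvalues_eq)
  moreover have "r > 0" using zero_imp_positive(2)[OF r(3)] by auto
  ultimately show "z \<in> {z \<in> ball 0 (contour_radius N). D z = 0}" by auto
qed

lemma eigs_below_pos: "x \<in> dirichlet_eigenvalues V \<Longrightarrow> x > 0"
  using zero_imp_positive(2)[of "of_real x"] by (auto simp: dirichlet_eigenvalues_eq)

lemma D_0_nz: "D 0 \<noteq> 0" using sol_0_pos by auto

lemma finite_eigs_below: "finite (eigs_below N)"
proof -
  have "finite (complex_of_real ` eigs_below N)"
    unfolding D_zeros_ball[symmetric] by (rule entire_finite_zeros_ball[OF D_hol D_0_nz])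
  then show ?thesis by (rule finite_imageD) (simp add: inj_on_def)
qed

lemma card_eigs_below:
  assumes "N \<ge> 1" "contour_error N < 1" shows "card (eigs_below N) = N"
proof -
  have "card {z \<in> ball 0 (contour_radius N). D z = 0} = card {z \<in> ball 0 (contour_radius N). D0 z = 0}"
  proof (rule rouche_card[OF D_hol D0_hol contour_radius_pos zero_simple free.zero_simple])
    fix z :: complex assume z: "norm z = contour_radius N"
    have "norm (D z - D0 z) \<le> contour_error N * norm (D0 z)" unfolding contour_error_def by (rule circle_bound(1)[OF assms(1) z])
    also have "\<dots> < 1 * norm (D0 z)" using assms(2) circle_bound(2)[OF assms(1) z] by (intro mult_strict_right_mono) auto
    finally show "norm (D z - D0 z) < norm (D0 z)" by simp
  qed
  then show ?thesis unfolding D_zeros_ball free_zeros_ball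
    by (simp only: card_image[OF inj_on_subset[OF inj_free_zeros subset_UNIV]] card_lessThan)
      (simp add: card_image inj_on_def)
qed

text \<open>\<open>jensen_comparison\<close> used twice with the roles of \<open>D\<close> and
  \<open>D0\<close> exchanged, with constants \<open>1 + contour_error N\<close> and
  \<open>1 / (1 - contour_error N)\<close>.\<close>

lemma eigs_below_prod_bounds:
  assumes "N \<ge> 1" "contour_error N < 1" "D 0 = of_real d" "d > 0"
  shows "d * (\<Prod>n<N. (real (Suc n) * pi)\<^sup>2) \<le> (1 + contour_error N) * (\<Prod>x\<in>eigs_below N. x)"
    and "(1 - contour_error N) * (\<Prod>x\<in>eigs_below N. x) \<le> d * (\<Prod>n<N. (real (Suc n) * pi)\<^sup>2)"
proof -
  have pf: "(\<Prod>b\<in>{z \<in> ball 0 (contour_radius N). D0 z = 0}. norm b) = (\<Prod>n<N. (real (Suc n) * pi)\<^sup>2)"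
    unfolding free_zeros_ball
    by (subst prod.reindex[OF inj_on_subset[OF inj_free_zeros subset_UNIV]]) (simp add: norm_power norm_mult power_mult_distrib del: of_nat_Suc of_real_power of_real_mult)
  have pe: "(\<Prod>b\<in>{z \<in> ball 0 (contour_radius N). D z = 0}. norm b) = (\<Prod>x\<in>eigs_below N. x)"
    unfolding D_zeros_ball
    by (subst prod.reindex) (auto simp: inj_on_def eigs_below_def abs_of_pos[OF eigs_below_pos] intro!: prod.cong)
  have card: "card {z \<in> ball 0 (contour_radius N). D z = 0} = card {z \<in> ball 0 (contour_radius N). D0 z = 0}"
    unfolding D_zeros_ball free_zeros_ball using card_eigs_below[OF assms(1,2)]
    by (simp add: card_image inj_on_def card_image[OF inj_on_subset[OF inj_free_zeros subset_UNIV]] del: of_nat_Suc of_real_power of_real_mult)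
  have f: "finite {z \<in> ball 0 (contour_radius N). D z = 0}" "finite {z \<in> ball 0 (contour_radius N). D0 z = 0}"
    by (rule entire_finite_zeros_ball[OF D_hol D_0_nz], rule entire_finite_zeros_ball[OF D0_hol, of 0]) (simp add: free_sol_0)
  have b: "norm (D z - D0 z) \<le> contour_error N * norm (D0 z)" "D0 z \<noteq> 0" if "norm z = contour_radius N" for z
    using circle_bound[OF assms(1) that] by (auto simp: contour_error_def)
  have b2: "norm (D z) \<le> (1 + contour_error N) * norm (D0 z)" "norm (D0 z) \<le> 1 / (1 - contour_error N) * norm (D z)" "D z \<noteq> 0" if "norm z = contour_radius N" for z
  proof -
    have "norm (D z) \<le> norm (D0 z) + norm (D z - D0 z)" "norm (D0 z) - norm (D z - D0 z) \<le> norm (D z)"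
      using norm_triangle_sub[of "D z" "D0 z"] norm_triangle_ineq2[of "D0 z" "D0 z - D z"] by (auto simp: norm_minus_commute)
    then show 1: "norm (D z) \<le> (1 + contour_error N) * norm (D0 z)" and 2: "norm (D0 z) \<le> 1 / (1 - contour_error N) * norm (D z)"
      using b(1)[OF that] assms(2) by (auto simp: field_simps)
    show "D z \<noteq> 0" using 2 b(2)[OF that] by auto
  qed
  show "d * (\<Prod>n<N. (real (Suc n) * pi)\<^sup>2) \<le> (1 + contour_error N) * (\<Prod>x\<in>eigs_below N. x)"
    using jensen_comparison[OF D_hol D0_hol contour_radius_pos f card zero_simple free.zero_simple b2(1) b(2)] assms(3,4)
    unfolding pf pe by (simp add: free_sol_0)
  have "(\<Prod>x\<in>eigs_below N. x) \<le> 1 / (1 - contour_error N) * d * (\<Prod>n<N. (real (Suc n) * pi)\<^sup>2)"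
    using jensen_comparison[OF D0_hol D_hol contour_radius_pos f(2,1) card[symmetric] free.zero_simple zero_simple b2(2,3)] assms(3,4)
    unfolding pf pe by (simp add: free_sol_0)
  then show "(1 - contour_error N) * (\<Prod>x\<in>eigs_below N. x) \<le> d * (\<Prod>n<N. (real (Suc n) * pi)\<^sup>2)"
    using assms(2) by (simp add: field_simps)
qed

text \<open>With \<open>u\<close> the distance of \<open>z = sqrt x\<close> from its multiple of
  \<open>pi\<close>, the asymptotics at a zero give \<open>\<bar>sin z\<bar> \<le> C / z\<close>,
  hence \<open>\<bar>u\<bar> * z \<le> 4 * C\<close>. The difference of squares is
  \<open>u * (z + (n + 1) * pi)\<close>, and the second factor is at most \<open>4 * z\<close>: the
  decay of \<open>u\<close> exactly balances its growth. The two factors 4 make up 16.\<close>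

lemma eigs_below_localized:
  assumes x: "x \<in> dirichlet_eigenvalues V" and n: "n \<ge> 1" and lo: "contour_radius n \<le> x" and hi: "x < contour_radius (Suc n)"
  shows "\<bar>x - (real (Suc n) * pi)\<^sup>2\<bar> \<le> 16 * V_L1 * exp V_L1"
proof -
  define z where "z = sqrt x"
  define C where "C = V_L1 * exp V_L1"
  have x0: "x > 0" by (rule eigs_below_pos[OF x])
  have z2: "z\<^sup>2 = x" using x0 by (simp add: z_def)
  have zlo: "(real n + 1/2) * pi \<le> z" unfolding z_def using lo by (intro real_le_rsqrt) (simp add: contour_radius_def)
  have zhi: "z < (real (Suc n) + 1/2) * pi" unfolding z_def using hi by (intro real_less_lsqrt) (auto simp: contour_radius_def)
  have "(1 + 1/2) * 2 \<le> (real n + 1/2) * pi" using n pi_ge_two by (intro mult_mono) auto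
  then have z3: "z \<ge> 3" using zlo by simp
  define u where "u = z - real (Suc n) * pi"
  have "- (pi / 2) \<le> u" "u \<le> pi / 2" unfolding u_def using zlo zhi by (simp_all add: algebra_simps)
  then have u: "\<bar>u\<bar> \<le> pi / 2" by linarith
  have su: "\<bar>sin z\<bar> = \<bar>sin u\<bar>"
  proof -
    have "sin u = sin z * cos (real (Suc n) * pi) - cos z * sin (real (Suc n) * pi)" unfolding u_def by (rule sin_diff)
    also have "\<dots> = sin z * (-1) ^ Suc n" by (simp only: sin_npi cos_npi mult_zero_right diff_0_right)
    finally show ?thesis by (simp only: abs_mult power_abs) simp
  qed
  have "D (of_real x) = 0" using x by (simp add: dirichlet_eigenvalues_eq)
  then have "D ((of_real z)\<^sup>2) = 0" by (simp add: z2[symmetric])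
  then have "norm (sin (complex_of_real z) / of_real z) \<le> C / z\<^sup>2"
    using sol_asymp[of "of_real z"] z3 by (simp add: C_def)
  then have "\<bar>sin z\<bar> / z \<le> C / z\<^sup>2" using z3 by (simp add: norm_divide sin_of_real)
  then have "\<bar>sin z\<bar> \<le> C / z" using z3 by (simp add: field_simps power2_eq_square)
  then have "\<bar>u\<bar> / 4 \<le> C / z" unfolding su by (rule order_trans[OF abs_sin_ge[OF u]])
  then have uz: "\<bar>u\<bar> * z \<le> 4 * C" using z3 by (simp add: field_simps)
  have "real (Suc n) * pi \<le> 3 * z"
  proof -
    have "real (Suc n) * pi = z - u" by (simp add: u_def)
    also have "\<dots> \<le> z + pi / 2" using u by linarith
    also have "\<dots> \<le> 3 * z" using z3 pi_less_4 by simp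
    finally show ?thesis .
  qed
  then have "\<bar>u\<bar> * (z + real (Suc n) * pi) \<le> \<bar>u\<bar> * (4 * z)" by (intro mult_left_mono) auto
  also have "\<dots> = 4 * (\<bar>u\<bar> * z)" by simp
  also have "\<dots> \<le> 4 * (4 * C)" using uz by (intro mult_left_mono) auto
  also have "\<dots> = 16 * C" by simp
  finally have "\<bar>u\<bar> * (z + real (Suc n) * pi) \<le> 16 * C" .
  moreover have "x - (real (Suc n) * pi)\<^sup>2 = u * (z + real (Suc n) * pi)"
    unfolding u_def z2[symmetric] by (simp add: power2_eq_square algebra_simps)
  moreover have "z + real (Suc n) * pi \<ge> 0" using z3 by simp
  ultimately show ?thesis by (simp only: abs_mult abs_of_nonneg C_def mult.assoc)
qed

lemma contour_radius_unbounded: "\<exists>N\<ge>M. x < contour_radius N"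
proof -
  obtain N :: nat where N: "real N > \<bar>x\<bar>" using reals_Archimedean2 by blast
  define k where "k = real (max M N) + 1/2"
  have k: "k \<ge> 1/2" by (simp add: k_def)
  have "x < k + 1/2" using N by (auto simp: k_def)
  also have "\<dots> \<le> k * 2" using k by simp
  also have "\<dots> \<le> k * pi" using k pi_ge_two by (intro mult_left_mono) auto
  also have "\<dots> \<le> (k * pi)\<^sup>2"
  proof -
    have "(1/2) * 2 \<le> k * pi" using k pi_ge_two by (intro mult_mono) auto
    then show ?thesis by (simp add: self_le_power)
  qed
  also have "\<dots> = contour_radius (max M N)" by (simp add: contour_radius_def k_def)
  finally show ?thesis by (intro exI[of _ "max M N"]) auto
qed

lemma eigenvalue_enumeration:
  assumes d: "D 0 = of_real d" "d > 0"
  shows "\<exists>e C. bij_betw e (UNIV::nat set) (dirichlet_eigenvalues V) \<and> (\<forall>n. e n > 0) \<and>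
     (\<forall>n. \<bar>e n - (real (Suc n) * pi)\<^sup>2\<bar> \<le> C) \<and>
     (\<lambda>N. \<Prod>n<N. (real (Suc n) * pi)\<^sup>2 / e n) \<longlonglongrightarrow> 1 / d"
proof -
  obtain N1 where N1: "\<And>N. N \<ge> N1 \<Longrightarrow> contour_error N < 1"
    using order_tendstoD(2)[OF contour_error_tendsto, of 1] by (auto simp: eventually_sequentially)
  \<comment> \<open>The successor ensures \<open>N0 \<ge> 1\<close>, which the estimate of the sine
    on the circle requires.\<close>
  define N0 where "N0 = Suc N1"
  have c: "card (eigs_below N) = N" if "N \<ge> N0" for N using that N1[of N] by (intro card_eigs_below) (auto simp: N0_def)
  obtain f where f: "bij_betw f {..<N0} (eigs_below N0)"
    using ex_bij_betw_nat_finite[OF finite_eigs_below[of N0]] c[of N0] by (auto simp: atLeast0LessThan)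
  have mono: "eigs_below M \<subseteq> eigs_below N" if "M \<le> N" for M N
    using that contour_radius_less_iff[of N M] by (auto simp: eigs_below_def)
  have "\<exists>x. eigs_below (Suc n) - eigs_below n = {x}" if "n \<ge> N0" for n
  proof -
    have "card (eigs_below (Suc n) - eigs_below n) = 1"
      using c[of n] c[of "Suc n"] that mono[of n "Suc n"] finite_eigs_below by (subst card_Diff_subset) auto
    then show ?thesis by (rule card_1_singletonE) auto
  qed
  then obtain g where g: "\<And>n. n \<ge> N0 \<Longrightarrow> eigs_below (Suc n) - eigs_below n = {g n}" by metis
  define e where "e n = (if n < N0 then f n else g n)" for n
  have bij: "bij_betw e {..<N} (eigs_below N)" if "N \<ge> N0" for N
    using that
  proof (induction N rule: dec_induct)
    case base
    have "bij_betw e {..<N0} (eigs_below N0) = bij_betw f {..<N0} (eigs_below N0)" by (rule bij_betw_cong) (simp add: e_def)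
    then show ?case using f by simp
  next
    case (step n)
    have "bij_betw e {n} {g n}" using step.hyps by (simp add: e_def bij_betw_def)
    moreover have "eigs_below n \<inter> {g n} = {}" using g[OF step.hyps(1)] by blast
    ultimately have "bij_betw e ({..<n} \<union> {n}) (eigs_below n \<union> {g n})" using step.IH by (intro bij_betw_combine)
    moreover have "eigs_below n \<union> {g n} = eigs_below (Suc n)" using g[OF step.hyps(1)] mono[of n "Suc n"] by auto
    moreover have "{..<n} \<union> {n} = {..<Suc n}" by auto
    ultimately show ?case by simp
  qed
  have bijU: "bij_betw e UNIV (dirichlet_eigenvalues V)"
    unfolding bij_betw_def
  proof
    show "inj e"
    proof (rule injI)
      fix m n assume mn: "e m = e n"
      have "inj_on e {..<N0 + Suc (max m n)}" using bij[of "N0 + Suc (max m n)"] by (simp add: bij_betw_def)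
      then show "m = n" using mn by (auto simp: inj_on_def)
    qed
    show "range e = dirichlet_eigenvalues V"
    proof (intro set_eqI iffI)
      fix x assume "x \<in> range e"
      then obtain n where n: "x = e n" by auto
      have "e n \<in> e ` {..<N0 + Suc n}" by auto
      also have "\<dots> = eigs_below (N0 + Suc n)" using bij[of "N0 + Suc n"] by (simp add: bij_betw_def)
      finally show "x \<in> dirichlet_eigenvalues V" using n by (simp add: eigs_below_def)
    next
      fix x assume x: "x \<in> dirichlet_eigenvalues V"
      obtain N where "N \<ge> N0" "x < contour_radius N" using contour_radius_unbounded by blast
      then have "x \<in> eigs_below N" "eigs_below N = e ` {..<N}" using x bij[of N] by (auto simp: eigs_below_def bij_betw_def)
      then show "x \<in> range e" by auto
    qed
  qed
  have pos: "e n > 0" for n using bijU by (intro eigs_below_pos) (auto simp: bij_betw_def)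
  \<comment> \<open>The finite sum absorbs the initial block, for which no localization is
    available.\<close>
  define C where "C = 16 * V_L1 * exp V_L1 + (\<Sum>n<N0. \<bar>e n - (real (Suc n) * pi)\<^sup>2\<bar>)"
  have C: "\<bar>e n - (real (Suc n) * pi)\<^sup>2\<bar> \<le> C" for n
  proof (cases "n < N0")
    case True
    then have "\<bar>e n - (real (Suc n) * pi)\<^sup>2\<bar> \<le> (\<Sum>n<N0. \<bar>e n - (real (Suc n) * pi)\<^sup>2\<bar>)"
      by (intro member_le_sum) auto
    then show ?thesis unfolding C_def using V_L1_nonneg by (simp add: add_increasing)
  next
    case False
    then have gn: "eigs_below (Suc n) - eigs_below n = {e n}" using g[of n] by (simp add: e_def)
    then have "e n \<in> eigs_below (Suc n)" "e n \<notin> eigs_below n" by auto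
    then have "\<bar>e n - (real (Suc n) * pi)\<^sup>2\<bar> \<le> 16 * V_L1 * exp V_L1"
      using False by (intro eigs_below_localized) (auto simp: eigs_below_def N0_def)
    also have "\<dots> \<le> C" unfolding C_def by (simp add: sum_nonneg)
    finally show ?thesis .
  qed
  have "(\<lambda>N. \<Prod>n<N. (real (Suc n) * pi)\<^sup>2 / e n) \<longlonglongrightarrow> 1 / d"
  proof (rule tendsto_sandwich)
    have ev: "eventually (\<lambda>N. N \<ge> N0) sequentially" by (rule eventually_ge_at_top)
    have *: "d * (\<Prod>n<N. (real (Suc n) * pi)\<^sup>2) \<le> (1 + contour_error N) * (\<Prod>n<N. e n)"
      "(1 - contour_error N) * (\<Prod>n<N. e n) \<le> d * (\<Prod>n<N. (real (Suc n) * pi)\<^sup>2)" if "N \<ge> N0" for N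
    proof -
      have "(\<Prod>x\<in>eigs_below N. x) = (\<Prod>n<N. e n)" using prod.reindex_bij_betw[OF bij[OF that], of "\<lambda>x. x"] by simp
      then show "d * (\<Prod>n<N. (real (Suc n) * pi)\<^sup>2) \<le> (1 + contour_error N) * (\<Prod>n<N. e n)"
        "(1 - contour_error N) * (\<Prod>n<N. e n) \<le> d * (\<Prod>n<N. (real (Suc n) * pi)\<^sup>2)"
        using eigs_below_prod_bounds[OF _ N1 d, of N] that by (auto simp: N0_def)
    qed
    have pp: "(\<Prod>n<N. e n) > 0" for N by (rule prod_pos) (use pos in auto)
    show "eventually (\<lambda>N. (1 - contour_error N) / d \<le> (\<Prod>n<N. (real (Suc n) * pi)\<^sup>2 / e n)) sequentially"
      using ev by eventually_elim (use *(2) d pp in \<open>simp add: prod_dividef field_simps\<close>)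
    show "eventually (\<lambda>N. (\<Prod>n<N. (real (Suc n) * pi)\<^sup>2 / e n) \<le> (1 + contour_error N) / d) sequentially"
      using ev by eventually_elim (use *(1) d pp in \<open>simp add: prod_dividef field_simps\<close>)
    show "(\<lambda>N. (1 - contour_error N) / d) \<longlonglongrightarrow> 1 / d" "(\<lambda>N. (1 + contour_error N) / d) \<longlonglongrightarrow> 1 / d"
      using tendsto_divide[OF tendsto_diff[OF tendsto_const contour_error_tendsto] tendsto_const, of d 1]
        tendsto_divide[OF tendsto_add[OF tendsto_const contour_error_tendsto] tendsto_const, of d 1] d by simp_all
  qed
  then show ?thesis using bijU pos C by blast
qed

end

section \<open>Wallis' product and real powers with complex exponent\<close>

text \<open>Wallis' partial product in terms of factorials, cleared of denominators so that its
  logarithm can be read off.\<close>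

lemma wallis_factorial:
  "(\<Prod>k=1..N. (4 * real k^2) / (4 * real k^2 - 1)) * ((fact (2 * N))\<^sup>2 * (2 * real N + 1)) = 2 ^ (4 * N) * (fact N) ^ 4"
proof (induction N)
  case (Suc N)
  define m where "m = real N + 1"
  have m: "m \<ge> 1" by (simp add: m_def)
  have nz: "2 * m - 1 \<noteq> 0" "2 * m + 1 \<noteq> 0" using m by auto
  have f1: "fact (2 * Suc N) = (2 * m) * (2 * m - 1) * (fact (2 * N) :: real)"
    by (simp add: m_def algebra_simps)
  have f2: "fact (Suc N) = m * (fact N :: real)" by (simp add: m_def algebra_simps)
  define P where "P = (\<Prod>k=1..N. (4 * real k^2) / (4 * real k^2 - 1))"
  have IH: "P * ((fact (2 * N))\<^sup>2 * (2 * m - 1)) = 2 ^ (4 * N) * (fact N) ^ 4"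
  proof -
    have "2 * m - 1 = 2 * real N + 1" by (simp add: m_def)
    then show ?thesis using Suc by (simp only: P_def)
  qed
  have s: "4 * m^2 - 1 = (2 * m - 1) * (2 * m + 1)" by (simp add: power2_eq_square algebra_simps)
  have "(\<Prod>k=1..Suc N. (4 * real k^2) / (4 * real k^2 - 1)) = P * ((4 * m^2) / ((2 * m - 1) * (2 * m + 1)))"
  proof -
    have mS: "m = real (Suc N)" by (simp add: m_def)
    show ?thesis unfolding s[symmetric] unfolding mS P_def by (simp del: of_nat_Suc)
  qed
  then have "(\<Prod>k=1..Suc N. (4 * real k^2) / (4 * real k^2 - 1)) * ((fact (2 * Suc N))\<^sup>2 * (2 * real (Suc N) + 1))
     = P * ((4 * m^2) / ((2 * m - 1) * (2 * m + 1))) * (((2 * m) * (2 * m - 1) * fact (2 * N))\<^sup>2 * (2 * m + 1))"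
    by (simp only: f1) (simp add: m_def algebra_simps)
  also have "\<dots> = 16 * m ^ 4 * (P * ((fact (2 * N))\<^sup>2 * (2 * m - 1)))"
  proof -
    have "P * ((4 * m^2) / (a * b)) * (((2 * m) * a * F)\<^sup>2 * b) = 16 * m ^ 4 * (P * (F\<^sup>2 * a))"
      if "a \<noteq> 0" "b \<noteq> 0" for a b F :: real
      using that by (simp add: field_simps power2_eq_square power4_eq_xxxx)
    from this[OF nz] show ?thesis .
  qed
  also have "\<dots> = 2 ^ (4 * Suc N) * (fact (Suc N)) ^ 4"
    unfolding IH f2 by (simp add: power_mult_distrib power_add)
  finally show ?case .
qed simp

text \<open>If \<open>T\<close> converges to \<open>t\<close>, so does
  \<open>2 * T N - T (2 * N)\<close>. In this combination the factorials assemble into Wallis'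
  product and the rest is elementary. Convergence itself is assumed here; it will come from the
  differentiated zeta series.\<close>

lemma stirling_limit_unique:
  fixes T :: "nat \<Rightarrow> real"
  defines "T \<equiv> (\<lambda>N. 2 * ((real N + 1/2) * ln (real N + 1/2)) - 2 * real N - 2 * ln (fact N))"
  assumes lim: "T \<longlonglongrightarrow> t"
  shows "t = 1 - ln (2 * pi)"
proof -
  define W where "W = (\<lambda>N. \<Prod>k=1..N. (4 * real k^2) / (4 * real k^2 - 1))"
  have Wpos: "W N > 0" for N
  proof -
    have "W N * ((fact (2 * N))\<^sup>2 * (2 * real N + 1)) > 0" unfolding W_def wallis_factorial by simp
    moreover have "(fact (2 * N))\<^sup>2 * (2 * real N + 1) > 0" by simp
    ultimately show ?thesis by (rule zero_less_mult_pos2)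
  qed
  have lnW: "ln (W N) = 4 * real N * ln 2 + 4 * ln (fact N) - 2 * ln (fact (2 * N)) - ln (2 * real N + 1)" for N
  proof -
    have "ln (W N * ((fact (2 * N))\<^sup>2 * (2 * real N + 1))) = ln (2 ^ (4 * N) * (fact N) ^ 4)"
      unfolding W_def wallis_factorial ..
    then show ?thesis using Wpos[of N] by (simp add: ln_mult ln_realpow)
  qed
  have eq: "2 * T N - T (2 * N) = - ln (W N) - 2 * ln 2 + (4 * real N + 1) * (ln (2 * real N + 1) - ln (2 * real N + 1/2))" for N
  proof -
    have "ln (real N + 1/2) = ln ((2 * real N + 1) / 2)" by (simp add: field_simps)
    also have "\<dots> = ln (2 * real N + 1) - ln 2" by (subst ln_div) auto
    finally have l: "ln (real N + 1/2) = ln (2 * real N + 1) - ln 2" .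
    show ?thesis unfolding T_def l lnW by (simp add: algebra_simps)
  qed
  have "(\<lambda>N. ln (W N)) \<longlonglongrightarrow> ln (pi / 2)" unfolding W_def by (intro tendsto_ln wallis) simp
  moreover have "(\<lambda>N. (4 * real N + 1) * (ln (2 * real N + 1) - ln (2 * real N + 1/2))) \<longlonglongrightarrow> 1" by real_asymp
  ultimately have "(\<lambda>N. - ln (W N) - 2 * ln 2 + (4 * real N + 1) * (ln (2 * real N + 1) - ln (2 * real N + 1/2))) \<longlonglongrightarrow> - ln (pi / 2) - 2 * ln 2 + 1"
    by (intro tendsto_add tendsto_diff tendsto_minus tendsto_const)
  then have "(\<lambda>N. 2 * T N - T (2 * N)) \<longlonglongrightarrow> - ln (pi / 2) - 2 * ln 2 + 1" by (simp only: eq)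
  moreover have "(\<lambda>N. 2 * T N - T (2 * N)) \<longlonglongrightarrow> 2 * t - t"
  proof (intro tendsto_intros lim)
    have "strict_mono (\<lambda>N::nat. 2 * N)" by (simp add: strict_mono_def)
    from LIMSEQ_subseq_LIMSEQ[OF lim this] show "(\<lambda>N. T (2 * N)) \<longlonglongrightarrow> t" by (simp add: o_def)
  qed
  ultimately have "2 * t - t = - ln (pi / 2) - 2 * ln 2 + 1" by (rule LIMSEQ_unique[rotated])
  moreover have "ln (pi / 2) = ln pi - ln 2" "ln (2 * pi) = ln 2 + ln pi" by (simp_all add: ln_div ln_mult)
  ultimately show ?thesis by simp
qed

text \<open>Unlike \<open>powr\<close> with a complex base this is visibly entire in the exponent; the two agree
  only for positive \<open>x\<close>.\<close>
definition rpow :: "real \<Rightarrow> complex \<Rightarrow> complex" where "rpow x w = exp (w * of_real (ln x))"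

lemma rpow_eq_powr: "x > 0 \<Longrightarrow> rpow x w = complex_of_real x powr w"
  by (simp add: rpow_def powr_def Ln_of_real)

lemma norm_rpow: "x > 0 \<Longrightarrow> norm (rpow x w) = x powr Re w"
  by (simp add: rpow_def norm_exp_eq_Re powr_def mult.commute)

lemma rpow_hol [holomorphic_intros]: "f holomorphic_on A \<Longrightarrow> (\<lambda>s. rpow x (f s)) holomorphic_on A"
  unfolding rpow_def by (intro holomorphic_intros)

lemma segment_of_real:
  assumes "z \<in> closed_segment (of_real a) (of_real b :: complex)" "c \<le> a" "c \<le> b"
  shows "\<exists>t\<ge>c. z = of_real t"
proof -
  obtain u where u: "0 \<le> u" "u \<le> 1" "z = (1 - u) *\<^sub>R of_real a + u *\<^sub>R of_real b"
    using assms(1) by (auto simp: closed_segment_def)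
  have "z = of_real ((1 - u) * a + u * b)" using u by (simp add: scaleR_conv_of_real)
  moreover have "(1 - u) * a + u * b \<ge> (1 - u) * c + u * c" using u assms by (intro add_mono mult_left_mono) auto
  ultimately show ?thesis by (intro exI[of _ "(1 - u) * a + u * b"]) (simp add: algebra_simps)
qed

text \<open>The successive derivatives of \<open>z powr w\<close>, with falling factorials as
  coefficients, in the form required by \<open>complex_Taylor\<close>.\<close>

lemma powr_Taylor_family:
  fixes w :: complex
  assumes "z \<notin> \<real>\<^sub>\<le>\<^sub>0"
  shows "((\<lambda>z. (\<Prod>j<i. w - of_nat j) * z powr (w - of_nat i)) has_field_derivative
     (\<Prod>j<Suc i. w - of_nat j) * z powr (w - of_nat (Suc i))) (at z within S)"
proof -
  have "((\<lambda>z. (\<Prod>j<i. w - of_nat j) * z powr (w - of_nat i)) has_field_derivative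
     (\<Prod>j<i. w - of_nat j) * ((w - of_nat i) * z powr (w - of_nat i - 1))) (at z)"
    using assms by (intro DERIV_cmult has_field_derivative_powr)
  then show ?thesis by (simp add: mult.assoc diff_diff_eq add.commute has_field_derivative_at_within)
qed

text \<open>Taylor's formula of order 0 in the base, along the real segment. The condition
  \<open>Re s > -1\<close> makes the modulus of the derivative decreasing, so it is largest at
  \<open>c\<close>.\<close>

lemma rpow_diff_bound:
  assumes "a \<ge> c" "b \<ge> c" "c > 0" "Re s > -1"
  shows "norm (rpow a (-s) - rpow b (-s)) \<le> norm s * \<bar>a - b\<bar> * c powr (- Re s - 1)"
proof -
  define f where "f = (\<lambda>i z. (\<Prod>j<i. - s - of_nat j) * z powr (- s - of_nat i))"
  let ?S = "closed_segment (of_real b) (of_real a) :: complex set"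
  have St: "\<exists>t\<ge>c. z = of_real t" if "z \<in> ?S" for z using segment_of_real[OF that] assms by auto
  have "norm (f 0 (of_real a) - (\<Sum>i\<le>0. f i (of_real b) * (of_real a - of_real b) ^ i / fact i)) 
     \<le> (norm s * c powr (- Re s - 1)) * norm (of_real a - of_real b :: complex) ^ Suc 0 / fact 0"
  proof (rule complex_Taylor)
    show "convex ?S" by simp
    show "(f i has_field_derivative f (Suc i) x) (at x within ?S)" if "x \<in> ?S" for i x
      unfolding f_def using St[OF that] assms by (intro powr_Taylor_family) (auto simp: complex_nonpos_Reals_iff)
    fix x assume "x \<in> ?S"
    then obtain t where t: "t \<ge> c" "x = of_real t" using St by blast
    have "norm (f (Suc 0) x) = norm s * t powr (- Re s - 1)"
      using t assms by (simp add: f_def norm_mult norm_powr_real_powr)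
    also have "\<dots> \<le> norm s * c powr (- Re s - 1)" using t assms by (intro mult_left_mono powr_mono2') auto
    finally show "norm (f (Suc 0) x) \<le> norm s * c powr (- Re s - 1)" .
  qed auto
  then have "norm (of_real a powr (-s) - of_real b powr (-s)) \<le> norm s * c powr (- Re s - 1) * \<bar>a - b\<bar>"
    by (simp add: f_def flip: of_real_diff)
  then show ?thesis using assms by (simp add: rpow_eq_powr mult_ac)
qed

text \<open>The midpoint rule: in the difference of the second order expansions about
  \<open>m\<close>, the constant and quadratic terms cancel and the linear one is
  \<open>(1 - w) * rpow m (- w)\<close>. The bound comes from the third derivative: three factors of
  size at most \<open>1 + norm w\<close>, and a power taken at \<open>m / 2\<close>, which lies
  below the whole segment.\<close>

lemma midpoint_bound:
  assumes m: "m \<ge> 1" and w: "Re w > -1"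
  shows "norm (rpow (m + 1/2) (1 - w) - rpow (m - 1/2) (1 - w) - (1 - w) * rpow m (- w))
    \<le> (1 + norm w) ^ 3 * (2 powr (Re w + 2) * m powr (- Re w - 2))"
proof -
  define f where "f = (\<lambda>i z. (\<Prod>j<i. (1 - w) - of_nat j) * z powr ((1 - w) - of_nat i))"
  let ?S = "closed_segment (of_real (m - 1/2)) (of_real (m + 1/2)) :: complex set"
  have St: "\<exists>t\<ge>m / 2. z = of_real t" if "z \<in> ?S" for z using segment_of_real[OF that, of "m / 2"] m by simp
  define B where "B = (1 + norm w) ^ 3 * (2 powr (Re w + 2) * m powr (- Re w - 2))"
  have tay: "norm (f 0 z - (\<Sum>i\<le>2. f i (of_real m) * (z - of_real m) ^ i / fact i)) \<le> B * norm (z - of_real m) ^ Suc 2 / fact 2" 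
    if z: "z \<in> ?S" for z
  proof (rule complex_Taylor)
    show "convex ?S" by simp
    show "(f i has_field_derivative f (Suc i) x) (at x within ?S)" if "x \<in> ?S" for i x
      unfolding f_def using St[OF that] m by (intro powr_Taylor_family) (auto simp: complex_nonpos_Reals_iff)
    show "of_real m \<in> ?S"
      unfolding closed_segment_def by (intro CollectI exI[of _ "1/2"]) (simp add: scaleR_conv_of_real field_simps)
    fix x assume "x \<in> ?S"
    then obtain t where t: "t \<ge> m / 2" "x = of_real t" using St by blast
    have "norm (1 - w) \<le> 1 + norm w" "norm (- 1 - w) \<le> 1 + norm w"
      using norm_triangle_ineq4[of 1 w] norm_triangle_ineq4[of "-1" w] by auto
    then have "norm (1 - w) * norm w * norm (- 1 - w) \<le> (1 + norm w) * (1 + norm w) * (1 + norm w)"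
      by (intro mult_mono) auto
    moreover have "t powr (- Re w - 2) \<le> (m / 2) powr (- Re w - 2)"
      using t w m by (intro powr_mono2') auto
    moreover have "(m / 2) powr (- Re w - 2) = 2 powr (Re w + 2) * m powr (- Re w - 2)"
    proof -
      have "- Re w - 2 = - (Re w + 2)" by simp
      then show ?thesis using m by (simp only: powr_divide powr_minus) (simp add: field_simps)
    qed
    moreover have "norm (f (Suc 2) x) = norm (1 - w) * norm w * norm (- 1 - w) * t powr (- Re w - 2)"
    proof -
      have "- Re w - 2 = -2 - Re w" by simp
      then show ?thesis
        using t m by (simp only:) (simp add: f_def norm_mult norm_powr_real_powr numeral_2_eq_2 numeral_3_eq_3)
    qed
    ultimately show "norm (f (Suc 2) x) \<le> B"
      unfolding B_def by (auto simp: power3_eq_cube intro!: mult_mono)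
  qed (use z in auto)
  have B0: "B \<ge> 0" by (simp add: B_def)
  let ?p = "complex_of_real (m + 1/2)" and ?q = "complex_of_real (m - 1/2)"
  have a: "norm (f 0 ?p - (f 0 m + f 1 m / 2 + f 2 m / 8)) \<le> B / 2"
    using tay[of ?p] B0 by (simp add: numeral_2_eq_2 power_divide field_simps norm_divide)
  have b: "norm (f 0 ?q - (f 0 m - f 1 m / 2 + f 2 m / 8)) \<le> B / 2"
    using tay[of ?q] B0 by (simp add: numeral_2_eq_2 power_divide field_simps norm_divide)
  have "f 0 ?p - f 0 ?q - f 1 m = (f 0 ?p - (f 0 m + f 1 m / 2 + f 2 m / 8)) - (f 0 ?q - (f 0 m - f 1 m / 2 + f 2 m / 8))"
    by (simp add: field_simps)
  then have "norm (f 0 ?p - f 0 ?q - f 1 m) \<le> B / 2 + B / 2"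
    using order_trans[OF norm_triangle_ineq4 add_mono[OF a b]] by (simp only:)
  moreover have "f 0 ?p = rpow (m + 1/2) (1 - w)" "f 0 ?q = rpow (m - 1/2) (1 - w)" "f 1 m = (1 - w) * rpow m (- w)"
    using m by (simp_all add: f_def rpow_eq_powr)
  ultimately have "norm (rpow (m + 1/2) (1 - w) - rpow (m - 1/2) (1 - w) - (1 - w) * rpow m (- w)) \<le> B" by simp
  then show ?thesis unfolding B_def .
qed

section \<open>Continuation of the zeta series\<close>

text \<open>All that the zeta function needs to know about the operator; \<open>d\<close> will be
  \<open>y 1\<close>.\<close>

locale spectral_sequence =
  fixes e :: "nat \<Rightarrow> real" and C d :: real
  assumes e_pos: "\<And>n. e n > 0"
    and e_asymp: "\<And>n. \<bar>e n - (real (Suc n) * pi)\<^sup>2\<bar> \<le> C"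
    and d_pos: "d > 0"
    and e_prod: "(\<lambda>N. \<Prod>n<N. (real (Suc n) * pi)\<^sup>2 / e n) \<longlonglongrightarrow> 1 / d"
begin

text \<open>Subtracting the integral of \<open>(\<pi>x) powr (- 2 * s)\<close> over a unit interval around \<open>n + 1\<close>, as in
  the midpoint rule, makes the zeta series converge for \<open>Re s > -1/2\<close>; the factor \<open>1 - 2 * s\<close>
  clears the pole of that integral at \<open>s = 1/2\<close>.\<close>
definition zeta_term :: "nat \<Rightarrow> complex \<Rightarrow> complex" where
  "zeta_term n s = (1 - 2 * s) * rpow (e n) (- s)
     - rpow pi (- 2 * s) * (rpow (real n + 3/2) (1 - 2 * s) - rpow (real n + 1/2) (1 - 2 * s))"

lemma zeta_term_hol: "zeta_term n holomorphic_on A"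
  unfolding zeta_term_def by (intro holomorphic_intros)

text \<open>Two errors are added: replacing \<open>e n\<close> by its free value, controlled by
  \<open>C\<close> and \<open>rpow_diff_bound\<close>, and the midpoint rule with
  \<open>w = 2 * s\<close>. Both are of order \<open>n powr (- 2 * Re s - 2)\<close>, which is
  summable exactly for \<open>Re s > -1/2\<close>.\<close>

lemma zeta_term_bound:
  assumes M: "norm s \<le> M" and s: "Re s > -1/2" and n: "2 * C \<le> (real (Suc n) * pi)\<^sup>2"
  shows "norm (zeta_term n s) \<le> ((1 + 2 * M) * M * C + pi powr (2 * M) * ((1 + 2 * M) ^ 3 * 2 powr (2 * M + 2))) * real (Suc n) powr (- 2 * Re s - 2)"
proof -
  define m where "m = real (Suc n)"
  have m: "m \<ge> 1" by (simp add: m_def)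
  have M0: "M \<ge> 0" using M norm_ge_zero order_trans by blast
  have C0: "C \<ge> 0" using e_asymp[of 0] by linarith
  have Re: "\<bar>Re s\<bar> \<le> M" using M abs_Re_le_cmod[of s] by linarith
  have n2: "2 * norm s \<le> 2 * M" using M by simp
  have n12: "norm (1 - 2 * s) \<le> 1 + 2 * M"
    using norm_triangle_ineq4[of 1 "2 * s"] n2 by (simp add: norm_mult)
  have pi2: "2 * 2 \<le> pi * pi" using pi_ge_two by (intro mult_mono) auto
  have mpi: "2 * m\<^sup>2 \<le> (m * pi)\<^sup>2"
  proof -
    have "m\<^sup>2 * 2 \<le> m\<^sup>2 * (pi * pi)" using pi2 by (intro mult_left_mono) auto
    then show ?thesis by (simp add: power2_eq_square mult_ac)
  qed
  \<comment> \<open>The assumption on \<open>n\<close> keeps the perturbation below half of the free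
    eigenvalue, and half of \<open>(m * pi)\<^sup>2\<close> still exceeds
    \<open>m\<^sup>2\<close>.\<close>
  have e_ge: "e n \<ge> m\<^sup>2" using e_asymp[of n] n mpi unfolding m_def[symmetric] by (simp add: abs_le_iff)
  have mpi': "(m * pi)\<^sup>2 \<ge> m\<^sup>2" using mpi zero_le_power2[of m] by linarith
  have "norm (rpow (e n) (-s) - rpow ((m * pi)\<^sup>2) (-s)) \<le> norm s * \<bar>e n - (m * pi)\<^sup>2\<bar> * m\<^sup>2 powr (- Re s - 1)"
    by (rule rpow_diff_bound) (use e_ge mpi' m s in auto)
  also have "\<dots> \<le> M * C * m\<^sup>2 powr (- Re s - 1)"
    using M M0 C0 e_asymp[of n] by (intro mult_right_mono mult_mono) (auto simp: m_def)
  also have "m\<^sup>2 powr (- Re s - 1) = m powr (- 2 * Re s - 2)"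
  proof -
    have "m\<^sup>2 powr (- Re s - 1) = (m powr 2) powr (- Re s - 1)" using m by simp
    also have "\<dots> = m powr (2 * (- Re s - 1))" by (rule powr_powr)
    also have "2 * (- Re s - 1) = - 2 * Re s - 2" by (simp add: algebra_simps)
    finally show ?thesis .
  qed
  finally have p1: "norm (rpow (e n) (-s) - rpow ((m * pi)\<^sup>2) (-s)) \<le> M * C * m powr (- 2 * Re s - 2)" .
  have "norm (rpow (m + 1/2) (1 - 2 * s) - rpow (m - 1/2) (1 - 2 * s) - (1 - 2 * s) * rpow m (- (2 * s)))
    \<le> (1 + norm (2 * s)) ^ 3 * (2 powr (Re (2 * s) + 2) * m powr (- Re (2 * s) - 2))"
    by (rule midpoint_bound[OF m]) (use s in simp)
  also have "\<dots> \<le> (1 + 2 * M) ^ 3 * (2 powr (2 * M + 2) * m powr (- 2 * Re s - 2))"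
    using n2 Re M0 m by (intro mult_mono power_mono powr_mono) (auto simp: norm_mult)
  finally have p2: "norm (rpow (m + 1/2) (1 - 2 * s) - rpow (m - 1/2) (1 - 2 * s) - (1 - 2 * s) * rpow m (- (2 * s)))
    \<le> (1 + 2 * M) ^ 3 * (2 powr (2 * M + 2) * m powr (- 2 * Re s - 2))" .
  have p3: "norm (rpow pi (- 2 * s)) \<le> pi powr (2 * M)"
    using Re pi_ge_two by (subst norm_rpow) (auto intro!: powr_mono)
  have sq: "rpow ((m * pi)\<^sup>2) (- s) = rpow pi (- 2 * s) * rpow m (- (2 * s))"
    using m by (simp add: rpow_def ln_realpow ln_mult exp_add[symmetric] algebra_simps)
  have mn: "m + 1/2 = real n + 3/2" "m - 1/2 = real n + 1/2" by (simp_all add: m_def)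
  have "zeta_term n s = (1 - 2 * s) * (rpow (e n) (-s) - rpow ((m * pi)\<^sup>2) (-s)) 
     - rpow pi (- 2 * s) * (rpow (m + 1/2) (1 - 2 * s) - rpow (m - 1/2) (1 - 2 * s) - (1 - 2 * s) * rpow m (- (2 * s)))"
    unfolding zeta_term_def sq mn by (simp add: algebra_simps)
  then have "norm (zeta_term n s) \<le> norm (1 - 2 * s) * norm (rpow (e n) (-s) - rpow ((m * pi)\<^sup>2) (-s)) 
     + norm (rpow pi (- 2 * s)) * norm (rpow (m + 1/2) (1 - 2 * s) - rpow (m - 1/2) (1 - 2 * s) - (1 - 2 * s) * rpow m (- (2 * s)))"
    by (simp only: norm_mult[symmetric] norm_triangle_ineq4)
  also have "\<dots> \<le> (1 + 2 * M) * (M * C * m powr (- 2 * Re s - 2)) + pi powr (2 * M) * ((1 + 2 * M) ^ 3 * (2 powr (2 * M + 2) * m powr (- 2 * Re s - 2)))"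
    using n12 p1 p2 p3 M0 by (intro add_mono mult_mono) auto
  also have "\<dots> = ((1 + 2 * M) * M * C + pi powr (2 * M) * ((1 + 2 * M) ^ 3 * 2 powr (2 * M + 2))) * m powr (- 2 * Re s - 2)"
    by (simp only: distrib_right mult.assoc)
  finally show ?thesis by (simp only: m_def)
qed

abbreviation H :: "complex set" where "H \<equiv> {s. Re s > -1/2}"

lemma open_H: "open H" by (simp add: open_halfspace_Re_gt)

lemma zeta_term_series:
  "\<exists>g g'. \<forall>s\<in>H. ((\<lambda>n. zeta_term n s) sums g s) \<and> ((\<lambda>n. deriv (zeta_term n) s) sums g' s) \<and> (g has_field_derivative g' s) (at s)"
proof (rule series_and_derivative_comparison_local[OF open_H])
  show "(zeta_term n has_field_derivative deriv (zeta_term n) x) (at x)" if "x \<in> H" for n x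
    by (rule holomorphic_derivI[OF zeta_term_hol open_UNIV]) simp
  fix x assume x: "x \<in> H"
  \<comment> \<open>Half the distance to the line \<open>Re s = -1/2\<close>: on the ball of radius
    \<open>r\<close> the exponents of the majorant stay below a fixed number less than -1.\<close>
  define r where "r = (Re x + 1/2) / 2"
  have r: "r > 0" using x by (simp add: r_def)
  define M where "M = norm x + r"
  define K where "K = (1 + 2 * M) * M * C + pi powr (2 * M) * ((1 + 2 * M) ^ 3 * 2 powr (2 * M + 2))"
  define h where "h n = K * real (Suc n) powr (- 2 * (Re x - r) - 2)" for n
  have C0: "C \<ge> 0" using e_asymp[of 0] by linarith
  have M0: "M \<ge> 0" using r by (simp add: M_def)
  have K0: "K \<ge> 0" unfolding K_def using C0 M0 by (intro add_nonneg_nonneg mult_nonneg_nonneg) auto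
  have "summable h"
  proof -
    have "- 2 * (Re x - r) - 2 < -1" using x by (simp add: r_def field_simps)
    then have "summable (\<lambda>n. real n powr (- 2 * (Re x - r) - 2))" by (simp add: summable_real_powr_iff)
    then have "summable (\<lambda>n. real (Suc n) powr (- 2 * (Re x - r) - 2))" by (subst summable_Suc_iff)
    then show ?thesis unfolding h_def by (rule summable_mult)
  qed
  moreover have "\<forall>\<^sub>F n in sequentially. \<forall>y\<in>ball x r \<inter> H. norm (zeta_term n y) \<le> h n"
  proof -
    obtain n0 :: nat where n0: "real n0 \<ge> 2 * C" using real_arch_simple by blast
    show ?thesis unfolding eventually_sequentially
    proof (intro exI[of _ n0] allI impI ballI)
      fix n y assume n: "n0 \<le> n" and y: "y \<in> ball x r \<inter> H"
      have "2 * C \<le> real (Suc n) * 1" using n0 n by simp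
      also have "\<dots> \<le> real (Suc n) * pi" using pi_ge_two by (intro mult_left_mono) auto
      also have "\<dots> \<le> (real (Suc n) * pi)\<^sup>2"
      proof -
        have "1 * 1 \<le> real (Suc n) * pi" using pi_ge_two by (intro mult_mono) auto
        then show ?thesis by (simp add: self_le_power)
      qed
      finally have n': "2 * C \<le> (real (Suc n) * pi)\<^sup>2" .
      have nxy: "norm (x - y) < r" using y by (simp add: dist_norm)
      have My: "norm y \<le> M" using nxy norm_triangle_sub[of y x] by (simp add: M_def norm_minus_commute)
      have "Re x - Re y \<le> r" using nxy abs_Re_le_cmod[of "x - y"] by simp
      then have "real (Suc n) powr (- 2 * Re y - 2) \<le> real (Suc n) powr (- 2 * (Re x - r) - 2)"
        by (intro powr_mono) auto
      then have "K * real (Suc n) powr (- 2 * Re y - 2) \<le> h n" unfolding h_def using K0 by (rule mult_left_mono)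
      moreover have "norm (zeta_term n y) \<le> K * real (Suc n) powr (- 2 * Re y - 2)"
        unfolding K_def by (rule zeta_term_bound[OF My _ n']) (use y in simp)
      ultimately show "norm (zeta_term n y) \<le> h n" by linarith
    qed
  qed
  ultimately show "\<exists>d h. 0 < d \<and> summable h \<and> (\<forall>\<^sub>F n in sequentially. \<forall>y\<in>ball x d \<inter> H. norm (zeta_term n y) \<le> h n)"
    using r by blast
qed

section \<open>The derivative at zero and Stirling's constant\<close>

lemma deriv_zeta_term_0:
  "deriv (zeta_term n) 0 = of_real (- 2 - ln (e n) + 2 * ln pi
     + 2 * ((real n + 3/2) * ln (real n + 3/2) - (real n + 1/2) * ln (real n + 1/2)))"
proof -
  have rpow1: "x > 0 \<Longrightarrow> exp (complex_of_real (ln x)) = of_real x" for x by (simp add: exp_of_real)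
  have "(zeta_term n has_field_derivative of_real (- 2 - ln (e n) + 2 * ln pi
     + 2 * ((real n + 3/2) * ln (real n + 3/2) - (real n + 1/2) * ln (real n + 1/2)))) (at 0)"
    unfolding zeta_term_def rpow_def
    by (rule derivative_eq_intros refl | simp)+ (simp add: rpow1 algebra_simps)
  then show ?thesis by (rule DERIV_imp_deriv)
qed

text \<open>The partial sums split into the Stirling sequence \<open>T\<close> and the logarithm
  \<open>L\<close> of the product of ratios, which tends to \<open>- ln d\<close>. As the whole
  series converges by \<open>zeta_term_series\<close>, so does \<open>T\<close>, and its limit is
  then known.\<close>

lemma deriv_zeta_term_0_sums: "(\<lambda>n. deriv (zeta_term n) 0) sums of_real (1 - ln pi - ln d)"
proof -
  define a where "a n = - 2 - ln (e n) + 2 * ln pi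
     + 2 * ((real n + 3/2) * ln (real n + 3/2) - (real n + 1/2) * ln (real n + 1/2))" for n
  define T where "T N = 2 * ((real N + 1/2) * ln (real N + 1/2)) - 2 * real N - 2 * ln (fact N)" for N :: nat
  define L where "L N = ln (\<Prod>n<N. (real (Suc n) * pi)\<^sup>2 / e n)" for N
  \<comment> \<open>The constant \<open>ln 2\<close> compensates the starting value
    \<open>T 0 = ln (1/2)\<close>.\<close>
  have part: "(\<Sum>n<N. a n) = T N + L N + ln 2" for N
  proof (induction N)
    case 0
    then show ?case by (simp add: T_def L_def ln_div)
  next
    case (Suc N)
    have "(\<Prod>n<N. (real (Suc n) * pi)\<^sup>2 / e n) > 0" using e_pos by (intro prod_pos) (auto simp del: of_nat_Suc)
    moreover have "(real (Suc N) * pi)\<^sup>2 / e N > 0" using e_pos[of N] by (simp del: of_nat_Suc)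
    ultimately have "L (Suc N) = L N + ln ((real (Suc N) * pi)\<^sup>2 / e N)"
      unfolding L_def prod.lessThan_Suc by (rule ln_mult_pos)
    also have "ln ((real (Suc N) * pi)\<^sup>2 / e N) = 2 * ln (real (Suc N)) + 2 * ln pi - ln (e N)"
      using e_pos[of N] by (simp add: ln_mult ln_div ln_realpow del: of_nat_Suc)
    finally have L: "L (Suc N) = L N + (2 * ln (real (Suc N)) + 2 * ln pi - ln (e N))" .
    have T: "T (Suc N) = T N + 2 * ((real N + 3/2) * ln (real N + 3/2) - (real N + 1/2) * ln (real N + 1/2)) - 2 - 2 * ln (real (Suc N))"
    proof -
      have "ln (fact (Suc N) :: real) = ln (real (Suc N)) + ln (fact N)" by (simp add: ln_mult del: of_nat_Suc)
      moreover have "real (Suc N) + 1/2 = real N + 3/2" by simp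
      ultimately show ?thesis unfolding T_def by (simp add: algebra_simps)
    qed
    show ?case unfolding sum.lessThan_Suc Suc L T a_def[of N] by simp
  qed
  obtain g g' where g: "\<And>s. s \<in> H \<Longrightarrow> (\<lambda>n. deriv (zeta_term n) s) sums g' s" using zeta_term_series by blast
  have "(\<lambda>n. complex_of_real (a n)) sums g' 0" using g[of 0] unfolding deriv_zeta_term_0 a_def[symmetric] by simp
  then have "a sums Re (g' 0)" using sums_Re by fastforce
  then have A: "(\<lambda>N. T N + L N + ln 2) \<longlonglongrightarrow> Re (g' 0)" unfolding sums_def part .
  have Ll: "L \<longlonglongrightarrow> - ln d" 
    using tendsto_ln[OF e_prod] d_pos unfolding L_def[abs_def] by (simp add: ln_div)
  have "(\<lambda>N. (T N + L N + ln 2) - L N - ln 2) \<longlonglongrightarrow> Re (g' 0) - (- ln d) - ln 2"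
    by (intro tendsto_diff A Ll tendsto_const)
  then have "T \<longlonglongrightarrow> Re (g' 0) + ln d - ln 2" by simp
  then have "Re (g' 0) + ln d - ln 2 = 1 - ln (2 * pi)" unfolding T_def[abs_def] by (rule stirling_limit_unique)
  then have "Re (g' 0) = 1 - ln pi - ln d" by (simp add: ln_mult)
  with \<open>a sums Re (g' 0)\<close> have "a sums (1 - ln pi - ln d)" by simp
  then show ?thesis unfolding deriv_zeta_term_0 a_def[symmetric] by (rule sums_of_real)
qed

text \<open>The lower end, at 1/2, of the telescoping sum of power differences in
  \<open>zeta_term\<close>.\<close>

definition boundary_term :: "complex \<Rightarrow> complex" where "boundary_term s = rpow pi (- 2 * s) * rpow (1/2) (1 - 2 * s)"

lemma zeta_term_partial: "(\<Sum>n<N. zeta_term n s) = (1 - 2 * s) * (\<Sum>n<N. rpow (e n) (- s)) - rpow pi (- 2 * s) * rpow (real N + 1/2) (1 - 2 * s) + boundary_term s"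
proof (induction N)
  case (Suc N)
  have "real (Suc N) + 1/2 = real N + 3/2" by simp
  then show ?case unfolding sum.lessThan_Suc Suc by (simp only: zeta_term_def) (simp add: algebra_simps)
qed (simp add: boundary_term_def)

text \<open>For \<open>Re s > 1/2\<close> the upper end of the telescoping sum tends to 0, so only
  \<open>boundary_term\<close> remains.\<close>

lemma eigen_sums:
  assumes s: "Re s > 1/2" and g: "(\<lambda>n. zeta_term n s) sums g"
  shows "(\<lambda>n. rpow (e n) (- s)) sums ((g - boundary_term s) / (1 - 2 * s))"
proof -
  have nz: "1 - 2 * s \<noteq> 0" using s by (auto simp: complex_eq_iff)
  have eq: "(\<Sum>n<N. rpow (e n) (- s)) = ((\<Sum>n<N. zeta_term n s) + rpow pi (- 2 * s) * rpow (real N + 1/2) (1 - 2 * s) - boundary_term s) / (1 - 2 * s)" for N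
    unfolding zeta_term_partial using nz by (simp add: field_simps)
  have "(\<lambda>N. rpow (real N + 1/2) (1 - 2 * s)) \<longlonglongrightarrow> 0"
  proof (rule Lim_null_comparison)
    show "\<forall>\<^sub>F N in sequentially. norm (rpow (real N + 1/2) (1 - 2 * s)) \<le> (real N + 1/2) powr (1 - 2 * Re s)"
      by (intro always_eventually allI) (subst norm_rpow, auto)
    have "filterlim (\<lambda>N. real N + 1/2) at_top sequentially"
      using filterlim_tendsto_add_at_top[OF tendsto_const filterlim_real_sequentially, of "1/2"] by (simp add: add.commute)
    then show "(\<lambda>N. (real N + 1/2) powr (1 - 2 * Re s)) \<longlonglongrightarrow> 0"
      using s by (intro tendsto_neg_powr) auto
  qed
  then have "(\<lambda>N. ((\<Sum>n<N. zeta_term n s) + rpow pi (- 2 * s) * rpow (real N + 1/2) (1 - 2 * s) - boundary_term s) / (1 - 2 * s)) \<longlonglongrightarrow> (g + rpow pi (- 2 * s) * 0 - boundary_term s) / (1 - 2 * s)"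
    using g nz unfolding sums_def by (intro tendsto_intros)
  then show ?thesis unfolding sums_def eq by simp
qed

lemma zeta_exists:
  "\<exists>Z. Z meromorphic_on H \<and> Z analytic_on {0} \<and>
     (\<forall>s. Re s > 1/2 \<longrightarrow> summable (\<lambda>n. norm (rpow (e n) (- s))) \<and> (\<lambda>n. rpow (e n) (- s)) sums Z s) \<and>
     deriv Z 0 = of_real (- ln (2 * d))"
proof -
  obtain g g' where g: "\<And>s. s \<in> H \<Longrightarrow> (\<lambda>n. zeta_term n s) sums g s" "\<And>s. s \<in> H \<Longrightarrow> (\<lambda>n. deriv (zeta_term n) s) sums g' s"
     "\<And>s. s \<in> H \<Longrightarrow> (g has_field_derivative g' s) (at s)" using zeta_term_series by blast
  define G where "G s = g s - boundary_term s" for s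
  define Z where "Z s = G s / (1 - 2 * s)" for s
  have gh: "g holomorphic_on H" unfolding holomorphic_on_open[OF open_H] using g(3) by blast
  have Gh: "G holomorphic_on H" unfolding G_def boundary_term_def by (intro holomorphic_intros gh)
  have Ga: "G analytic_on H" using Gh open_H by (simp add: analytic_on_open)
  have "Z meromorphic_on H" unfolding Z_def
    by (intro meromorphic_intros analytic_on_imp_meromorphic_on Ga)
  moreover have "Z analytic_on {0}" unfolding Z_def
    by (intro analytic_intros analytic_on_subset[OF Ga]) auto
  moreover have "summable (\<lambda>n. norm (rpow (e n) (- s))) \<and> (\<lambda>n. rpow (e n) (- s)) sums Z s" if s: "Re s > 1/2" for s
  proof
    show "(\<lambda>n. rpow (e n) (- s)) sums Z s" unfolding Z_def G_def by (rule eigen_sums[OF s g(1)]) (use s in simp)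
    \<comment> \<open>Absolute convergence comes for free: at the real point \<open>Re s\<close> the
      terms are positive and equal to the moduli of the terms at \<open>s\<close>.\<close>
    have "(\<lambda>n. rpow (e n) (- of_real (Re s))) sums ((g (of_real (Re s)) - boundary_term (of_real (Re s))) / (1 - 2 * of_real (Re s)))"
      by (rule eigen_sums[OF _ g(1)]) (use s in simp_all)
    then have "summable (\<lambda>n. Re (rpow (e n) (- of_real (Re s))))" by (rule summable_Re[OF sums_summable])
    moreover have "Re (rpow (e n) (- of_real (Re s))) = norm (rpow (e n) (- s))" for n
      using e_pos[of n] by (simp add: norm_rpow) (simp add: rpow_def powr_def Re_exp)
    ultimately show "summable (\<lambda>n. norm (rpow (e n) (- s)))" by simp
  qed
  moreover have "deriv Z 0 = of_real (- ln (2 * d))"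
  proof -
    have H0: "0 \<in> H" by simp
    have g0: "g 0 = 0"
    proof -
      have "zeta_term n 0 = 0" for n by (simp add: zeta_term_def rpow_def exp_of_real)
      then show ?thesis using g(1)[OF H0] sums_unique2[OF _ sums_zero] by simp
    qed
    have g'0: "g' 0 = of_real (1 - ln pi - ln d)" using sums_unique2[OF g(2)[OF H0] deriv_zeta_term_0_sums] .
    have c0: "boundary_term 0 = 1/2" by (simp add: boundary_term_def rpow_def exp_of_real)
    have cd: "(boundary_term has_field_derivative of_real (- ln pi + ln 2)) (at 0)"
    proof -
      have "exp (complex_of_real (ln (1/2))) = 1/2" by (simp add: exp_of_real)
      moreover have "ln (1/2 :: real) = - ln 2" by (simp add: ln_div)
      ultimately have h: "exp (- complex_of_real (ln 2)) = 1/2" by simp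
      show ?thesis unfolding boundary_term_def rpow_def \<open>ln (1/2) = - ln 2\<close>
        by (rule derivative_eq_intros refl | simp)+ (simp add: h)
    qed
    have "(G has_field_derivative of_real (1 - ln pi - ln d) - of_real (- ln pi + ln 2)) (at 0)"
      unfolding G_def using g(3)[OF H0] cd unfolding g'0 by (intro DERIV_diff)
    then have "(Z has_field_derivative ((of_real (1 - ln pi - ln d) - of_real (- ln pi + ln 2)) * (1 - 2 * 0) - G 0 * (- 2)) / ((1 - 2 * 0) * (1 - 2 * 0))) (at 0)"
      unfolding Z_def by (intro DERIV_divide) (auto intro!: derivative_eq_intros)
    then have "deriv Z 0 = ((of_real (1 - ln pi - ln d) - of_real (- ln pi + ln 2)) * (1 - 2 * 0) - G 0 * (- 2)) / ((1 - 2 * 0) * (1 - 2 * 0))"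
      by (rule DERIV_imp_deriv)
    \<comment> \<open>Here \<open>G 0 = - 1/2\<close>, so the quotient rule gives
      \<open>G' 0 + 2 * G 0\<close>. The resulting -1 cancels the 1 from Stirling's constant, the
      two \<open>ln pi\<close> cancel, and \<open>- ln 2\<close> comes from the boundary
      term.\<close>
    also have "\<dots> = of_real (- ln (2 * d))" using d_pos by (simp add: G_def g0 c0 ln_mult)
    finally show ?thesis .
  qed
  ultimately show ?thesis by blast
qed

end

section \<open>The determinant\<close>

text \<open>On an interval of finite measure
  \<open>\<bar>v\<bar> \<le> 1 + \<bar>v\<bar> powr p\<close> for \<open>p \<ge> 1\<close> reduces
  every finite exponent to integrability; infinity is the bounded case.\<close>

lemma memLq_imp_integrable:
  assumes q: "1 \<le> q" and V: "memLq q V"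
  shows "set_integrable lborel {0..1} V"
proof -
  have meas: "(\<lambda>x. indicator {0..1} x *\<^sub>R V x) \<in> borel_measurable lborel"
    using V unfolding memLq_def by (simp add: borel_measurable_restrict_space_iff)
  have one: "set_integrable lborel {0..1::real} (\<lambda>_. c::real)" for c
    by (intro borel_integrable_atLeastAtMost' continuous_intros)
  show ?thesis
  proof (cases "q = \<infinity>")
    case True
    then obtain C where C: "AE x in lborel. x \<in> {0..1} \<longrightarrow> \<bar>V x\<bar> \<le> C" using V by (auto simp: memLq_def)
    show ?thesis unfolding set_integrable_def
    proof (rule Bochner_Integration.integrable_bound[OF one[of C, unfolded set_integrable_def] meas])
      show "AE x in lborel. norm (indicator {0..1} x *\<^sub>R V x) \<le> norm (indicator {0..1} x *\<^sub>R C)"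
        using C by (rule AE_mp) (auto intro!: AE_I2 simp: indicator_def)
    qed
  next
    case False
    then have i: "set_integrable lborel {0..1} (\<lambda>x. \<bar>V x\<bar> powr enn2real q)" using V by (auto simp: memLq_def)
    have "q < top" using False by (simp add: less_top[symmetric])
    then have p: "enn2real q \<ge> 1" using enn2real_mono[OF q] by simp
    have le: "\<bar>v\<bar> \<le> 1 + \<bar>v\<bar> powr enn2real q" for v :: real
    proof (cases "\<bar>v\<bar> \<le> 1")
      case False
      then have "\<bar>v\<bar> powr 1 \<le> \<bar>v\<bar> powr enn2real q" using p by (intro powr_mono) auto
      then show ?thesis using False by simp
    qed (simp add: add_increasing2)
    have "set_integrable lborel {0..1} (\<lambda>x. 1 + \<bar>V x\<bar> powr enn2real q)" by (rule set_integral_add(1)[OF one i])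
    then show ?thesis unfolding set_integrable_def
    proof (rule Bochner_Integration.integrable_bound[OF _ meas])
      show "AE x in lborel. norm (indicator {0..1} x *\<^sub>R V x) \<le> norm (indicator {0..1} x *\<^sub>R (1 + \<bar>V x\<bar> powr enn2real q))"
        using le by (auto intro!: AE_I2 simp: indicator_def)
    qed
  qed
qed

text \<open>The identity theorem on a connected half plane: a meromorphic function either equals 0
  or avoids 0 off a sparse set, and near \<open>s = 1\<close> the difference is 0.\<close>

lemma zeta_continuation_deriv_unique:
  assumes "zeta_continuation V Z1" "zeta_continuation V Z2"
  shows "deriv Z1 0 = deriv Z2 0"
proof -
  let ?A = "{s. Re s > -1/2}"
  have A: "open ?A" "connected ?A"
    by (simp_all add: open_halfspace_Re_gt convex_connected convex_halfspace_Re_gt)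
  have m: "(\<lambda>s. Z1 s - Z2 s) meromorphic_on ?A"
    using assms unfolding zeta_continuation_def by (intro meromorphic_intros) auto
  have eq: "Z1 s - Z2 s = 0" if "Re s > 1/2" for s using assms that by (simp add: zeta_continuation_def)
  have "\<not> eventually (\<lambda>s. Z1 s - Z2 s \<noteq> 0) (cosparse ?A)"
  proof
    assume "eventually (\<lambda>s. Z1 s - Z2 s \<noteq> 0) (cosparse ?A)"
    then have "eventually (\<lambda>s. Z1 s - Z2 s \<noteq> 0) (at 1)"
      using A(1) by (simp add: eventually_cosparse_open_eq)
    moreover have "eventually (\<lambda>s. s \<in> {s. Re s > 1/2}) (at (1::complex))"
      by (rule eventually_at_in_open'[OF open_halfspace_Re_gt]) simp
    then have "eventually (\<lambda>s. Z1 s - Z2 s = 0) (at 1)" by eventually_elim (use eq in auto)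
    ultimately have "eventually (\<lambda>s. False) (at (1::complex))" by eventually_elim simp
    then show False by simp
  qed
  then have "eventually (\<lambda>s. Z1 s - Z2 s = 0) (cosparse ?A)"
    using meromorphic_imp_constant_or_avoid[OF m A] by blast
  then have ev: "eventually (\<lambda>s. Z1 s = Z2 s) (at 0)"
    using A(1) by (simp add: eventually_cosparse_open_eq)
  \<comment> \<open>So far the two functions agree only in a punctured neighbourhood of 0, because
    meromorphy does not fix values at isolated points. Analyticity at 0 supplies the missing value
    through continuity.\<close>
  have "isCont Z1 0" "isCont Z2 0" using assms by (auto simp: zeta_continuation_def intro: analytic_at_imp_isCont)
  then have "Z2 \<midarrow>0\<rightarrow> Z1 0" "Z2 \<midarrow>0\<rightarrow> Z2 0" using tendsto_cong[OF ev] by (auto simp: isCont_def)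
  then have "Z1 0 = Z2 0" by (rule LIM_unique)
  then have "eventually (\<lambda>s. Z1 s = Z2 s) (nhds 0)" using ev by (simp add: eventually_nhds_conv_at)
  then show ?thesis by (rule deriv_cong_ev) simp
qed

theorem mainTheorem5:
  fixes q :: ennreal and V y dy :: "real \<Rightarrow> real"
  assumes "1 \<le> q"
    and "memLq q V"
    and "AE x in lborel. x \<in> {0..1} \<longrightarrow> V x \<ge> 0"
    and "ode_sol V 0 y dy" and "y 0 = 0" and "dy 0 = 1"
  shows "(\<exists>Z. zeta_continuation V Z) \<and>
         (\<forall>Z. zeta_continuation V Z \<longrightarrow> exp (- deriv Z 0) = complex_of_real (2 * y 1))"
proof -
  interpret nonneg_potential V
    by (intro nonneg_potential.intro potential.intro nonneg_potential_axioms.intro memLq_imp_integrable[OF assms(1,2)] assms(3))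
  have D0: "sol 0 1 = of_real (y 1)" by (rule ode_sol_eq_sol[OF assms(4-6)])
  then have y1: "y 1 > 0" using sol_0_pos by auto
  from eigenvalue_enumeration[OF D0 y1] obtain e C where
    e: "bij_betw e (UNIV::nat set) (dirichlet_eigenvalues V)" and e': "\<forall>n. e n > 0"
     "\<forall>n. \<bar>e n - (real (Suc n) * pi)\<^sup>2\<bar> \<le> C"
     "(\<lambda>N. \<Prod>n<N. (real (Suc n) * pi)\<^sup>2 / e n) \<longlonglongrightarrow> 1 / y 1"
    by (elim exE conjE) (rule that)
  interpret spectral_sequence e C "y 1" by (rule spectral_sequence.intro[OF e'(1,2)[rule_format] y1 e'(3)])
  from zeta_exists obtain Z where Z: "Z meromorphic_on {s. Re s > -1/2}" "Z analytic_on {0}"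
     "\<And>s. Re s > 1/2 \<Longrightarrow> summable (\<lambda>n. norm (rpow (e n) (- s)))"
     "\<And>s. Re s > 1/2 \<Longrightarrow> (\<lambda>n. rpow (e n) (- s)) sums Z s"
     "deriv Z 0 = of_real (- ln (2 * y 1))"
    by (elim exE conjE) (rule that; auto)
  have "zeta_continuation V Z"
    unfolding zeta_continuation_def
  proof (intro conjI allI impI Z(1,2))
    fix s :: complex assume s: "Re s > 1/2"
    have rpow: "rpow (e n) (- s) = complex_of_real (e n) powr (- s)" for n by (rule rpow_eq_powr[OF e_pos])
    \<comment> \<open>The spectral zeta function is an unordered sum over a set, so convergence in
      the order of the enumeration would not suffice; the absolute convergence from
      \<open>zeta_exists\<close> is used here.\<close>
    have sm: "(\<lambda>n. complex_of_real (e n) powr (- s)) summable_on UNIV"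
      using norm_summable_imp_summable_on[OF Z(3)[OF s]] by (simp only: rpow)
    then show "(\<lambda>lam. complex_of_real lam powr (- s)) summable_on dirichlet_eigenvalues V"
      using summable_on_reindex_bij_betw[OF e, of "\<lambda>lam. complex_of_real lam powr (- s)"] by blast
    have "spectral_zeta V s = (\<Sum>\<^sub>\<infinity>n. complex_of_real (e n) powr (- s))"
      unfolding spectral_zeta_def using infsum_reindex_bij_betw[OF e, of "\<lambda>lam. complex_of_real lam powr (- s)"] by simp
    moreover have "(\<lambda>n. complex_of_real (e n) powr (- s)) sums (\<Sum>\<^sub>\<infinity>n. complex_of_real (e n) powr (- s))"
      by (rule has_sum_imp_sums[OF has_sum_infsum[OF sm]])
    ultimately show "Z s = spectral_zeta V s" using sums_unique2[OF Z(4)[OF s, unfolded rpow]] by simp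
  qed
  moreover have "exp (- deriv Z' 0) = complex_of_real (2 * y 1)" if "zeta_continuation V Z'" for Z'
  proof -
    have "- deriv Z' 0 = of_real (ln (2 * y 1))"
      using zeta_continuation_deriv_unique[OF that \<open>zeta_continuation V Z\<close>] Z(5) by simp
    then show ?thesis using y1 by (simp only: exp_of_real) simp
  qed
  ultimately show ?thesis by blast
qed

end
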